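(* Work over $\mathbb{Q}$. Every multilinear polynomial identity of degree 7 satisfied by the tetrad $\{a,b,c,d\}=abcd+dcba$ in every associative algebra is a consequence of the symmetry $\{a,b,c,d\}\equiv\{d,c,b,a\}$ and the following three identities of the tetrad in degree 7: (1) $\{\{a,b,c,d\},e,f,g\}+\{\{a,b,f,e\},d,c,g\}+\{\{d,c,f,e\},a,b,g\}-\{g,\{b,a,d,c\},f,e\}-\{g,\{b,a,e,f\},c,d\}-\{g,\{c,d,e,f\},b,a\}\equiv 0$; (2) $\{\{a,b,c,d\},e,f,g\}-\{\{a,b,g,f\},e,c,d\}+\{\{a,b,d,c\},e,g,f\}-\{\{a,b,f,g\},e,d,c\}+\{\{a,e,c,d\},b,g,f\}-\{\{a,e,g,f\},b,d,c\}+\{\{a,e,d,c\},b,f,g\}-\{\{a,e,f,g\},b,c,d\}-\{a,\{b,c,d,e\},f,g\}+\{a,\{b,g,f,e\},c,d\}-\{a,\{b,d,c,e\},g,f\}+\{a,\{b,f,g,e\},d,c\}\equiv 0$; (3) $\{\{a,b,c,d\},e,f,g\}-\{\{a,f,g,c\},b,e,d\}+\{\{c,b,a,d\},e,g,f\}+\{\{f,b,c,e\},g,a,d\}-\{\{f,g,a,e\},c,b,d\}-\{\{f,g,a,d\},b,c,e\}-\{\{f,g,e,d\},a,b,c\}+\{\{g,b,a,e\},f,c,d\}-\{\{g,f,c,e\},a,b,d\}-\{\{g,f,c,d\},b,a,e\}-\{\{g,f,e,d\},c,b,a\}+\{\{e,a,b,d\},c,f,g\}+\{\{e,c,b,d\},a,g,f\}+\{a,\{b,c,g,f\},e,d\}+\{c,\{b,a,f,g\},e,d\}-\{f,\{b,c,e,g\},a,d\}-\{g,\{b,a,e,f\},c,d\}+\{e,\{a,g,f,c\},b,d\}\equiv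 0$.
   Context: A quaternary algebra is a vector space with one quadrilinear operation $\{-,-,-,-\}$. A multilinear polynomial of degree 7 is a linear combination of nonassociative monomials in which two operation symbols are applied to seven distinct variables $a,\dots,g$, each occurring exactly once. Such a polynomial $I$ is an identity satisfied by the tetrad if it vanishes in the free associative algebra when every occurrence of the operation is expanded by $\{x,y,z,w\}=xyzw+wzyx$ (equivalently, $I\equiv0$ in every associative algebra with the tetrad as operation). An identity $I$ is a consequence of a set $S$ of identities if every quaternary algebra satisfying all identities in $S$ also satisfies $I$. The symbol $\equiv$ means equality for all values of the arguments. *)

theory Defs
  imports Complex_Main "HOL-Library.Poly_Mapping"
begin

locale quaternary_algebra = vector_space scale
  for scale :: "rat \<Rightarrow> 'a::ab_group_add \<Rightarrow> 'a" +
  fixes quad :: "'a \<Rightarrow> 'a \<Rightarrow> 'a \<Rightarrow> 'a \<Rightarrow> 'a"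
  assumes linear_arg1: "Vector_Spaces.linear scale scale (\<lambda>u. quad u y z w)"
    and linear_arg2: "Vector_Spaces.linear scale scale (\<lambda>u. quad x u z w)"
    and linear_arg3: "Vector_Spaces.linear scale scale (\<lambda>u. quad x y u w)"
    and linear_arg4: "Vector_Spaces.linear scale scale (\<lambda>u. quad x y z u)"

datatype 'x quad_monomial =
    Var 'x
  | Quad "'x quad_monomial" "'x quad_monomial" "'x quad_monomial" "'x quad_monomial"
      (\<open>\<lbrace>_, _, _, _\<rbrace>\<close>)

type_synonym 'x quad_poly = "'x quad_monomial \<Rightarrow>\<^sub>0 rat"

abbreviation monomial_poly :: "'x quad_monomial \<Rightarrow> 'x quad_poly" (\<open>\<langle>_\<rangle>\<close>) where
  "\<langle>m\<rangle> \<equiv> Poly_Mapping.single m 1"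

primrec leaves :: "'x quad_monomial \<Rightarrow> 'x list" where
  "leaves (Var x) = [x]"
| "leaves \<lbrace>p, q, r, s\<rbrace> = leaves p @ leaves q @ leaves r @ leaves s"

primrec eval_monomial ::
  "('a \<Rightarrow> 'a \<Rightarrow> 'a \<Rightarrow> 'a \<Rightarrow> 'a) \<Rightarrow> ('x \<Rightarrow> 'a) \<Rightarrow> 'x quad_monomial \<Rightarrow> 'a" where
  "eval_monomial quad \<rho> (Var x) = \<rho> x"
| "eval_monomial quad \<rho> \<lbrace>p, q, r, s\<rbrace> =
     quad (eval_monomial quad \<rho> p) (eval_monomial quad \<rho> q)
          (eval_monomial quad \<rho> r) (eval_monomial quad \<rho> s)"

definition eval_poly ::
  "(rat \<Rightarrow> 'a::ab_group_add \<Rightarrow> 'a) \<Rightarrow> ('a \<Rightarrow> 'a \<Rightarrow> 'a \<Rightarrow> 'a \<Rightarrow> 'a) \<Rightarrow> ('x \<Rightarrow> 'a)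
   \<Rightarrow> 'x quad_poly \<Rightarrow> 'a" where
  "eval_poly scale quad \<rho> p =
     (\<Sum>m\<in>Poly_Mapping.keys p. scale (Poly_Mapping.lookup p m) (eval_monomial quad \<rho> m))"

definition satisfies ::
  "(rat \<Rightarrow> 'a::ab_group_add \<Rightarrow> 'a) \<Rightarrow> ('a \<Rightarrow> 'a \<Rightarrow> 'a \<Rightarrow> 'a \<Rightarrow> 'a) \<Rightarrow> 'x quad_poly \<Rightarrow> bool" where
  "satisfies scale quad p \<longleftrightarrow> (\<forall>\<rho>. eval_poly scale quad \<rho> p = 0)"

text \<open>
  HOL cannot quantify over types inside a formula, so the carrier type of the quaternary
  algebras is an explicit argument.  A theorem stating \<open>consequence TYPE('a) S p\<close> for a free type
  variable \<open>'a\<close> speaks about all quaternary algebras.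
\<close>

definition consequence ::
  "'a::ab_group_add itself \<Rightarrow> 'x quad_poly set \<Rightarrow> 'x quad_poly \<Rightarrow> bool" where
  "consequence _ S p \<longleftrightarrow>
     (\<forall>(scale :: rat \<Rightarrow> 'a \<Rightarrow> 'a) quad.
        quaternary_algebra scale quad \<longrightarrow> (\<forall>s\<in>S. satisfies scale quad s) \<longrightarrow> satisfies scale quad p)"

datatype var7 = Xa | Xb | Xc | Xd | Xe | Xf | Xg

text \<open>
  A monomial with seven leaves contains exactly two operation symbols, as each of them
  increases the number of leaves by three.
\<close>

definition multilinear7 :: "var7 quad_poly \<Rightarrow> bool" where
  "multilinear7 p \<longleftrightarrow>
     (\<forall>m\<in>Poly_Mapping.keys p. distinct (leaves m) \<and> set (leaves m) = UNIV)"

datatype 'x word = Word (letters: "'x list")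

instantiation word :: (type) monoid_add
begin

definition zero_word :: "'a word" where "0 = Word []"

definition plus_word :: "'a word \<Rightarrow> 'a word \<Rightarrow> 'a word" where
  "u + v = Word (letters u @ letters v)"

instance
  by standard (simp_all add: zero_word_def plus_word_def)

end

text \<open>
  The free monoid of words is written additively because multiplication of finitely supported
  functions is convolution along \<open>+\<close> on the keys; so the ring structure of the following type
  is that of the free unital associative algebra over the rationals.
\<close>

type_synonym 'x free_algebra = "'x word \<Rightarrow>\<^sub>0 rat"

definition scale_free :: "rat \<Rightarrow> 'x free_algebra \<Rightarrow> 'x free_algebra" where
  "scale_free c = Poly_Mapping.map ((*) c)"

definition generator :: "'x \<Rightarrow> 'x free_algebra" where
  "generator x = Poly_Mapping.single (Word [x]) 1"

definition tetrad :: "'r \<Rightarrow> 'r \<Rightarrow> 'r \<Rightarrow> 'r \<Rightarrow> 'r::ring" where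
  "tetrad x y z w = x * y * z * w + w * z * y * x"

definition tetrad_identity :: "'x quad_poly \<Rightarrow> bool" where
  "tetrad_identity p \<longleftrightarrow> eval_poly scale_free tetrad generator p = 0"

definition tetrad_symmetry ::
  "'x quad_monomial \<Rightarrow> 'x quad_monomial \<Rightarrow> 'x quad_monomial \<Rightarrow> 'x quad_monomial \<Rightarrow> 'x quad_poly" where
  "tetrad_symmetry a b c d = \<langle>\<lbrace>a, b, c, d\<rbrace>\<rangle> - \<langle>\<lbrace>d, c, b, a\<rbrace>\<rangle>"

definition tetrad_id1 ::
  "'x quad_monomial \<Rightarrow> 'x quad_monomial \<Rightarrow> 'x quad_monomial \<Rightarrow> 'x quad_monomial \<Rightarrow>
   'x quad_monomial \<Rightarrow> 'x quad_monomial \<Rightarrow> 'x quad_monomial \<Rightarrow> 'x quad_poly" where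
  "tetrad_id1 a b c d e f g =
      \<langle>\<lbrace>\<lbrace>a, b, c, d\<rbrace>, e, f, g\<rbrace>\<rangle> + \<langle>\<lbrace>\<lbrace>a, b, f, e\<rbrace>, d, c, g\<rbrace>\<rangle>
      + \<langle>\<lbrace>\<lbrace>d, c, f, e\<rbrace>, a, b, g\<rbrace>\<rangle> - \<langle>\<lbrace>g, \<lbrace>b, a, d, c\<rbrace>, f, e\<rbrace>\<rangle>
      - \<langle>\<lbrace>g, \<lbrace>b, a, e, f\<rbrace>, c, d\<rbrace>\<rangle> - \<langle>\<lbrace>g, \<lbrace>c, d, e, f\<rbrace>, b, a\<rbrace>\<rangle>"

definition tetrad_id2 ::
  "'x quad_monomial \<Rightarrow> 'x quad_monomial \<Rightarrow> 'x quad_monomial \<Rightarrow> 'x quad_monomial \<Rightarrow>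
   'x quad_monomial \<Rightarrow> 'x quad_monomial \<Rightarrow> 'x quad_monomial \<Rightarrow> 'x quad_poly" where
  "tetrad_id2 a b c d e f g =
      \<langle>\<lbrace>\<lbrace>a, b, c, d\<rbrace>, e, f, g\<rbrace>\<rangle> - \<langle>\<lbrace>\<lbrace>a, b, g, f\<rbrace>, e, c, d\<rbrace>\<rangle>
      + \<langle>\<lbrace>\<lbrace>a, b, d, c\<rbrace>, e, g, f\<rbrace>\<rangle> - \<langle>\<lbrace>\<lbrace>a, b, f, g\<rbrace>, e, d, c\<rbrace>\<rangle>
      + \<langle>\<lbrace>\<lbrace>a, e, c, d\<rbrace>, b, g, f\<rbrace>\<rangle> - \<langle>\<lbrace>\<lbrace>a, e, g, f\<rbrace>, b, d, c\<rbrace>\<rangle>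
      + \<langle>\<lbrace>\<lbrace>a, e, d, c\<rbrace>, b, f, g\<rbrace>\<rangle> - \<langle>\<lbrace>\<lbrace>a, e, f, g\<rbrace>, b, c, d\<rbrace>\<rangle>
      - \<langle>\<lbrace>a, \<lbrace>b, c, d, e\<rbrace>, f, g\<rbrace>\<rangle> + \<langle>\<lbrace>a, \<lbrace>b, g, f, e\<rbrace>, c, d\<rbrace>\<rangle>
      - \<langle>\<lbrace>a, \<lbrace>b, d, c, e\<rbrace>, g, f\<rbrace>\<rangle> + \<langle>\<lbrace>a, \<lbrace>b, f, g, e\<rbrace>, d, c\<rbrace>\<rangle>"

definition tetrad_id3 ::
  "'x quad_monomial \<Rightarrow> 'x quad_monomial \<Rightarrow> 'x quad_monomial \<Rightarrow> 'x quad_monomial \<Rightarrow>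
   'x quad_monomial \<Rightarrow> 'x quad_monomial \<Rightarrow> 'x quad_monomial \<Rightarrow> 'x quad_poly" where
  "tetrad_id3 a b c d e f g =
      \<langle>\<lbrace>\<lbrace>a, b, c, d\<rbrace>, e, f, g\<rbrace>\<rangle> - \<langle>\<lbrace>\<lbrace>a, f, g, c\<rbrace>, b, e, d\<rbrace>\<rangle>
      + \<langle>\<lbrace>\<lbrace>c, b, a, d\<rbrace>, e, g, f\<rbrace>\<rangle> + \<langle>\<lbrace>\<lbrace>f, b, c, e\<rbrace>, g, a, d\<rbrace>\<rangle>
      - \<langle>\<lbrace>\<lbrace>f, g, a, e\<rbrace>, c, b, d\<rbrace>\<rangle> - \<langle>\<lbrace>\<lbrace>f, g, a, d\<rbrace>, b, c, e\<rbrace>\<rangle>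
      - \<langle>\<lbrace>\<lbrace>f, g, e, d\<rbrace>, a, b, c\<rbrace>\<rangle> + \<langle>\<lbrace>\<lbrace>g, b, a, e\<rbrace>, f, c, d\<rbrace>\<rangle>
      - \<langle>\<lbrace>\<lbrace>g, f, c, e\<rbrace>, a, b, d\<rbrace>\<rangle> - \<langle>\<lbrace>\<lbrace>g, f, c, d\<rbrace>, b, a, e\<rbrace>\<rangle>
      - \<langle>\<lbrace>\<lbrace>g, f, e, d\<rbrace>, c, b, a\<rbrace>\<rangle> + \<langle>\<lbrace>\<lbrace>e, a, b, d\<rbrace>, c, f, g\<rbrace>\<rangle>
      + \<langle>\<lbrace>\<lbrace>e, c, b, d\<rbrace>, a, g, f\<rbrace>\<rangle> + \<langle>\<lbrace>a, \<lbrace>b, c, g, f\<rbrace>, e, d\<rbrace>\<rangle>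
      + \<langle>\<lbrace>c, \<lbrace>b, a, f, g\<rbrace>, e, d\<rbrace>\<rangle> - \<langle>\<lbrace>f, \<lbrace>b, c, e, g\<rbrace>, a, d\<rbrace>\<rangle>
      - \<langle>\<lbrace>g, \<lbrace>b, a, e, f\<rbrace>, c, d\<rbrace>\<rangle> + \<langle>\<lbrace>e, \<lbrace>a, g, f, c\<rbrace>, b, d\<rbrace>\<rangle>"

definition tetrad_id_set :: "var7 quad_poly set" where
  "tetrad_id_set =
     {tetrad_symmetry (Var Xa) (Var Xb) (Var Xc) (Var Xd),
      tetrad_id1 (Var Xa) (Var Xb) (Var Xc) (Var Xd) (Var Xe) (Var Xf) (Var Xg),
      tetrad_id2 (Var Xa) (Var Xb) (Var Xc) (Var Xd) (Var Xe) (Var Xf) (Var Xg),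
      tetrad_id3 (Var Xa) (Var Xb) (Var Xc) (Var Xd) (Var Xe) (Var Xf) (Var Xg)}"

end

(*
  Identify every word of degree 7 with its reversal.  Up to the symmetries of the tetrad,
  {{a,b,c,d},e,f,g} then expands to abcdefg + dcbaefg and {a,{b,c,d,e},f,g} expands to
  abcdefg + aedcbfg.  So the monomials are the edges, and the words the vertices, of a graph: the
  Cayley graph of the alternating group A_7 for the four reversals of a block of four consecutive
  positions.  The identities of the tetrad are the edge weightings with sum 0 at every vertex,
  and (1), (2), (3) are closed walks of length 6, 12 and 18 with alternating signs.

  Composing an algebra that satisfies (1)-(3) with a linear functional gives a rational function f
  on the edges.  It annihilates all identities as soon as f(uv) = g(u) + g(v) for a function g on
  the vertices, and g(w) must be half of the alternating sum of f along any closed walk of odd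
  length at w.  Subtract this candidate from f.  The result f' still annihilates (1)-(3), its
  alternating sums along the chosen odd walks vanish, and it remains to show that f' = 0.

  This is a 3-adic descent.  Modulo 3, a single edge is a combination of instances of (1)-(3) and
  of the odd walks.  Hence, if the values of f' are integers divisible by 3^n, then they are
  divisible by 3^(n+1).
*)

theory Submission
  imports Defs "HOL-Number_Theory.Cong"
begin

section \<open>The relations between the two kinds of monomials\<close>

text \<open>The identities hold for all arguments, so it is enough to certify one edge of each of
  the two kinds. Such a certificate is still a linear dependence among 5040 edges. Modulo 3 all its
  coefficients are signs, and checking it is mere counting; the price is the descent.

  The prime 2 would fail. If f(uv) = g(u) + g(v), then f satisfies (1)-(3) and its alternating sum
  along a closed walk of odd length is 2 g(w), so modulo 2 such an f passes every test without being
  0.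

  Divisibility says nothing in a rational vector space, where every vector is divisible by 3. Hence
  a functional is applied, and the elements assigned to the seven letters are fixed beforehand: only
  finitely many rationals then occur, and a common denominator makes them integers.

  A function g on words of degree 7 is a functional on that part of the free algebra. So the form
  g(u) + g(v) says that f depends only on the expansions of the monomials, and f vanishes on
  whatever vanishes in the free algebra.\<close>

text \<open>
  \<open>P a b c d e f g\<close> stands for the monomial \<open>{{a,b,c,d},e,f,g}\<close>, the edge between \<open>abcdefg\<close> and
  \<open>dcbaefg\<close>, and \<open>Q a b c d e f g\<close> for \<open>{a,{b,c,d,e},f,g}\<close>, the edge between \<open>abcdefg\<close> and
  \<open>aedcbfg\<close>.  The alternating sum \<open>walk\<close> runs along a closed walk of length 13 from \<open>abcdefg\<close>, the
  smallest odd length.  In \<open>gauge\<close> it is symmetrized because reversing a word changes the walk.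
\<close>

definition walk ::
  "('v \<Rightarrow> 'v \<Rightarrow> 'v \<Rightarrow> 'v \<Rightarrow> 'v \<Rightarrow> 'v \<Rightarrow> 'v \<Rightarrow> 'b::comm_ring_1) \<Rightarrow>
   ('v \<Rightarrow> 'v \<Rightarrow> 'v \<Rightarrow> 'v \<Rightarrow> 'v \<Rightarrow> 'v \<Rightarrow> 'v \<Rightarrow> 'b) \<Rightarrow>
   'v \<Rightarrow> 'v \<Rightarrow> 'v \<Rightarrow> 'v \<Rightarrow> 'v \<Rightarrow> 'v \<Rightarrow> 'v \<Rightarrow> 'b" where
  "walk P Q a b c d e f g =
     P a b c d e f g - Q d c b a e f g + P g f c b a e d - Q d e a g f c b + P d f g a e c b
     - Q b c e d f g a + P b f d e c g a - Q a g c b f d e + P e d g c b f a - Q c g d e b f a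
     + Q a f g d e b c - P c b f g d e a + Q a e d c b f g"

definition gauge ::
  "('v \<Rightarrow> 'v \<Rightarrow> 'v \<Rightarrow> 'v \<Rightarrow> 'v \<Rightarrow> 'v \<Rightarrow> 'v \<Rightarrow> 'b::comm_ring_1) \<Rightarrow>
   ('v \<Rightarrow> 'v \<Rightarrow> 'v \<Rightarrow> 'v \<Rightarrow> 'v \<Rightarrow> 'v \<Rightarrow> 'v \<Rightarrow> 'b) \<Rightarrow>
   'v \<Rightarrow> 'v \<Rightarrow> 'v \<Rightarrow> 'v \<Rightarrow> 'v \<Rightarrow> 'v \<Rightarrow> 'v \<Rightarrow> 'b" where
  "gauge P Q a b c d e f g = walk P Q a b c d e f g + walk P Q g f e d c b a"

lemma gauge_rev: "gauge P Q g f e d c b a = gauge P Q a b c d e f g"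
  by (simp add: gauge_def add.commute)

text \<open>Letters and coefficients are left general: functionals produce rational values, the
  descent runs over the integers, and the certificates are written in the letters
  \<open>var7\<close>. Two functions suffice for all monomials with two operations, since the
  symmetry moves an inner operation from the fourth place to the first and from the third to the
  second.\<close>

locale tetrad_relations =
  fixes P Q :: "'v \<Rightarrow> 'v \<Rightarrow> 'v \<Rightarrow> 'v \<Rightarrow> 'v \<Rightarrow> 'v \<Rightarrow> 'v \<Rightarrow> 'b::comm_ring_1"
  assumes P_sym: "P d c b a e f g = P a b c d e f g"
    and Q_sym: "Q a e d c b f g = Q a b c d e f g"
    and rel1: "P a b c d e f g + P a b f e d c g + P d c f e a b g
      - Q g b a d c f e - Q g b a e f c d - Q g c d e f b a = 0"
    and rel2: "P a b c d e f g - P a b g f e c d + P a b d c e g f - P a b f g e d c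
      + P a e c d b g f - P a e g f b d c + P a e d c b f g - P a e f g b c d
      - Q a b c d e f g + Q a b g f e c d - Q a b d c e g f + Q a b f g e d c = 0"
    and rel3: "P a b c d e f g - P a f g c b e d + P c b a d e g f + P f b c e g a d
      - P f g a e c b d - P f g a d b c e - P f g e d a b c + P g b a e f c d
      - P g f c e a b d - P g f c d b a e - P g f e d c b a + P e a b d c f g
      + P e c b d a g f + Q a b c g f e d + Q c b a f g e d - Q f b c e g a d
      - Q g b a e f c d + Q e a g f c b d = 0"

locale gauged_relations = tetrad_relations +
  assumes gauge_eq_0: "gauge P Q a b c d e f g = 0"

section \<open>Subtracting the potential\<close>

context tetrad_relations
begin

text \<open>On edge values g(u) + g(v) each of the two walks in \<open>gauge\<close> gives 2 g, so
  \<open>gauge\<close> is 4 g. Multiplying the edge value by 4, instead of dividing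
  \<open>gauge\<close>, avoids denominators.\<close>

definition "P_fix a b c d e f g = 4 * P a b c d e f g - gauge P Q a b c d e f g - gauge P Q d c b a e f g"

definition "Q_fix a b c d e f g = 4 * Q a b c d e f g - gauge P Q a b c d e f g - gauge P Q a e d c b f g"

text \<open>Telescoping: consecutive edges of the walk have opposite signs, so the subtracted values
  cancel at every vertex except the start. There the first and the last edge have the same sign
  because the length is odd, which leaves twice the \<open>gauge\<close>. \<open>gauge_rev\<close>
  identifies a word with its reversal where an edge is read backwards.\<close>

lemma walk_fix:
  "walk P_fix Q_fix a b c d e f g = 4 * walk P Q a b c d e f g - 2 * gauge P Q a b c d e f g"
  unfolding walk_def[of P_fix] walk_def[of P] P_fix_def Q_fix_def
  by (simp add: algebra_simps gauge_rev)

text \<open>Adding \<open>walk_fix\<close> for a word and for its reversal gives 4 - 2 - 2 = 0 times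
  the \<open>gauge\<close>. The two \<open>gauge\<close> terms are merged by
  \<open>gauge_rev\<close> before \<open>gauge\<close> is unfolded.\<close>

lemma gauge_fix: "gauge P_fix Q_fix a b c d e f g = 0"
  unfolding gauge_def[of P_fix] walk_fix
  by (simp add: algebra_simps gauge_rev) (simp add: gauge_def algebra_simps)

text \<open>Along a closed walk of even length with alternating signs the subtracted values g(u) +
  g(v) cancel at every vertex, the start included. So in each relation only 4 times the original one
  remains.\<close>

lemma gauged_relations_fix: "gauged_relations P_fix Q_fix"
proof unfold_locales
  fix a b c d e f g
  show "P_fix d c b a e f g = P_fix a b c d e f g"
    by (simp add: P_fix_def P_sym)
  show "Q_fix a e d c b f g = Q_fix a b c d e f g"
    by (simp add: Q_fix_def Q_sym)
  show "P_fix a b c d e f g + P_fix a b f e d c g + P_fix d c f e a b g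
      - Q_fix g b a d c f e - Q_fix g b a e f c d - Q_fix g c d e f b a = 0"
    unfolding P_fix_def Q_fix_def
    using arg_cong[OF rel1[of a b c d e f g], of "\<lambda>x. 4 * x"]
    by (simp add: algebra_simps gauge_rev)
  show "P_fix a b c d e f g - P_fix a b g f e c d + P_fix a b d c e g f - P_fix a b f g e d c
      + P_fix a e c d b g f - P_fix a e g f b d c + P_fix a e d c b f g - P_fix a e f g b c d
      - Q_fix a b c d e f g + Q_fix a b g f e c d - Q_fix a b d c e g f + Q_fix a b f g e d c = 0"
    unfolding P_fix_def Q_fix_def
    using arg_cong[OF rel2[of a b c d e f g], of "\<lambda>x. 4 * x"]
    by (simp add: algebra_simps gauge_rev)
  show "P_fix a b c d e f g - P_fix a f g c b e d + P_fix c b a d e g f + P_fix f b c e g a d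
      - P_fix f g a e c b d - P_fix f g a d b c e - P_fix f g e d a b c + P_fix g b a e f c d
      - P_fix g f c e a b d - P_fix g f c d b a e - P_fix g f e d c b a + P_fix e a b d c f g
      + P_fix e c b d a g f + Q_fix a b c g f e d + Q_fix c b a f g e d - Q_fix f b c e g a d
      - Q_fix g b a e f c d + Q_fix e a g f c b d = 0"
    unfolding P_fix_def Q_fix_def
    using arg_cong[OF rel3[of a b c d e f g], of "\<lambda>x. 4 * x"]
    by (simp add: algebra_simps gauge_rev)
  show "gauge P_fix Q_fix a b c d e f g = 0"
    by (rule gauge_fix)
qed

end

text \<open>The relations are universally quantified over letters, so they survive every
  relabelling, injective or not. This lets a statement about the letters \<open>Xa\<close> to
  \<open>Xg\<close> speak about all arguments.\<close>

lemma (in tetrad_relations) tetrad_relations_subst: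
  "tetrad_relations (\<lambda>a b c d e f g. P (s a) (s b) (s c) (s d) (s e) (s f) (s g))
     (\<lambda>a b c d e f g. Q (s a) (s b) (s c) (s d) (s e) (s f) (s g))"
  by unfold_locales (fact P_sym Q_sym rel1 rel2 rel3)+

lemma (in gauged_relations) gauged_relations_subst:
  "gauged_relations (\<lambda>a b c d e f g. P (s a) (s b) (s c) (s d) (s e) (s f) (s g))
     (\<lambda>a b c d e f g. Q (s a) (s b) (s c) (s d) (s e) (s f) (s g))"
proof -
  interpret sub: tetrad_relations
    "\<lambda>a b c d e f g. P (s a) (s b) (s c) (s d) (s e) (s f) (s g)"
    "\<lambda>a b c d e f g. Q (s a) (s b) (s c) (s d) (s e) (s f) (s g)"
    by (rule tetrad_relations_subst)
  show ?thesis
    using gauge_eq_0[unfolded gauge_def walk_def]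
    by unfold_locales (simp add: gauge_def walk_def)
qed

section \<open>Evaluating integer combinations of relations modulo 3\<close>

text \<open>Residues modulo 3 in balanced form: with three constructors, the arithmetic of
  coefficients becomes pattern matching.\<close>

datatype digit = Zero | Plus | Minus

primrec digit_val :: "digit \<Rightarrow> int" where
  "digit_val Zero = 0"
| "digit_val Plus = 1"
| "digit_val Minus = -1"

primrec neg :: "digit \<Rightarrow> digit" where
  "neg Zero = Zero"
| "neg Plus = Minus"
| "neg Minus = Plus"

fun digit_add :: "digit \<Rightarrow> digit \<Rightarrow> digit" where
  "digit_add Zero y = y"
| "digit_add Plus Zero = Plus"
| "digit_add Plus Plus = Minus"
| "digit_add Plus Minus = Zero"
| "digit_add Minus Zero = Minus"
| "digit_add Minus Plus = Zero"
| "digit_add Minus Minus = Plus"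

lemma digit_val_neg: "digit_val (neg s) = - digit_val s"
  by (cases s) auto

lemma digit_val_add: "[digit_val (digit_add s t) = digit_val s + digit_val t] (mod 3)"
  by (cases s; cases t) (auto simp: cong_def)

text \<open>A list of coefficients indexed by the last four letters of a term. The second and third
  letters select a position in the nested nodes of \<open>table\<close>, and the first letter is
  fixed for each table.\<close>

datatype bag = Nothing | Entry digit var7 var7 var7 var7 bag

primrec bag_val :: "(var7 \<Rightarrow> var7 \<Rightarrow> var7 \<Rightarrow> var7 \<Rightarrow> int) \<Rightarrow> bag \<Rightarrow> int" where
  "bag_val h Nothing = 0"
| "bag_val h (Entry s d e f g b) = digit_val s * h d e f g + bag_val h b"

text \<open>An entry whose coefficient becomes 0 is deleted, so complete cancellation restores
  \<open>empty_table\<close> literally and can be tested by an equation between tables.\<close>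

fun bag_add :: "digit \<Rightarrow> var7 \<Rightarrow> var7 \<Rightarrow> var7 \<Rightarrow> var7 \<Rightarrow> bag \<Rightarrow> bag" where
  "bag_add s d e f g Nothing = Entry s d e f g Nothing"
| "bag_add s d e f g (Entry t d' e' f' g' b) =
     (if d = d' \<and> e = e' \<and> f = f' \<and> g = g'
      then (case digit_add s t of
          Zero \<Rightarrow> b | Plus \<Rightarrow> Entry Plus d e f g b | Minus \<Rightarrow> Entry Minus d e f g b)
      else Entry t d' e' f' g' (bag_add s d e f g b))"

lemma bag_add_match:
  "bag_val h (case digit_add s t of
      Zero \<Rightarrow> b | Plus \<Rightarrow> Entry Plus d e f g b | Minus \<Rightarrow> Entry Minus d e f g b)
   = digit_val (digit_add s t) * h d e f g + bag_val h b"
  by (simp split: digit.split)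

text \<open>Coefficients are right only modulo 3, but they multiply values divisible by
  \<open>q\<close>, so the error is a multiple of \<open>3 * q\<close>. This is the factor 3 gained
  in each step of the descent.\<close>

lemma bag_val_add:
  assumes "\<And>d e f g. q dvd h d e f g"
  shows "[bag_val h (bag_add s d e f g b) = digit_val s * h d e f g + bag_val h b] (mod 3 * q)"
proof (induction b)
  case (Entry t d' e' f' g' b)
  show ?case
  proof (cases "d = d' \<and> e = e' \<and> f = f' \<and> g = g'")
    case True
    have "[digit_val (digit_add s t) * h d e f g = (digit_val s + digit_val t) * h d e f g] (mod 3 * q)"
      using digit_val_add[of s t] assms[of d e f g]
      by (auto simp: cong_iff_dvd_diff left_diff_distrib[symmetric] intro: mult_dvd_mono)
    from cong_add[OF this cong_refl[of "bag_val h b"]] show ?thesis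
      using True by (simp add: bag_add_match algebra_simps)
  next
    case False
    then show ?thesis
      using cong_add[OF cong_refl[of "digit_val t * h d' e' f' g'"] Entry] 
      by (auto simp: algebra_simps)
  qed
qed simp

datatype 'a node = Node 'a 'a 'a 'a 'a 'a 'a

primrec node_val :: "(var7 \<Rightarrow> 'a \<Rightarrow> int) \<Rightarrow> 'a node \<Rightarrow> int" where
  "node_val h (Node p q r s t u v) =
     h Xa p + h Xb q + h Xc r + h Xd s + h Xe t + h Xf u + h Xg v"

fun node_map :: "('a \<Rightarrow> 'a) \<Rightarrow> var7 \<Rightarrow> 'a node \<Rightarrow> 'a node" where
  "node_map F Xa (Node p q r s t u v) = Node (F p) q r s t u v"
| "node_map F Xb (Node p q r s t u v) = Node p (F q) r s t u v"
| "node_map F Xc (Node p q r s t u v) = Node p q (F r) s t u v"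
| "node_map F Xd (Node p q r s t u v) = Node p q r (F s) t u v"
| "node_map F Xe (Node p q r s t u v) = Node p q r s (F t) u v"
| "node_map F Xf (Node p q r s t u v) = Node p q r s t (F u) v"
| "node_map F Xg (Node p q r s t u v) = Node p q r s t u (F v)"

lemma node_val_map:
  assumes "\<And>p. [h x (F p) = k + h x p] (mod m)"
  shows "[node_val h (node_map F x t) = k + node_val h t] (mod m)"
proof (cases t)
  case (Node p q r s t u v)
  then show ?thesis
    using assms by (cases x) (auto simp: cong_iff_dvd_diff algebra_simps)
qed

datatype entry = Item digit var7 var7 var7 var7 var7 var7

primrec entry_val :: "(var7 \<Rightarrow> var7 \<Rightarrow> var7 \<Rightarrow> var7 \<Rightarrow> var7 \<Rightarrow> var7 \<Rightarrow> int) \<Rightarrow> entry \<Rightarrow> int" where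
  "entry_val h (Item s b c d e f g) = digit_val s * h b c d e f g"

type_synonym table = "bag node node"

definition table_val ::
  "(var7 \<Rightarrow> var7 \<Rightarrow> var7 \<Rightarrow> var7 \<Rightarrow> var7 \<Rightarrow> var7 \<Rightarrow> int) \<Rightarrow> table \<Rightarrow> int" where
  "table_val h = node_val (\<lambda>b. node_val (\<lambda>c. bag_val (h b c)))"

fun insert_all :: "entry list \<Rightarrow> table \<Rightarrow> table" where
  "insert_all [] t = t"
| "insert_all (Item s b c d e f g # xs) t =
     insert_all xs (node_map (node_map (bag_add s d e f g) c) b t)"

lemma table_val_insert_all:
  assumes "\<And>b c d e f g. q dvd h b c d e f g"
  shows "[table_val h (insert_all xs t) = sum_list (map (entry_val h) xs) + table_val h t] (mod 3 * q)"
proof (induction xs t rule: insert_all.induct)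
  case (2 s b c d e f g xs t)
  have "[table_val h (node_map (node_map (bag_add s d e f g) c) b t)
      = digit_val s * h b c d e f g + table_val h t] (mod 3 * q)"
    unfolding table_val_def by (intro node_val_map bag_val_add assms)
  from cong_trans[OF 2 cong_add[OF cong_refl this]] show ?case
    by (simp add: algebra_simps)
qed simp

section \<open>Certificates as lists of signed terms\<close>

datatype key =
    KP digit var7 var7 var7 var7 var7 var7 var7
  | KQ digit var7 var7 var7 var7 var7 var7 var7

type_synonym pattern = "var7 list \<Rightarrow> key list"

type_synonym certificate = "(pattern \<times> var7 list list) list"

fun sel_P :: "var7 \<Rightarrow> key list \<Rightarrow> entry list" where
  "sel_P x [] = []"
| "sel_P x (KP s a b c d e f g # ks) = (if x = a then Item s b c d e f g # sel_P x ks else sel_P x ks)"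
| "sel_P x (KQ s a b c d e f g # ks) = sel_P x ks"

fun sel_Q :: "var7 \<Rightarrow> key list \<Rightarrow> entry list" where
  "sel_Q x [] = []"
| "sel_Q x (KQ s a b c d e f g # ks) = (if x = a then Item s b c d e f g # sel_Q x ks else sel_Q x ks)"
| "sel_Q x (KP s a b c d e f g # ks) = sel_Q x ks"

fun collect :: "(key list \<Rightarrow> entry list) \<Rightarrow> pattern \<Rightarrow> var7 list list \<Rightarrow> table \<Rightarrow> table" where
  "collect sel pat [] t = t"
| "collect sel pat (w # ws) t = collect sel pat ws (insert_all (sel (pat w)) t)"

fun collect_all :: "(key list \<Rightarrow> entry list) \<Rightarrow> certificate \<Rightarrow> table \<Rightarrow> table" where
  "collect_all sel [] t = t"
| "collect_all sel ((pat, ws) # C) t = collect_all sel C (collect sel pat ws t)"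

definition empty_table :: table where
  "empty_table = (let n = Node Nothing Nothing Nothing Nothing Nothing Nothing Nothing
     in Node n n n n n n n)"

text \<open>
  The tables are filled separately for each first letter because the cost of one rewriting step
  is proportional to the size of the table.
\<close>

definition cancels :: "(var7 \<Rightarrow> key list \<Rightarrow> entry list) \<Rightarrow> certificate \<Rightarrow> bool" where
  "cancels sel C \<longleftrightarrow>
     list_all (\<lambda>x. collect_all (sel x) C empty_table = empty_table) [Xa, Xb, Xc, Xd, Xe, Xf, Xg]"

definition total :: "(key list \<Rightarrow> int) \<Rightarrow> certificate \<Rightarrow> int" where
  "total v C = (\<Sum>(pat, ws)\<leftarrow>C. \<Sum>w\<leftarrow>ws. v (pat w))"

lemma total_Nil [simp]: "total v [] = 0"
  and total_Cons [simp]: "total v ((pat, ws) # C) = (\<Sum>w\<leftarrow>ws. v (pat w)) + total v C"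
  by (simp_all add: total_def)

lemma total_add: "total (\<lambda>ks. v ks + v' ks) C = total v C + total v' C"
  by (induction C) (auto simp: sum_list_addf)

lemma total_sum: "finite A \<Longrightarrow> total (\<lambda>ks. \<Sum>x\<in>A. v x ks) C = (\<Sum>x\<in>A. total (v x) C)"
proof (induction A rule: finite_induct)
  case empty
  show ?case by (induction C) (auto simp: sum_list_0)
qed (simp add: total_add)

lemma table_val_collect:
  assumes "\<And>b c d e f g. q dvd h b c d e f g"
  shows "[table_val h (collect sel pat ws t) =
      (\<Sum>w\<leftarrow>ws. sum_list (map (entry_val h) (sel (pat w)))) + table_val h t] (mod 3 * q)"
proof (induction ws arbitrary: t)
  case (Cons w ws)
  from cong_trans[OF Cons cong_add[OF cong_refl table_val_insert_all]] assms show ?case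
    by (simp add: algebra_simps)
qed simp

lemma table_val_collect_all:
  assumes "\<And>b c d e f g. q dvd h b c d e f g"
  shows "[table_val h (collect_all sel C t) =
      total (\<lambda>ks. sum_list (map (entry_val h) (sel ks))) C + table_val h t] (mod 3 * q)"
proof (induction C arbitrary: t)
  case (Cons patws C)
  obtain pat ws where "patws = (pat, ws)"
    by (cases patws)
  with cong_trans[OF Cons cong_add[OF cong_refl table_val_collect]] assms show ?case
    by (simp add: algebra_simps)
qed simp

lemma table_val_empty: "table_val h empty_table = 0"
  by (simp add: table_val_def empty_table_def Let_def)

lemma UNIV_var7: "UNIV = {Xa, Xb, Xc, Xd, Xe, Xf, Xg}"
  using var7.exhaust by blast

instance var7 :: finite
  by standard (simp add: UNIV_var7)

text \<open>Cancellation concerns formal coefficients only. Evaluating the tables, one for each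
  first letter \<open>x\<close>, turns it into a congruence between values.\<close>

lemma total_cancels:
  assumes "cancels sel C" and "\<And>a b c d e f g. q dvd T a b c d e f g"
  shows "[total (\<lambda>ks. \<Sum>x\<in>UNIV. sum_list (map (entry_val (T x)) (sel x ks))) C = 0] (mod 3 * q)"
proof -
  have "[total (\<lambda>ks. sum_list (map (entry_val (T x)) (sel x ks))) C = 0] (mod 3 * q)" for x
  proof -
    have "collect_all (sel x) C empty_table = empty_table"
      using assms(1) by (cases x) (auto simp: cancels_def)
    with table_val_collect_all[of q "T x" "sel x" C empty_table] assms(2) show ?thesis
      by (simp add: table_val_empty cong_sym)
  qed
  then have "[(\<Sum>x\<in>UNIV. total (\<lambda>ks. sum_list (map (entry_val (T x)) (sel x ks))) C) = (\<Sum>x\<in>(UNIV :: var7 set). 0)] (mod 3 * q)"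
    by (intro cong_sum)
  then show ?thesis
    by (simp add: total_sum)
qed

section \<open>The certificates\<close>

text \<open>
  The smaller of \<open>a\<close> and \<open>d\<close> (for \<open>Q\<close>, of \<open>b\<close> and \<open>e\<close>) is put in front so that terms that are
  equal by symmetry meet in the tables.
\<close>

fun before :: "var7 \<Rightarrow> var7 \<Rightarrow> bool" where
  "before Xa y = True" | "before x Xa = False"
| "before Xb y = True" | "before x Xb = False"
| "before Xc y = True" | "before x Xc = False"
| "before Xd y = True" | "before x Xd = False"
| "before Xe y = True" | "before x Xe = False"
| "before Xf y = True" | "before Xg y = False"

definition key_P :: "digit \<Rightarrow> var7 \<Rightarrow> var7 \<Rightarrow> var7 \<Rightarrow> var7 \<Rightarrow> var7 \<Rightarrow> var7 \<Rightarrow> var7 \<Rightarrow> key" where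
  "key_P s a b c d e f g = (if before a d then KP s a b c d e f g else KP s d c b a e f g)"

definition key_Q :: "digit \<Rightarrow> var7 \<Rightarrow> var7 \<Rightarrow> var7 \<Rightarrow> var7 \<Rightarrow> var7 \<Rightarrow> var7 \<Rightarrow> var7 \<Rightarrow> key" where
  "key_Q s a b c d e f g = (if before b e then KQ s a b c d e f g else KQ s a e d c b f g)"

fun keys_P :: "digit \<Rightarrow> pattern" where
  "keys_P s [a, b, c, d, e, f, g] =
     [key_P s a b c d e f g]"
| "keys_P s _ = []"

fun keys_Q :: "digit \<Rightarrow> pattern" where
  "keys_Q s [a, b, c, d, e, f, g] =
     [key_Q s a b c d e f g]"
| "keys_Q s _ = []"

fun keys1 :: "digit \<Rightarrow> pattern" where
  "keys1 s [a, b, c, d, e, f, g] =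
     [key_P s a b c d e f g, key_P s a b f e d c g, key_P s d c f e a b g,
      key_Q (neg s) g b a d c f e, key_Q (neg s) g b a e f c d,
      key_Q (neg s) g c d e f b a]"
| "keys1 s _ = []"

fun keys2 :: "digit \<Rightarrow> pattern" where
  "keys2 s [a, b, c, d, e, f, g] =
     [key_P s a b c d e f g, key_P (neg s) a b g f e c d, key_P s a b d c e g f,
      key_P (neg s) a b f g e d c, key_P s a e c d b g f, key_P (neg s) a e g f b d c,
      key_P s a e d c b f g, key_P (neg s) a e f g b c d, key_Q (neg s) a b c d e f g,
      key_Q s a b g f e c d, key_Q (neg s) a b d c e g f, key_Q s a b f g e d c]"
| "keys2 s _ = []"

fun keys3 :: "digit \<Rightarrow> pattern" where
  "keys3 s [a, b, c, d, e, f, g] =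
     [key_P s a b c d e f g, key_P (neg s) a f g c b e d, key_P s c b a d e g f,
      key_P s f b c e g a d, key_P (neg s) f g a e c b d, key_P (neg s) f g a d b c e,
      key_P (neg s) f g e d a b c, key_P s g b a e f c d, key_P (neg s) g f c e a b d,
      key_P (neg s) g f c d b a e, key_P (neg s) g f e d c b a, key_P s e a b d c f g,
      key_P s e c b d a g f, key_Q s a b c g f e d, key_Q s c b a f g e d,
      key_Q (neg s) f b c e g a d, key_Q (neg s) g b a e f c d, key_Q s e a g f c b d]"
| "keys3 s _ = []"

fun keys_gauge :: "digit \<Rightarrow> pattern" where
  "keys_gauge s [a, b, c, d, e, f, g] =
     [key_P s a b c d e f g, key_Q (neg s) d c b a e f g, key_P s g f c b a e d,
      key_Q (neg s) d e a g f c b, key_P s d f g a e c b, key_Q (neg s) b c e d f g a,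
      key_P s b f d e c g a, key_Q (neg s) a g c b f d e, key_P s e d g c b f a,
      key_Q (neg s) c g d e b f a, key_Q s a f g d e b c, key_P (neg s) c b f g d e a,
      key_Q s a e d c b f g, key_P s g f e d c b a, key_Q (neg s) d e f g c b a,
      key_P s a b e f g c d, key_Q (neg s) d c g a b e f, key_P s d b a g c e f,
      key_Q (neg s) f e c d b a g, key_P s f b d c e a g, key_Q (neg s) g a e f b d c,
      key_P s c d a e f b g, key_Q (neg s) e a d c f b g, key_Q s g b a d c f e,
      key_P (neg s) e f b a d c g, key_Q s g c d e f b a]"
| "keys_gauge s _ = []"

text \<open>
  A word in a list paired with \<open>keys1\<close>, \<open>keys2\<close> or \<open>keys3\<close> is the argument list of an instance of
  identity (1), (2) or (3).  The lists come from solving linear systems over the field with three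
  elements by Gaussian elimination, followed by a local search for a solution with few terms.
  \<open>cert_P\<close> reduces \<open>P a b c d e f g\<close> to 0 modulo 3; \<open>cert_Q\<close> reduces \<open>Q a b c d e f g\<close> to terms of
  the form \<open>P\<close>.
\<close>

context
begin

private abbreviation (input) "A \<equiv> Xa"
private abbreviation (input) "B \<equiv> Xb"
private abbreviation (input) "C \<equiv> Xc"
private abbreviation (input) "D \<equiv> Xd"
private abbreviation (input) "E \<equiv> Xe"
private abbreviation (input) "F \<equiv> Xf"
private abbreviation (input) "G \<equiv> Xg"

definition "cert_P_1minus0 = [
  [A,B,C,D,E,G,F], [A,B,C,E,F,D,G], [A,B,C,E,F,G,D], [A,B,C,F,E,D,G], [A,B,C,G,E,D,F], [A,B,D,C,E,F,G],
  [A,B,D,C,F,G,E], [A,B,D,G,C,F,E], [A,B,D,G,F,E,C], [A,B,E,F,C,G,D], [A,B,E,G,C,F,D], [A,B,F,D,E,G,C],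
  [A,C,B,D,G,E,F], [A,C,B,E,F,D,G], [A,C,B,E,F,G,D], [A,C,B,F,E,D,G], [A,C,D,B,E,G,F], [A,C,D,B,F,G,E],
  [A,C,D,B,G,F,E], [A,C,D,E,G,F,B], [A,C,D,F,B,E,G], [A,C,D,F,B,G,E], [A,C,D,F,G,E,B], [A,C,D,G,B,E,F],
  [A,C,E,D,B,F,G], [A,C,E,F,B,G,D], [A,C,F,D,E,G,B], [A,D,B,C,G,E,F], [A,D,B,E,F,C,G], [A,D,B,E,F,G,C],
  [A,D,B,F,C,E,G], [A,D,B,F,C,G,E], [A,D,B,F,E,C,G], [A,D,B,F,G,E,C], [A,D,B,G,E,C,F], [A,D,B,G,F,C,E],
  [A,D,C,B,E,F,G], [A,D,C,B,E,G,F], [A,D,C,B,F,E,G], [A,D,C,B,G,E,F]]"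

definition "cert_P_1minus1 = [
  [A,D,E,B,F,G,C], [A,D,E,B,G,F,C], [A,D,E,C,B,F,G], [A,D,E,C,F,G,B], [A,D,E,G,B,F,C], [A,E,B,C,D,F,G],
  [A,E,B,C,D,G,F], [A,E,B,C,G,F,D], [A,E,B,D,C,F,G], [A,E,B,D,F,G,C], [A,E,B,D,G,C,F], [A,E,B,D,G,F,C],
  [A,E,B,F,D,C,G], [A,E,B,F,G,D,C], [A,E,B,G,C,F,D], [A,E,C,B,F,D,G], [A,E,C,B,F,G,D], [A,E,C,B,G,F,D],
  [A,E,C,D,G,F,B], [A,E,C,F,D,G,B], [A,E,C,F,G,D,B], [A,E,C,G,B,F,D], [A,E,D,B,C,G,F], [A,E,D,B,G,F,C],
  [A,E,D,C,B,F,G], [A,E,D,C,B,G,F], [A,E,D,C,F,G,B], [A,E,D,G,B,F,C], [A,E,D,G,C,F,B], [A,E,F,B,C,G,D],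
  [A,E,F,D,C,G,B], [A,F,B,C,E,G,D], [A,F,B,D,E,G,C], [A,F,B,E,C,D,G], [A,F,B,E,D,G,C], [A,F,B,G,E,D,C],
  [A,F,C,B,E,D,G], [A,F,C,D,E,G,B], [A,F,C,E,B,D,G], [A,F,C,E,D,G,B]]"

definition "cert_P_1minus2 = [
  [A,F,C,E,G,D,B], [A,F,C,G,B,E,D], [A,F,D,B,C,G,E], [A,F,D,B,E,G,C], [A,F,D,C,B,E,G], [A,F,D,E,C,G,B],
  [A,F,D,G,C,E,B], [A,F,E,B,D,G,C], [A,G,B,C,D,F,E], [A,G,B,C,F,E,D], [A,G,B,D,E,C,F], [A,G,B,D,E,F,C],
  [A,G,B,D,F,C,E], [A,G,B,D,F,E,C], [A,G,B,E,C,F,D], [A,G,B,E,D,C,F], [A,G,B,E,F,D,C], [A,G,B,F,C,E,D],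
  [A,G,C,B,E,D,F], [A,G,C,B,E,F,D], [A,G,C,B,F,E,D], [A,G,C,D,F,E,B], [A,G,C,E,B,D,F], [A,G,C,E,B,F,D],
  [A,G,C,E,F,D,B], [A,G,C,F,B,E,D], [A,G,C,F,D,E,B], [A,G,D,B,C,F,E], [A,G,D,C,B,F,E], [A,G,D,C,E,F,B],
  [A,G,D,C,F,E,B], [A,G,E,C,D,F,B], [B,A,C,D,E,G,F], [B,A,C,E,D,G,F], [B,A,C,E,F,D,G], [B,A,C,F,D,E,G],
  [B,A,C,F,G,D,E], [B,A,D,C,E,G,F], [B,A,D,C,F,E,G], [B,A,D,C,F,G,E]]"

definition "cert_P_1minus3 = [
  [B,A,D,E,C,F,G], [B,A,D,E,C,G,F], [B,A,D,E,F,G,C], [B,A,D,F,C,G,E], [B,A,E,D,C,G,F], [B,A,E,D,F,G,C],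
  [B,A,E,D,G,F,C], [B,A,E,G,D,F,C], [B,A,F,C,D,G,E], [B,A,F,E,C,G,D], [B,A,F,E,D,G,C], [B,C,A,D,G,E,F],
  [B,C,A,D,G,F,E], [B,C,A,E,F,G,D], [B,C,A,E,G,D,F], [B,C,A,E,G,F,D], [B,C,A,F,D,E,G], [B,C,A,F,E,G,D],
  [B,C,A,G,D,E,F], [B,C,A,G,E,D,F], [B,C,D,E,G,F,A], [B,C,D,F,G,E,A], [B,C,D,G,E,F,A], [B,C,E,D,F,G,A],
  [B,C,E,F,D,G,A], [B,C,E,G,D,F,A], [B,C,F,D,E,G,A], [B,C,F,E,D,G,A], [B,D,A,E,G,F,C], [B,D,A,F,G,C,E],
  [B,D,A,F,G,E,C], [B,D,A,G,F,E,C], [B,D,C,E,G,F,A], [B,D,C,G,E,F,A], [B,D,C,G,F,E,A], [B,D,E,C,G,F,A],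
  [B,D,E,G,C,F,A], [B,D,F,E,C,G,A], [B,E,A,C,G,D,F], [B,E,A,C,G,F,D]]"

definition "cert_P_1minus4 = [
  [B,E,A,D,C,G,F], [B,E,A,D,F,C,G], [B,E,A,D,F,G,C], [B,E,A,D,G,F,C], [B,E,A,F,C,D,G], [B,E,A,F,D,G,C],
  [B,E,C,D,F,G,A], [B,E,D,C,F,G,A], [B,E,F,C,D,G,A], [B,F,A,C,E,D,G], [B,F,A,C,G,D,E], [B,F,A,D,C,G,E],
  [B,F,A,E,G,D,C], [B,F,A,G,D,C,E], [B,F,C,D,G,E,A], [B,F,C,G,E,D,A], [B,G,A,C,F,D,E], [B,G,A,C,F,E,D],
  [B,G,A,E,C,F,D], [B,G,A,E,D,C,F], [B,G,A,E,D,F,C], [B,G,A,E,F,D,C], [B,G,A,F,D,E,C], [B,G,C,D,F,E,A],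
  [B,G,C,F,D,E,A], [B,G,D,E,C,F,A], [B,G,D,F,C,E,A], [C,A,B,D,E,G,F], [C,A,B,D,G,E,F], [C,A,B,E,F,G,D],
  [C,A,B,E,G,D,F], [C,A,B,E,G,F,D], [C,A,B,F,D,E,G], [C,A,B,F,G,D,E], [C,A,B,G,D,E,F], [C,A,B,G,E,F,D],
  [C,A,B,G,F,D,E], [C,A,E,F,D,G,B], [C,A,E,G,D,F,B], [C,B,A,D,E,G,F]]"

definition "cert_P_1minus5 = [
  [C,B,A,D,F,G,E], [C,B,A,E,F,D,G], [C,B,A,E,F,G,D], [C,B,A,F,G,E,D], [C,B,A,G,D,F,E], [C,B,A,G,E,F,D],
  [C,B,A,G,F,D,E], [C,B,E,D,F,G,A], [C,D,A,E,F,B,G], [C,D,A,E,F,G,B], [C,D,A,E,G,B,F], [C,D,A,F,E,B,G],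
  [C,D,A,F,G,B,E], [C,D,A,F,G,E,B], [C,D,A,G,E,F,B], [C,D,B,E,F,G,A], [C,D,B,E,G,F,A], [C,D,B,F,G,E,A],
  [C,E,A,D,F,G,B], [C,E,A,D,G,F,B], [C,E,A,G,D,B,F], [C,E,B,D,G,F,A], [C,F,A,D,E,B,G], [C,F,A,E,D,G,B],
  [C,F,A,E,G,B,D], [C,F,A,E,G,D,B], [C,F,A,G,D,E,B], [C,F,A,G,E,B,D], [C,F,B,E,D,G,A], [C,F,B,E,G,D,A],
  [C,F,B,G,E,D,A], [C,G,A,D,E,B,F], [C,G,A,E,D,B,F], [C,G,A,E,F,B,D], [C,G,A,F,D,B,E], [C,G,B,D,F,E,A],
  [C,G,B,E,D,F,A], [C,G,B,F,D,E,A], [D,A,B,F,E,C,G], [D,A,B,F,G,C,E]]"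

definition "cert_P_1minus6 = [
  [D,A,B,G,E,F,C], [D,A,B,G,F,E,C], [D,A,C,E,F,G,B], [D,A,C,E,G,F,B], [D,B,A,E,F,C,G], [D,B,A,E,F,G,C],
  [D,B,A,E,G,C,F], [D,B,A,F,E,G,C], [D,B,A,G,E,F,C], [D,B,A,G,F,C,E], [D,B,A,G,F,E,C], [D,B,C,E,F,G,A],
  [D,B,C,E,G,F,A], [D,B,C,F,G,E,A], [D,B,C,G,F,E,A], [D,C,A,E,F,G,B], [D,C,A,F,E,B,G], [D,C,A,F,G,E,B],
  [D,C,B,F,E,G,A], [D,C,B,F,G,E,A], [D,C,B,G,E,F,A], [D,E,A,F,G,C,B], [D,E,B,G,F,C,A], [D,F,B,E,G,C,A],
  [D,G,A,E,F,C,B], [D,G,A,F,E,C,B], [D,G,B,E,F,C,A], [E,A,C,G,F,D,B], [E,C,B,F,G,D,A]]"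

definition "cert_P_1plus0 = [
  [A,B,C,D,E,F,G], [A,B,C,D,F,E,G], [A,B,C,D,G,E,F], [A,B,C,E,D,F,G], [A,B,C,E,G,F,D], [A,B,C,F,D,E,G],
  [A,B,C,F,E,G,D], [A,B,C,G,D,F,E], [A,B,C,G,F,E,D], [A,B,D,C,E,G,F], [A,B,D,C,F,E,G], [A,B,D,C,G,E,F],
  [A,B,D,E,F,G,C], [A,B,D,E,G,F,C], [A,B,D,F,C,G,E], [A,B,D,F,E,G,C], [A,B,D,F,G,E,C], [A,B,E,C,F,G,D],
  [A,B,E,D,C,F,G], [A,B,F,D,C,G,E], [A,B,F,E,C,G,D], [A,C,B,D,E,G,F], [A,C,B,D,F,E,G], [A,C,B,D,F,G,E],
  [A,C,B,D,G,F,E], [A,C,B,E,D,G,F], [A,C,B,E,G,D,F], [A,C,B,E,G,F,D], [A,C,B,F,D,E,G], [A,C,B,F,D,G,E],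
  [A,C,B,F,G,D,E], [A,C,B,G,E,D,F], [A,C,B,G,F,E,D], [A,C,D,B,F,E,G], [A,C,D,B,G,E,F], [A,C,D,E,B,F,G],
  [A,C,D,G,B,F,E], [A,C,D,G,F,E,B], [A,C,E,B,D,F,G], [A,C,E,B,G,F,D]]"

definition "cert_P_1plus1 = [
  [A,C,E,D,B,G,F], [A,C,E,D,F,G,B], [A,C,E,D,G,F,B], [A,C,F,E,D,G,B], [A,D,B,C,G,F,E], [A,D,B,E,C,F,G],
  [A,D,B,E,G,C,F], [A,D,B,F,E,G,C], [A,D,B,G,E,F,C], [A,D,B,G,F,E,C], [A,D,C,B,F,G,E], [A,D,C,B,G,F,E],
  [A,D,C,F,B,G,E], [A,D,C,G,B,E,F], [A,D,C,G,B,F,E], [A,D,C,G,E,F,B], [A,D,E,B,C,F,G], [A,D,E,B,C,G,F],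
  [A,D,E,C,B,G,F], [A,D,E,F,B,G,C], [A,D,E,G,C,F,B], [A,D,F,C,E,G,B], [A,D,F,E,B,G,C], [A,E,B,D,F,C,G],
  [A,E,B,F,C,D,G], [A,E,B,F,D,G,C], [A,E,B,G,C,D,F], [A,E,B,G,D,C,F], [A,E,C,B,G,D,F], [A,E,C,D,B,G,F],
  [A,E,C,G,B,D,F], [A,E,C,G,D,F,B], [A,E,D,C,G,F,B], [A,E,D,F,B,G,C], [A,F,B,C,G,E,D], [A,F,B,D,C,E,G],
  [A,F,B,D,C,G,E], [A,F,B,D,G,C,E], [A,F,B,D,G,E,C], [A,F,B,E,C,G,D]]"

definition "cert_P_1plus2 = [
  [A,F,B,G,C,D,E], [A,F,B,G,E,C,D], [A,F,C,B,D,E,G], [A,F,C,B,D,G,E], [A,F,C,B,E,G,D], [A,F,C,D,B,E,G],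
  [A,F,C,D,G,E,B], [A,F,C,E,B,G,D], [A,F,D,C,B,G,E], [A,F,D,C,G,E,B], [A,F,D,G,B,E,C], [A,F,E,B,C,G,D],
  [A,F,E,C,B,G,D], [A,F,E,D,B,G,C], [A,G,B,D,C,F,E], [A,G,B,F,E,C,D], [A,G,B,F,E,D,C], [A,G,C,B,D,E,F],
  [A,G,C,B,D,F,E], [A,G,C,E,D,F,B], [A,G,C,F,B,D,E], [A,G,C,F,E,D,B], [A,G,D,B,C,E,F], [A,G,D,E,B,F,C],
  [A,G,D,E,C,F,B], [A,G,D,F,B,E,C], [A,G,D,F,C,E,B], [A,G,E,B,C,F,D], [A,G,E,B,D,F,C], [A,G,E,C,B,F,D],
  [A,G,E,D,B,F,C], [B,A,C,D,G,F,E], [B,A,C,E,D,F,G], [B,A,C,E,F,G,D], [B,A,C,F,D,G,E], [B,A,C,G,D,F,E],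
  [B,A,C,G,E,D,F], [B,A,C,G,E,F,D], [B,A,D,F,C,E,G], [B,A,D,F,E,G,C]]"

definition "cert_P_1plus3 = [
  [B,A,D,F,G,E,C], [B,A,D,G,C,E,F], [B,A,E,C,G,F,D], [B,A,E,D,C,F,G], [B,A,E,F,C,G,D], [B,A,E,F,D,G,C],
  [B,A,F,C,E,G,D], [B,A,F,D,E,G,C], [B,C,A,D,E,G,F], [B,C,A,D,F,G,E], [B,C,A,E,D,F,G], [B,C,A,G,F,D,E],
  [B,C,D,F,E,G,A], [B,C,D,G,F,E,A], [B,C,E,D,G,F,A], [B,D,A,C,E,G,F], [B,D,A,C,G,E,F], [B,D,A,C,G,F,E],
  [B,D,A,E,C,F,G], [B,D,A,E,C,G,F], [B,D,A,E,F,C,G], [B,D,A,E,G,C,F], [B,D,A,F,E,C,G], [B,D,A,G,C,F,E],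
  [B,D,A,G,E,C,F], [B,D,A,G,F,C,E], [B,D,C,F,G,E,A], [B,D,E,F,C,G,A], [B,D,F,C,E,G,A], [B,E,A,C,F,D,G],
  [B,E,A,D,C,F,G], [B,E,A,F,C,G,D], [B,E,A,F,D,C,G], [B,E,A,F,G,C,D], [B,E,A,F,G,D,C], [B,E,A,G,C,D,F],
  [B,E,A,G,F,D,C], [B,E,C,F,D,G,A], [B,E,C,G,D,F,A], [B,E,D,C,G,F,A]]"

definition "cert_P_1plus4 = [
  [B,E,D,G,C,F,A], [B,F,A,C,D,G,E], [B,F,A,C,E,G,D], [B,F,A,D,E,G,C], [B,F,A,D,G,E,C], [B,F,A,E,C,G,D],
  [B,F,A,E,D,C,G], [B,F,A,G,C,D,E], [B,F,A,G,D,E,C], [B,F,A,G,E,D,C], [B,F,C,E,G,D,A], [B,F,D,C,G,E,A],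
  [B,F,D,E,C,G,A], [B,F,E,D,C,G,A], [B,G,A,D,E,F,C], [B,G,A,D,F,C,E], [B,G,A,D,F,E,C], [B,G,A,E,F,C,D],
  [B,G,C,E,F,D,A], [B,G,D,C,F,E,A], [B,G,E,C,D,F,A], [B,G,E,D,C,F,A], [C,A,B,D,F,G,E], [C,A,B,E,D,F,G],
  [C,A,B,E,D,G,F], [C,A,B,F,E,D,G], [C,A,B,G,E,D,F], [C,A,D,E,G,F,B], [C,A,D,F,E,G,B], [C,A,D,G,F,E,B],
  [C,B,A,D,E,F,G], [C,B,A,D,F,E,G], [C,B,A,D,G,E,F], [C,B,A,D,G,F,E], [C,B,A,E,D,F,G], [C,B,A,E,G,D,F],
  [C,B,A,E,G,F,D], [C,B,A,F,D,G,E], [C,B,A,F,E,G,D], [C,B,A,F,G,D,E]]"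

definition "cert_P_1plus5 = [
  [C,B,D,G,F,E,A], [C,B,E,G,D,F,A], [C,B,F,E,D,G,A], [C,D,A,E,G,F,B], [C,D,A,F,E,G,B], [C,D,B,G,E,F,A],
  [C,D,B,G,F,E,A], [C,E,A,F,G,D,B], [C,E,A,G,D,F,B], [C,E,B,D,F,G,A], [C,E,B,G,D,F,A], [C,F,A,D,E,G,B],
  [C,F,A,D,G,B,E], [C,F,A,G,D,B,E], [C,G,A,D,E,F,B], [C,G,A,D,F,B,E], [C,G,A,D,F,E,B], [C,G,A,F,D,E,B],
  [C,G,B,D,E,F,A], [C,G,B,F,E,D,A], [D,A,B,E,F,C,G], [D,A,B,G,F,C,E], [D,A,C,F,G,E,B], [D,A,C,G,E,F,B],
  [D,B,A,F,E,C,G], [D,B,A,F,G,C,E], [D,B,C,F,E,G,A], [D,B,C,G,E,F,A], [D,C,A,E,G,B,F], [D,C,A,E,G,F,B],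
  [D,C,A,F,G,B,E], [D,C,A,G,E,B,F], [D,C,A,G,F,B,E], [D,C,B,E,G,F,A], [D,C,B,G,F,E,A], [D,E,A,F,G,B,C],
  [D,F,A,E,G,B,C], [D,F,A,G,E,C,B], [D,F,B,G,E,C,A], [D,G,A,F,E,B,C]]"

definition "cert_P_1plus6 = [
  [E,A,B,G,F,C,D], [E,A,C,F,G,D,B], [E,B,A,F,G,C,D], [E,B,C,G,F,D,A], [E,C,A,G,F,B,D], [E,C,B,G,F,D,A],
  [E,D,A,F,G,B,C]]"

definition "cert_P_2minus0 = [
  [A,B,C,D,F,E,G], [A,B,C,D,G,E,F], [A,B,C,E,F,G,D], [A,B,C,E,G,F,D], [A,B,C,F,E,G,D], [A,B,C,F,G,D,E],
  [A,B,C,G,D,F,E], [A,B,C,G,E,D,F], [A,B,C,G,F,D,E], [A,B,D,E,C,G,F], [A,C,B,D,E,F,G], [A,C,B,D,G,F,E],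
  [A,C,B,E,G,D,F], [A,C,B,G,E,D,F], [A,C,B,G,F,E,D], [A,D,B,E,F,C,G], [A,D,B,F,E,G,C], [A,D,B,F,G,C,E],
  [A,D,B,G,F,E,C], [A,E,B,C,G,D,F], [A,E,B,D,F,C,G], [A,E,B,D,G,F,C], [A,E,B,F,G,D,C], [A,E,B,G,F,D,C],
  [A,F,B,C,G,D,E], [A,F,B,C,G,E,D], [A,F,B,E,G,C,D], [A,F,B,E,G,D,C], [B,A,C,D,F,G,E], [B,A,C,F,E,D,G],
  [B,A,C,F,G,D,E], [B,A,C,G,D,F,E], [B,A,C,G,E,D,F], [B,A,D,E,C,G,F], [B,A,D,G,C,F,E], [B,C,A,D,F,G,E],
  [B,C,A,E,D,F,G], [B,C,A,E,D,G,F], [B,C,A,E,F,G,D], [B,C,A,F,E,D,G]]"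

definition "cert_P_2minus1 = [
  [B,C,A,F,E,G,D], [B,C,A,F,G,D,E], [B,C,A,G,D,E,F], [B,C,A,G,D,F,E], [B,D,A,C,E,F,G], [B,D,A,C,G,E,F],
  [B,D,A,C,G,F,E], [B,D,A,E,F,G,C], [B,D,A,E,G,C,F], [B,D,A,F,E,C,G], [B,D,A,F,E,G,C], [B,D,A,F,G,E,C],
  [B,D,A,G,F,E,C], [B,E,A,C,G,F,D], [B,E,A,D,G,F,C], [B,E,A,F,G,C,D], [B,E,A,F,G,D,C], [B,E,A,G,F,D,C],
  [B,F,A,C,G,D,E], [B,F,A,C,G,E,D], [C,A,B,D,E,F,G], [C,A,B,D,F,G,E], [C,A,B,D,G,E,F], [C,A,B,E,D,G,F],
  [C,A,B,E,G,D,F], [C,A,B,F,G,D,E], [C,A,B,G,E,F,D], [C,A,D,F,B,G,E], [C,B,A,D,E,F,G], [C,B,A,D,G,E,F],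
  [C,B,A,E,D,F,G], [C,B,A,E,F,G,D], [C,B,A,E,G,D,F], [C,B,A,G,D,E,F], [C,D,A,E,G,B,F], [C,D,A,F,E,B,G],
  [C,E,A,B,F,G,D], [C,E,A,F,G,B,D], [C,E,A,F,G,D,B], [C,E,A,G,F,B,D]]"

definition "cert_P_2minus2 = [
  [C,F,A,B,G,E,D], [C,F,A,D,G,E,B], [D,A,B,C,E,F,G], [D,A,B,C,G,E,F], [D,A,B,E,F,C,G], [D,A,B,E,G,F,C],
  [D,A,B,G,E,F,C], [D,A,C,E,B,F,G], [D,A,C,F,B,E,G], [D,A,C,F,B,G,E], [D,B,A,C,E,G,F], [D,B,A,C,F,G,E],
  [D,B,A,C,G,E,F], [D,B,A,E,C,F,G], [D,B,A,E,C,G,F], [D,B,A,F,G,C,E], [D,B,A,F,G,E,C], [D,B,A,G,F,C,E],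
  [D,B,A,G,F,E,C], [D,C,A,B,E,F,G], [D,C,A,B,G,F,E], [D,C,A,F,E,B,G], [D,C,A,F,G,E,B], [D,C,A,G,F,E,B],
  [D,E,A,B,F,C,G], [D,E,A,C,G,B,F], [D,E,A,G,F,B,C], [D,F,A,E,G,B,C], [E,A,B,C,D,G,F], [E,A,B,D,C,F,G],
  [E,A,B,D,C,G,F], [E,A,B,D,F,G,C], [E,A,B,F,C,G,D], [E,A,B,F,D,G,C], [E,A,B,G,D,C,F], [E,A,C,F,B,G,D],
  [E,B,A,C,D,F,G], [E,B,A,C,D,G,F], [E,B,A,C,G,F,D], [E,B,A,D,F,G,C]]"

definition "cert_P_2minus3 = [
  [E,B,A,F,C,D,G], [E,B,A,F,D,G,C], [E,B,A,F,G,C,D], [E,C,A,B,D,G,F], [E,C,A,B,G,D,F], [E,C,A,D,F,B,G],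
  [E,C,A,F,D,B,G], [E,C,A,F,D,G,B], [E,C,A,F,G,D,B], [E,C,A,G,F,B,D], [E,D,A,B,F,G,C], [E,D,A,B,G,C,F],
  [E,D,A,C,F,G,B], [E,D,A,F,G,B,C], [E,D,A,F,G,C,B], [E,D,A,G,F,C,B], [E,F,A,D,G,B,C], [F,A,B,D,E,G,C],
  [F,A,B,E,C,G,D], [F,A,B,G,C,E,D], [F,A,B,G,D,E,C], [F,A,C,D,B,E,G], [F,B,A,C,G,E,D], [F,B,A,E,C,G,D],
  [F,B,A,E,G,C,D], [F,B,A,E,G,D,C], [F,B,A,G,E,C,D], [F,B,A,G,E,D,C], [F,C,A,D,E,G,B], [F,C,A,D,G,B,E],
  [F,C,A,E,G,D,B], [F,C,A,G,D,B,E], [F,C,A,G,D,E,B], [F,C,A,G,E,D,B], [F,D,A,B,E,G,C], [F,D,A,C,E,G,B],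
  [F,D,A,C,G,E,B], [F,D,A,E,G,C,B], [G,A,B,C,E,F,D], [G,A,B,D,F,E,C]]"

definition "cert_P_2minus4 = [
  [G,A,B,E,C,D,F], [G,A,B,E,C,F,D], [G,A,B,E,D,F,C], [G,A,B,F,D,E,C], [G,A,C,F,B,E,D], [G,B,A,C,E,F,D],
  [G,B,A,D,C,F,E], [G,B,A,D,E,C,F], [G,B,A,E,F,C,D], [G,C,A,B,D,F,E], [G,C,A,B,E,F,D], [G,C,A,B,F,D,E],
  [G,C,A,D,F,E,B], [G,C,A,E,D,F,B], [G,C,A,E,F,B,D], [G,C,A,F,D,B,E], [G,C,A,F,E,B,D], [G,C,A,F,E,D,B],
  [G,D,A,B,E,F,C], [G,D,A,B,F,C,E], [G,D,A,B,F,E,C], [G,D,A,E,F,C,B], [G,D,A,F,E,C,B], [G,E,A,C,F,D,B],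
  [G,E,A,D,F,C,B]]"

definition "cert_P_2plus0 = [
  [A,B,C,D,E,F,G], [A,B,C,D,G,F,E], [A,B,C,E,D,F,G], [A,B,C,F,D,E,G], [A,B,C,F,E,D,G], [A,B,C,F,G,E,D],
  [A,B,C,G,F,E,D], [A,B,D,F,C,E,G], [A,B,D,F,C,G,E], [A,B,D,G,C,F,E], [A,C,B,D,F,E,G], [A,C,B,D,F,G,E],
  [A,C,B,D,G,E,F], [A,C,B,E,D,G,F], [A,C,B,E,F,G,D], [A,C,B,E,G,F,D], [A,C,B,F,D,E,G], [A,C,B,F,D,G,E],
  [A,C,B,F,E,D,G], [A,C,B,F,G,E,D], [A,C,B,G,D,F,E], [A,C,B,G,E,F,D], [A,D,B,C,E,F,G], [A,D,B,C,G,F,E],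
  [A,D,B,E,F,G,C], [A,D,B,G,E,C,F], [A,D,B,G,F,C,E], [A,E,B,C,F,G,D], [A,E,B,C,G,F,D], [A,F,B,D,G,C,E],
  [B,A,C,D,E,F,G], [B,A,C,D,F,E,G], [B,A,C,D,G,E,F], [B,A,C,D,G,F,E], [B,A,C,E,D,G,F], [B,A,C,E,F,G,D],
  [B,A,C,E,G,F,D], [B,A,C,F,D,E,G], [B,A,C,F,E,G,D], [B,A,C,G,E,F,D]]"

definition "cert_P_2plus1 = [
  [B,A,C,G,F,D,E], [B,A,C,G,F,E,D], [B,A,D,F,C,E,G], [B,C,A,E,G,F,D], [B,C,A,F,D,G,E], [B,C,A,F,G,E,D],
  [B,C,A,G,E,D,F], [B,C,A,G,E,F,D], [B,D,A,C,E,G,F], [B,D,A,E,F,C,G], [B,D,A,G,E,C,F], [B,D,A,G,F,C,E],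
  [B,E,A,D,F,C,G], [B,E,A,D,F,G,C], [B,E,A,D,G,C,F], [B,F,A,D,G,C,E], [C,A,B,D,E,G,F], [C,A,B,D,G,F,E],
  [C,A,B,E,D,F,G], [C,A,B,E,F,G,D], [C,A,B,E,G,F,D], [C,A,B,G,D,E,F], [C,A,B,G,D,F,E], [C,A,B,G,F,E,D],
  [C,A,D,G,B,E,F], [C,B,A,D,E,G,F], [C,B,A,D,G,F,E], [C,B,A,E,F,D,G], [C,B,A,E,G,F,D], [C,B,A,F,D,G,E],
  [C,B,A,F,E,D,G], [C,B,A,F,G,D,E], [C,D,A,B,E,F,G], [C,D,A,B,E,G,F], [C,D,A,F,E,G,B], [C,D,A,F,G,B,E],
  [C,D,A,G,E,B,F], [C,D,A,G,E,F,B], [C,E,A,B,F,D,G], [C,E,A,D,G,B,F]]"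

definition "cert_P_2plus2 = [
  [C,E,A,D,G,F,B], [C,F,A,B,G,D,E], [C,F,A,D,G,B,E], [D,A,B,C,F,E,G], [D,A,B,E,C,F,G], [D,A,B,E,F,G,C],
  [D,A,B,F,C,G,E], [D,A,B,F,E,G,C], [D,A,B,F,G,C,E], [D,A,B,G,C,F,E], [D,A,C,E,B,G,F], [D,A,C,G,B,E,F],
  [D,B,A,C,E,F,G], [D,B,A,C,F,E,G], [D,B,A,C,G,F,E], [D,B,A,F,C,G,E], [D,B,A,F,E,C,G], [D,B,A,G,E,F,C],
  [D,C,A,B,E,G,F], [D,C,A,B,G,E,F], [D,C,A,E,G,B,F], [D,C,A,G,E,B,F], [D,C,A,G,F,B,E], [D,E,A,B,F,G,C],
  [D,E,A,B,G,F,C], [D,E,A,C,F,B,G], [D,E,A,C,G,F,B], [D,E,A,F,G,B,C], [D,F,A,B,G,E,C], [D,F,A,C,G,E,B],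
  [D,F,A,E,G,C,B], [E,A,B,C,F,G,D], [E,A,B,C,G,D,F], [E,A,B,C,G,F,D], [E,A,B,D,F,C,G], [E,A,B,D,G,F,C],
  [E,A,B,F,C,D,G], [E,A,B,F,D,C,G], [E,A,B,G,C,F,D], [E,A,B,G,F,D,C]]"

definition "cert_P_2plus3 = [
  [E,A,C,D,B,G,F], [E,A,C,G,B,D,F], [E,A,C,G,B,F,D], [E,B,A,C,G,D,F], [E,B,A,D,C,F,G], [E,B,A,D,F,C,G],
  [E,B,A,D,G,C,F], [E,B,A,D,G,F,C], [E,B,A,F,D,C,G], [E,B,A,F,G,D,C], [E,B,A,G,C,D,F], [E,C,A,B,F,D,G],
  [E,C,A,B,G,F,D], [E,C,A,D,G,F,B], [E,C,A,F,G,B,D], [E,C,A,G,D,F,B], [E,D,A,B,F,C,G], [E,D,A,B,G,F,C],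
  [E,D,A,C,F,B,G], [E,D,A,C,G,B,F], [E,D,A,C,G,F,B], [F,A,B,C,E,G,D], [F,A,B,C,G,E,D], [F,A,B,D,C,E,G],
  [F,A,B,D,G,E,C], [F,A,B,E,C,D,G], [F,A,B,E,G,D,C], [F,A,B,G,E,C,D], [F,B,A,C,D,G,E], [F,B,A,C,E,G,D],
  [F,B,A,D,C,G,E], [F,B,A,D,E,C,G], [F,B,A,D,E,G,C], [F,B,A,D,G,C,E], [F,B,A,E,C,D,G], [F,B,A,E,D,C,G],
  [F,B,A,G,C,D,E], [F,C,A,B,E,D,G], [F,C,A,B,G,D,E], [F,C,A,B,G,E,D]]"

definition "cert_P_2plus4 = [
  [F,C,A,D,E,B,G], [F,C,A,D,G,E,B], [F,C,A,E,D,G,B], [F,C,A,G,E,B,D], [F,D,A,B,E,C,G], [F,D,A,G,E,C,B],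
  [F,E,A,C,G,B,D], [F,E,A,D,G,C,B], [G,A,B,D,C,F,E], [G,A,B,D,E,C,F], [G,A,B,E,D,C,F], [G,A,B,F,C,D,E],
  [G,A,B,F,C,E,D], [G,A,B,F,D,C,E], [G,A,B,F,E,D,C], [G,A,C,D,B,E,F], [G,A,C,E,B,D,F], [G,A,C,F,B,D,E],
  [G,B,A,C,D,F,E], [G,B,A,C,E,D,F], [G,B,A,E,C,F,D], [G,B,A,E,D,F,C], [G,B,A,E,F,D,C], [G,B,A,F,C,D,E],
  [G,B,A,F,C,E,D], [G,B,A,F,E,D,C], [G,C,A,B,E,D,F], [G,C,A,D,E,B,F], [G,C,A,D,F,B,E], [G,C,A,E,D,B,F],
  [G,D,A,C,E,B,F], [G,D,A,C,F,B,E], [G,D,A,C,F,E,B]]"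

definition "cert_P_3minus0 = [
  [A,B,C,D,F,E,G], [A,B,C,D,F,G,E], [A,B,C,F,D,G,E], [A,B,C,G,D,E,F], [A,B,D,F,E,C,G], [A,B,D,F,G,E,C],
  [A,B,E,F,D,C,G], [A,B,E,G,C,D,F], [A,B,F,C,G,D,E], [A,B,F,G,D,C,E], [A,B,G,D,E,C,F], [A,B,G,E,C,D,F],
  [A,B,G,E,F,C,D], [A,C,B,D,E,F,G], [A,C,B,E,D,F,G], [A,C,B,E,G,F,D], [A,C,B,F,E,G,D], [A,C,B,G,E,F,D],
  [A,C,D,F,E,G,B], [A,C,E,D,G,B,F], [A,C,F,D,B,E,G], [A,C,F,D,G,B,E], [A,C,F,G,E,D,B], [A,C,G,B,E,F,D],
  [A,C,G,D,F,B,E], [A,C,G,E,D,F,B], [A,C,G,F,B,E,D], [A,D,B,E,G,C,F], [A,D,B,G,E,F,C], [A,D,B,G,F,C,E],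
  [A,D,C,F,G,E,B], [A,D,E,C,G,B,F], [A,D,F,B,G,C,E], [A,D,G,E,F,B,C], [A,E,B,D,C,G,F], [A,E,C,D,F,G,B],
  [A,E,C,F,B,D,G], [A,E,C,F,D,B,G], [A,E,C,G,F,B,D], [A,E,D,B,C,F,G]]"

definition "cert_P_3minus1 = [
  [A,E,D,C,B,F,G], [A,E,D,F,G,C,B], [A,E,D,G,B,C,F], [A,E,D,G,F,B,C], [A,E,F,C,D,G,B], [A,E,F,C,G,D,B],
  [A,E,G,B,C,D,F], [A,E,G,C,F,D,B], [A,E,G,F,B,C,D], [A,F,B,D,C,E,G], [A,F,B,D,C,G,E], [A,F,B,E,C,D,G],
  [A,F,B,E,D,G,C], [A,F,B,G,E,C,D], [A,F,C,B,D,E,G], [A,F,C,G,E,B,D], [A,F,D,B,E,C,G], [A,F,D,E,B,C,G],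
  [A,F,D,E,B,G,C], [A,F,D,E,G,C,B], [A,F,D,G,C,E,B], [A,F,E,C,G,B,D], [A,F,G,B,C,E,D], [A,F,G,C,E,B,D],
  [A,F,G,D,E,B,C], [A,F,G,E,D,C,B], [A,G,B,C,D,F,E], [A,G,B,D,C,F,E], [A,G,B,D,F,C,E], [A,G,B,E,C,D,F],
  [A,G,B,F,C,D,E], [A,G,B,F,E,C,D], [A,G,C,D,B,E,F], [A,G,C,E,B,D,F], [A,G,C,E,F,B,D], [A,G,C,F,B,D,E],
  [A,G,C,F,D,B,E], [A,G,C,F,E,D,B], [A,G,D,C,E,B,F], [A,G,D,E,C,F,B]]"

definition "cert_P_3minus2 = [
  [A,G,D,E,F,B,C], [A,G,E,B,D,C,F], [A,G,E,C,B,F,D], [A,G,E,C,D,B,F], [A,G,E,F,D,B,C], [A,G,F,E,B,C,D],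
  [A,G,F,E,D,B,C], [B,A,C,D,G,E,F], [B,A,C,E,D,G,F], [B,A,C,E,G,F,D], [B,A,C,G,F,E,D], [B,A,D,C,E,F,G],
  [B,A,D,E,C,G,F], [B,A,D,E,G,C,F], [B,A,D,F,E,C,G], [B,A,D,G,C,F,E], [B,A,E,F,D,C,G], [B,A,E,G,C,F,D],
  [B,A,E,G,F,C,D], [B,A,F,C,D,G,E], [B,A,F,C,G,E,D], [B,A,F,E,G,C,D], [B,A,F,G,C,E,D], [B,A,G,F,C,D,E],
  [B,C,D,A,G,E,F], [B,C,D,A,G,F,E], [B,C,D,G,E,A,F], [B,C,E,A,G,D,F], [B,C,E,D,A,F,G], [B,C,E,D,G,F,A],
  [B,C,E,F,D,G,A], [B,C,E,G,A,F,D], [B,C,E,G,D,F,A], [B,C,F,G,A,E,D], [B,C,F,G,E,A,D], [B,C,G,A,D,E,F],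
  [B,C,G,A,F,E,D], [B,C,G,D,A,E,F], [B,D,C,A,E,F,G], [B,D,C,A,F,E,G]]"

definition "cert_P_3minus3 = [
  [B,D,C,A,G,F,E], [B,D,C,E,A,F,G], [B,D,C,E,F,G,A], [B,D,C,G,E,A,F], [B,D,C,G,E,F,A], [B,D,C,G,F,A,E],
  [B,D,E,A,F,C,G], [B,D,E,A,G,C,F], [B,D,E,C,A,F,G], [B,D,E,C,A,G,F], [B,D,F,A,C,E,G], [B,D,F,A,E,G,C],
  [B,D,G,A,C,E,F], [B,D,G,A,F,E,C], [B,D,G,C,A,F,E], [B,D,G,C,F,E,A], [B,D,G,E,F,A,C], [B,D,G,F,A,E,C],
  [B,D,G,F,E,A,C], [B,E,C,A,D,F,G], [B,E,D,F,C,G,A], [B,E,D,G,A,C,F], [B,E,F,A,G,C,D], [B,E,F,C,A,D,G],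
  [B,E,F,C,D,A,G], [B,E,F,C,G,A,D], [B,E,F,C,G,D,A], [B,E,F,G,C,A,D], [B,E,G,A,C,F,D], [B,E,G,C,A,D,F],
  [B,F,C,A,E,G,D], [B,F,C,A,G,E,D], [B,F,C,D,G,A,E], [B,F,C,E,A,G,D], [B,F,C,G,A,E,D], [B,F,C,G,E,A,D],
  [B,F,D,C,G,A,E], [B,F,D,G,A,C,E], [B,F,D,G,A,E,C], [B,F,E,C,A,D,G]]"

definition "cert_P_3minus4 = [
  [B,F,E,D,C,G,A], [B,F,E,G,C,D,A], [B,F,G,A,C,E,D], [B,F,G,C,A,E,D], [B,F,G,C,E,D,A], [B,F,G,D,A,C,E],
  [B,F,G,E,D,C,A], [B,G,C,A,F,D,E], [B,G,D,C,E,A,F], [B,G,E,F,D,A,C], [B,G,F,A,C,D,E], [B,G,F,C,A,D,E],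
  [B,G,F,C,D,E,A], [B,G,F,D,A,C,E], [C,A,D,F,B,G,E], [C,A,D,F,E,B,G], [C,A,E,D,G,F,B], [C,A,E,F,D,B,G],
  [C,A,F,B,G,D,E], [C,A,F,D,E,G,B], [C,A,F,E,G,B,D], [C,A,F,E,G,D,B], [C,A,F,G,D,E,B], [C,A,G,B,E,F,D],
  [C,A,G,D,F,E,B], [C,B,D,A,E,F,G], [C,B,D,G,A,E,F], [C,B,D,G,E,A,F], [C,B,E,A,G,F,D], [C,B,E,D,F,A,G],
  [C,B,G,D,F,E,A], [C,B,G,E,A,F,D], [C,D,E,A,G,F,B], [C,D,E,B,G,A,F], [C,D,F,B,E,G,A], [C,D,F,E,B,A,G],
  [C,D,G,A,F,B,E], [C,D,G,B,E,A,F], [C,E,D,F,G,A,B], [C,E,D,G,A,B,F]]"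

definition "cert_P_3minus5 = [
  [C,E,D,G,F,B,A], [C,E,F,B,A,D,G], [C,E,F,D,A,G,B], [C,E,F,D,B,A,G], [C,E,G,A,D,B,F], [C,E,G,B,D,F,A],
  [C,E,G,D,A,B,F], [C,E,G,D,F,A,B], [C,E,G,D,F,B,A], [C,F,D,E,G,A,B], [C,F,E,A,G,D,B], [C,F,E,B,A,G,D],
  [C,F,E,D,B,A,G], [C,F,G,B,A,D,E], [C,F,G,B,D,E,A], [C,F,G,B,E,A,D], [C,F,G,E,D,B,A], [C,G,D,A,E,B,F],
  [C,G,D,A,F,B,E], [C,G,D,B,A,F,E], [C,G,D,E,A,F,B], [C,G,E,A,D,F,B], [C,G,E,B,D,F,A], [C,G,E,D,A,F,B],
  [C,G,E,D,B,F,A], [C,G,E,D,F,A,B], [C,G,F,A,E,D,B], [D,A,E,C,F,G,B], [D,A,F,C,G,B,E], [D,A,F,C,G,E,B],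
  [D,A,G,B,F,C,E], [D,A,G,B,F,E,C], [D,B,E,C,A,F,G], [D,B,E,C,F,G,A], [D,B,E,F,G,A,C], [D,B,E,G,A,C,F],
  [D,B,E,G,A,F,C], [D,B,F,C,E,G,A], [D,B,F,E,G,A,C], [D,B,G,A,E,C,F]]"

definition "cert_P_3minus6 = [
  [D,B,G,C,F,A,E], [D,B,G,E,F,A,C], [D,B,G,F,C,A,E], [D,C,E,F,A,G,B], [D,C,F,A,B,G,E], [D,C,F,E,B,A,G],
  [D,C,F,G,E,A,B], [D,C,G,A,E,F,B], [D,C,G,E,F,B,A], [D,E,F,A,C,B,G], [D,E,F,B,A,G,C], [D,E,F,B,C,G,A],
  [D,E,F,C,G,A,B], [D,E,G,A,F,C,B], [D,E,G,B,C,F,A], [D,E,G,F,A,C,B], [D,E,G,F,B,A,C], [D,F,E,A,G,C,B],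
  [D,F,E,B,G,A,C], [D,F,E,C,B,G,A], [D,F,E,C,G,B,A], [D,F,G,A,E,C,B], [D,G,E,B,A,C,F], [D,G,F,C,B,A,E],
  [E,A,F,C,D,G,B], [E,A,F,C,G,D,B], [E,A,F,G,C,B,D], [E,A,G,B,C,F,D], [E,A,G,B,D,F,C], [E,A,G,C,B,F,D],
  [E,A,G,D,B,F,C], [E,B,F,A,D,C,G], [E,B,F,C,G,D,A], [E,B,F,D,A,C,G], [E,B,F,D,A,G,C], [E,B,F,D,G,C,A],
  [E,B,G,C,F,A,D], [E,C,F,A,D,G,B], [E,C,F,D,A,B,G], [E,C,F,D,G,B,A]]"

definition "cert_P_3minus7 = [
  [E,C,F,G,A,D,B], [E,C,G,D,F,A,B], [E,D,F,A,B,C,G], [E,D,F,C,B,A,G], [E,D,F,G,B,C,A], [E,D,F,G,C,A,B],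
  [E,D,F,G,C,B,A], [E,D,G,F,A,B,C], [E,D,G,F,C,A,B], [E,F,G,D,A,B,C], [E,F,G,D,B,A,C], [E,G,F,C,B,D,A],
  [F,A,G,B,D,C,E], [F,A,G,C,E,D,B], [F,A,G,D,B,C,E], [F,B,G,A,C,E,D], [F,B,G,A,E,C,D], [F,B,G,C,E,D,A],
  [F,B,G,E,D,C,A], [F,C,G,A,B,E,D], [F,C,G,A,D,B,E], [F,C,G,B,D,E,A], [F,C,G,D,A,E,B], [F,C,G,E,A,D,B],
  [F,C,G,E,B,A,D], [F,C,G,E,B,D,A], [F,D,G,C,A,E,B], [F,D,G,C,B,A,E], [F,E,G,A,D,B,C]]"

definition "cert_P_3plus0 = [
  [A,B,C,F,G,D,E], [A,B,C,G,F,D,E], [A,B,D,E,F,G,C], [A,B,D,E,G,F,C], [A,B,D,F,G,C,E], [A,B,D,G,E,F,C],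
  [A,B,E,D,C,F,G], [A,B,E,D,F,C,G], [A,B,E,F,D,G,C], [A,B,F,C,D,E,G], [A,B,F,D,E,C,G], [A,B,F,E,G,C,D],
  [A,B,F,G,C,E,D], [A,B,G,C,D,F,E], [A,B,G,C,E,D,F], [A,B,G,F,D,C,E], [A,B,G,F,E,C,D], [A,C,B,E,F,D,G],
  [A,C,D,B,F,E,G], [A,C,D,E,B,G,F], [A,C,D,F,B,G,E], [A,C,D,G,F,B,E], [A,C,E,B,G,D,F], [A,C,E,D,B,F,G],
  [A,C,E,F,B,D,G], [A,C,F,B,D,E,G], [A,C,F,B,E,G,D], [A,C,F,B,G,D,E], [A,C,F,G,B,E,D], [A,C,F,G,D,B,E],
  [A,C,G,B,D,E,F], [A,C,G,E,F,D,B], [A,D,B,E,C,G,F], [A,D,B,G,E,C,F], [A,D,C,E,F,B,G], [A,D,C,F,E,G,B],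
  [A,D,E,B,F,C,G], [A,D,E,B,G,C,F], [A,D,E,F,B,C,G], [A,D,E,F,C,G,B]]"

definition "cert_P_3plus1 = [
  [A,D,E,F,G,C,B], [A,D,E,G,F,C,B], [A,D,F,E,C,B,G], [A,D,F,E,C,G,B], [A,D,F,G,C,E,B], [A,D,G,B,C,F,E],
  [A,D,G,B,F,E,C], [A,D,G,E,B,C,F], [A,D,G,E,F,C,B], [A,D,G,F,B,E,C], [A,D,G,F,E,C,B], [A,E,B,F,C,G,D],
  [A,E,B,F,D,C,G], [A,E,B,F,G,C,D], [A,E,B,G,D,F,C], [A,E,B,G,F,D,C], [A,E,D,B,C,G,F], [A,E,D,C,B,G,F],
  [A,E,D,F,C,G,B], [A,E,F,D,G,B,C], [A,E,G,B,D,C,F], [A,E,G,B,F,C,D], [A,E,G,C,D,B,F], [A,E,G,D,C,B,F],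
  [A,E,G,D,F,B,C], [A,F,B,C,G,D,E], [A,F,B,D,E,G,C], [A,F,B,G,D,C,E], [A,F,B,G,D,E,C], [A,F,C,D,B,E,G],
  [A,F,C,E,G,D,B], [A,F,C,G,D,E,B], [A,F,D,B,G,C,E], [A,F,D,G,E,C,B], [A,F,E,B,C,D,G], [A,F,E,C,G,D,B],
  [A,F,E,G,B,D,C], [A,F,G,C,B,E,D], [A,F,G,C,E,D,B], [A,F,G,E,B,D,C]]"

definition "cert_P_3plus2 = [
  [A,F,G,E,D,B,C], [A,G,B,D,C,E,F], [A,G,B,E,F,C,D], [A,G,B,F,D,E,C], [A,G,B,F,E,D,C], [A,G,C,B,F,D,E],
  [A,G,C,D,F,E,B], [A,G,C,E,B,F,D], [A,G,D,B,C,E,F], [A,G,D,C,F,B,E], [A,G,E,C,F,B,D], [A,G,E,D,C,F,B],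
  [A,G,E,D,F,C,B], [A,G,E,F,C,B,D], [A,G,F,C,D,B,E], [A,G,F,E,B,D,C], [A,G,F,E,C,B,D], [A,G,F,E,C,D,B],
  [B,A,D,C,F,G,E], [B,A,E,C,D,G,F], [B,A,F,D,C,E,G], [B,A,F,D,G,E,C], [B,A,F,G,D,E,C], [B,A,G,C,D,E,F],
  [B,A,G,E,C,F,D], [B,C,D,A,E,F,G], [B,C,D,F,A,G,E], [B,C,D,F,E,A,G], [B,C,D,G,F,E,A], [B,C,E,F,G,A,D],
  [B,C,F,A,G,E,D], [B,C,F,D,E,G,A], [B,C,G,A,E,D,F], [B,C,G,D,A,F,E], [B,C,G,E,D,F,A], [B,C,G,E,F,A,D],
  [B,D,C,G,F,E,A], [B,D,E,A,G,F,C], [B,D,E,G,A,C,F], [B,D,F,A,C,G,E]]"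

definition "cert_P_3plus3 = [
  [B,D,F,A,G,C,E], [B,D,F,A,G,E,C], [B,D,F,E,A,G,C], [B,D,F,E,G,A,C], [B,D,F,G,A,C,E], [B,D,F,G,A,E,C],
  [B,D,G,C,E,F,A], [B,E,C,A,D,G,F], [B,E,C,A,F,G,D], [B,E,C,D,A,F,G], [B,E,C,D,A,G,F], [B,E,C,G,D,A,F],
  [B,E,D,A,F,C,G], [B,E,D,A,F,G,C], [B,E,D,A,G,C,F], [B,E,D,C,A,F,G], [B,E,D,C,F,G,A], [B,E,D,C,G,A,F],
  [B,E,D,G,C,F,A], [B,E,D,G,F,C,A], [B,E,F,A,D,C,G], [B,E,F,A,G,D,C], [B,E,F,D,C,A,G], [B,E,G,A,D,F,C],
  [B,E,G,D,F,C,A], [B,F,C,A,G,D,E], [B,F,C,E,A,D,G], [B,F,D,A,E,C,G], [B,F,D,C,G,E,A], [B,F,E,D,A,G,C],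
  [B,F,E,G,D,A,C], [B,F,G,A,D,C,E], [B,G,C,D,E,F,A], [B,G,C,D,F,E,A], [B,G,C,F,A,E,D], [B,G,C,F,D,A,E],
  [B,G,D,A,C,F,E], [B,G,D,A,E,F,C], [B,G,D,A,F,E,C], [B,G,D,C,F,A,E]]"

definition "cert_P_3plus4 = [
  [B,G,D,C,F,E,A], [B,G,D,E,A,C,F], [B,G,E,A,D,F,C], [B,G,E,C,D,A,F], [B,G,E,C,F,D,A], [B,G,F,A,C,E,D],
  [B,G,F,C,E,A,D], [B,G,F,C,E,D,A], [B,G,F,D,C,A,E], [B,G,F,D,C,E,A], [B,G,F,E,A,D,C], [C,A,D,E,B,G,F],
  [C,A,D,E,F,B,G], [C,A,D,F,E,G,B], [C,A,D,G,E,F,B], [C,A,E,B,G,D,F], [C,A,E,D,B,F,G], [C,A,E,D,B,G,F],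
  [C,A,E,D,G,B,F], [C,A,E,G,B,D,F], [C,A,G,B,D,F,E], [C,A,G,B,F,E,D], [C,A,G,D,E,F,B], [C,A,G,E,D,F,B],
  [C,B,D,A,G,E,F], [C,B,D,A,G,F,E], [C,B,D,F,A,E,G], [C,B,D,F,E,A,G], [C,B,D,F,G,E,A], [C,B,D,G,E,F,A],
  [C,B,E,A,F,D,G], [C,B,E,F,G,A,D], [C,B,F,A,G,D,E], [C,B,F,G,A,D,E], [C,B,F,G,D,E,A], [C,B,G,A,E,F,D],
  [C,D,E,B,A,F,G], [C,D,E,B,F,A,G], [C,D,E,F,G,A,B], [C,D,E,G,A,B,F]]"

definition "cert_P_3plus5 = [
  [C,D,E,G,A,F,B], [C,D,F,B,A,G,E], [C,D,F,E,A,G,B], [C,D,F,E,B,G,A], [C,D,F,G,A,B,E], [C,D,G,A,E,F,B],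
  [C,D,G,B,E,F,A], [C,D,G,E,F,A,B], [C,E,D,B,F,A,G], [C,E,F,A,B,G,D], [C,E,F,B,A,G,D], [C,E,F,G,A,B,D],
  [C,E,G,A,B,D,F], [C,E,G,B,F,A,D], [C,F,D,A,E,B,G], [C,F,D,A,E,G,B], [C,F,D,E,A,G,B], [C,F,D,G,A,B,E],
  [C,F,D,G,B,A,E], [C,F,E,A,B,G,D], [C,F,E,A,D,G,B], [C,F,E,B,G,A,D], [C,F,E,B,G,D,A], [C,F,G,A,D,B,E],
  [C,F,G,A,D,E,B], [C,F,G,B,E,D,A], [C,F,G,D,A,E,B], [C,F,G,E,A,D,B], [C,G,D,B,E,F,A], [C,G,D,B,F,E,A],
  [C,G,D,E,A,B,F], [C,G,D,E,F,B,A], [C,G,D,F,E,B,A], [C,G,E,A,B,D,F], [C,G,E,A,D,B,F], [C,G,E,D,F,B,A],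
  [C,G,E,F,A,B,D], [C,G,F,A,B,E,D], [C,G,F,A,E,B,D], [C,G,F,E,B,A,D]]"

definition "cert_P_3plus6 = [
  [C,G,F,E,D,A,B], [D,A,E,B,G,C,F], [D,A,E,F,G,C,B], [D,A,F,B,C,G,E], [D,A,F,C,B,E,G], [D,A,F,E,C,B,G],
  [D,A,F,G,B,C,E], [D,A,F,G,C,E,B], [D,A,F,G,E,C,B], [D,A,G,C,E,B,F], [D,A,G,C,F,E,B], [D,A,G,F,C,B,E],
  [D,A,G,F,E,B,C], [D,B,F,A,E,G,C], [D,B,G,E,A,C,F], [D,B,G,E,A,F,C], [D,C,E,A,B,G,F], [D,C,E,B,A,F,G],
  [D,C,E,B,F,A,G], [D,C,E,B,G,F,A], [D,C,E,F,B,A,G], [D,C,E,F,G,A,B], [D,C,E,G,A,B,F], [D,C,F,E,A,B,G],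
  [D,C,F,G,E,B,A], [D,C,G,B,A,F,E], [D,C,G,E,B,A,F], [D,C,G,F,B,E,A], [D,E,F,B,A,C,G], [D,E,F,C,A,B,G],
  [D,E,F,G,B,A,C], [D,E,G,A,B,C,F], [D,E,G,C,A,B,F], [D,E,G,C,B,A,F], [D,E,G,F,C,B,A], [D,F,E,A,B,C,G],
  [D,F,E,A,G,B,C], [D,F,E,B,A,G,C], [D,F,E,G,B,A,C], [D,F,E,G,B,C,A]]"

definition "cert_P_3plus7 = [
  [D,F,G,A,C,E,B], [D,F,G,A,E,B,C], [D,F,G,E,A,B,C], [D,F,G,E,C,B,A], [D,G,E,B,F,A,C], [D,G,E,B,F,C,A],
  [D,G,E,F,A,B,C], [D,G,E,F,C,B,A], [D,G,F,A,C,E,B], [D,G,F,B,A,C,E], [D,G,F,C,A,B,E], [D,G,F,C,A,E,B],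
  [E,A,F,D,C,B,G], [E,A,F,D,G,B,C], [E,A,F,D,G,C,B], [E,A,G,B,D,C,F], [E,A,G,D,F,C,B], [E,A,G,F,C,D,B],
  [E,B,F,A,C,D,G], [E,B,F,A,C,G,D], [E,B,F,A,D,G,C], [E,B,F,C,G,A,D], [E,B,F,D,C,A,G], [E,B,G,C,A,D,F],
  [E,B,G,C,D,A,F], [E,B,G,C,D,F,A], [E,B,G,D,A,C,F], [E,B,G,D,C,A,F], [E,B,G,F,A,D,C], [E,C,F,B,A,D,G],
  [E,C,G,A,D,F,B], [E,C,G,B,F,A,D], [E,C,G,F,D,B,A], [E,D,G,A,C,B,F], [E,D,G,C,A,F,B], [E,D,G,F,A,C,B],
  [E,D,G,F,C,B,A], [E,F,G,A,D,C,B], [E,F,G,B,A,C,D], [E,F,G,C,A,D,B]]"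

definition "cert_P_3plus8 = [
  [E,F,G,C,B,D,A], [E,F,G,D,C,A,B], [E,G,F,B,C,A,D], [E,G,F,D,B,C,A], [F,A,G,D,B,E,C], [F,B,G,C,A,D,E],
  [F,B,G,C,D,A,E], [F,B,G,C,D,E,A], [F,B,G,C,E,A,D], [F,B,G,D,E,A,C], [F,B,G,E,D,A,C], [F,C,G,E,D,B,A],
  [F,D,G,A,E,B,C], [F,D,G,B,E,C,A], [F,D,G,E,A,B,C], [F,E,G,A,B,C,D], [F,E,G,A,B,D,C], [F,E,G,C,A,B,D],
  [F,E,G,C,D,A,B]]"

text \<open>The first entry subtracts the \<open>gauge\<close> at both ends of the edge. Since 4 is
  1 modulo 3, the edge minus these two terms is \<open>P_fix\<close> modulo 3, and the remaining
  entries express it by (1)-(3).\<close>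

definition cert_P :: certificate where
  "cert_P = [
    (keys_gauge Minus, [[A,B,C,D,E,F,G], [D,C,B,A,E,F,G]]),
    (keys1 Minus, cert_P_1minus0),
    (keys1 Minus, cert_P_1minus1),
    (keys1 Minus, cert_P_1minus2),
    (keys1 Minus, cert_P_1minus3),
    (keys1 Minus, cert_P_1minus4),
    (keys1 Minus, cert_P_1minus5),
    (keys1 Minus, cert_P_1minus6),
    (keys1 Plus, cert_P_1plus0),
    (keys1 Plus, cert_P_1plus1),
    (keys1 Plus, cert_P_1plus2),
    (keys1 Plus, cert_P_1plus3),
    (keys1 Plus, cert_P_1plus4),
    (keys1 Plus, cert_P_1plus5),
    (keys1 Plus, cert_P_1plus6),
    (keys2 Minus, cert_P_2minus0),
    (keys2 Minus, cert_P_2minus1),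
    (keys2 Minus, cert_P_2minus2),
    (keys2 Minus, cert_P_2minus3),
    (keys2 Minus, cert_P_2minus4),
    (keys2 Plus, cert_P_2plus0),
    (keys2 Plus, cert_P_2plus1),
    (keys2 Plus, cert_P_2plus2),
    (keys2 Plus, cert_P_2plus3),
    (keys2 Plus, cert_P_2plus4),
    (keys3 Minus, cert_P_3minus0),
    (keys3 Minus, cert_P_3minus1),
    (keys3 Minus, cert_P_3minus2),
    (keys3 Minus, cert_P_3minus3),
    (keys3 Minus, cert_P_3minus4),
    (keys3 Minus, cert_P_3minus5),
    (keys3 Minus, cert_P_3minus6),
    (keys3 Minus, cert_P_3minus7),
    (keys3 Plus, cert_P_3plus0),
    (keys3 Plus, cert_P_3plus1),
    (keys3 Plus, cert_P_3plus2),
    (keys3 Plus, cert_P_3plus3),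
    (keys3 Plus, cert_P_3plus4),
    (keys3 Plus, cert_P_3plus5),
    (keys3 Plus, cert_P_3plus6),
    (keys3 Plus, cert_P_3plus7),
    (keys3 Plus, cert_P_3plus8)]"

definition "cert_Q_1minus0 = [
  [A,B,C,D,G,E,F], [A,B,C,E,F,D,G], [A,B,C,E,G,D,F], [A,B,C,E,G,F,D], [A,B,C,F,D,E,G], [A,B,C,F,D,G,E],
  [A,B,C,F,G,D,E], [A,B,C,F,G,E,D], [A,B,C,G,D,F,E], [A,B,C,G,E,F,D], [A,B,C,G,F,D,E], [A,B,D,C,E,F,G],
  [A,B,D,C,F,E,G], [A,B,D,C,F,G,E], [A,B,D,E,F,G,C], [A,B,D,F,C,E,G], [A,B,D,G,C,E,F], [A,B,E,C,D,F,G],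
  [A,B,E,D,G,F,C], [A,B,E,F,C,G,D], [A,B,E,G,C,F,D], [A,B,E,G,D,F,C], [A,B,F,C,E,G,D], [A,B,F,D,C,G,E],
  [A,B,F,E,D,G,C], [A,C,B,E,D,F,G], [A,C,B,E,D,G,F], [A,C,B,E,F,G,D], [A,C,B,F,D,E,G], [A,C,B,F,E,D,G],
  [A,C,B,G,D,E,F], [A,C,B,G,E,D,F], [A,C,B,G,F,D,E], [A,C,B,G,F,E,D], [A,C,D,B,F,E,G], [A,C,D,B,G,F,E],
  [A,C,D,E,F,G,B], [A,C,D,E,G,F,B], [A,C,D,F,E,G,B], [A,C,D,G,E,F,B]]"

definition "cert_Q_1minus1 = [
  [A,C,E,D,B,G,F], [A,C,E,D,G,F,B], [A,C,E,F,B,G,D], [A,C,F,D,B,G,E], [A,D,B,C,E,G,F], [A,D,B,C,G,F,E],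
  [A,D,B,E,C,F,G], [A,D,B,E,G,C,F], [A,D,B,E,G,F,C], [A,D,B,F,C,E,G], [A,D,B,F,E,G,C], [A,D,B,F,G,E,C],
  [A,D,C,B,E,F,G], [A,D,C,F,B,G,E], [A,D,E,F,C,G,B], [A,D,E,G,B,F,C], [A,D,E,G,C,F,B], [A,D,F,B,C,G,E],
  [A,D,F,C,B,G,E], [A,E,B,C,F,G,D], [A,E,B,C,G,F,D], [A,E,B,D,C,G,F], [A,E,B,D,G,C,F], [A,E,B,F,C,D,G],
  [A,E,B,F,C,G,D], [A,E,B,F,D,G,C], [A,E,B,F,G,D,C], [A,E,B,G,C,D,F], [A,E,B,G,F,C,D], [A,E,C,B,D,F,G],
  [A,E,C,D,F,G,B], [A,E,C,D,G,F,B], [A,E,C,F,D,G,B], [A,E,C,F,G,D,B], [A,E,C,G,B,F,D], [A,E,D,C,B,G,F],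
  [A,E,D,C,F,G,B], [A,E,D,G,B,F,C], [A,E,F,B,C,G,D], [A,E,F,C,D,G,B]]"

definition "cert_Q_1minus2 = [
  [A,E,F,D,B,G,C], [A,E,F,D,C,G,B], [A,F,B,C,E,D,G], [A,F,B,C,E,G,D], [A,F,B,E,C,D,G], [A,F,B,G,C,E,D],
  [A,F,C,B,E,D,G], [A,F,C,B,G,E,D], [A,F,C,D,B,E,G], [A,F,C,D,G,E,B], [A,F,C,E,G,D,B], [A,F,D,B,C,E,G],
  [A,F,D,B,E,G,C], [A,F,D,B,G,E,C], [A,F,D,C,G,E,B], [A,F,D,E,B,G,C], [A,F,D,G,B,E,C], [A,F,E,B,C,G,D],
  [A,F,E,C,B,G,D], [A,F,E,D,C,G,B], [A,G,B,D,C,E,F], [A,G,B,D,E,F,C], [A,G,B,D,F,C,E], [A,G,B,E,C,F,D],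
  [A,G,B,E,F,C,D], [A,G,B,F,C,D,E], [A,G,B,F,D,C,E], [A,G,B,F,E,D,C], [A,G,C,B,D,F,E], [A,G,C,B,E,F,D],
  [A,G,C,E,F,D,B], [A,G,C,F,B,D,E], [A,G,C,F,D,E,B], [A,G,E,B,C,F,D], [A,G,E,D,B,F,C], [B,A,C,D,E,G,F],
  [B,A,C,D,G,E,F], [B,A,C,D,G,F,E], [B,A,C,E,D,G,F], [B,A,C,E,F,G,D]]"

definition "cert_Q_1minus3 = [
  [B,A,C,F,E,D,G], [B,A,C,G,D,F,E], [B,A,C,G,E,D,F], [B,A,D,C,G,F,E], [B,A,D,E,C,F,G], [B,A,D,E,F,G,C],
  [B,A,D,E,G,F,C], [B,A,D,F,C,E,G], [B,A,D,F,C,G,E], [B,A,D,F,E,G,C], [B,A,D,F,G,E,C], [B,A,E,C,G,F,D],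
  [B,A,E,G,D,F,C], [B,A,F,D,E,G,C], [B,C,A,D,G,E,F], [B,C,A,F,D,G,E], [B,C,A,F,G,E,D], [B,C,A,G,E,D,F],
  [B,C,A,G,E,F,D], [B,C,A,G,F,E,D], [B,C,D,F,E,G,A], [B,C,F,D,E,G,A], [B,D,A,C,E,F,G], [B,D,A,E,F,C,G],
  [B,D,A,F,C,E,G], [B,D,A,G,E,F,C], [B,D,A,G,F,C,E], [B,D,C,E,F,G,A], [B,E,A,C,D,F,G], [B,E,A,D,G,C,F],
  [B,E,A,D,G,F,C], [B,E,A,F,C,G,D], [B,E,A,F,D,G,C], [B,E,A,G,F,D,C], [B,E,C,D,G,F,A], [B,E,C,F,D,G,A],
  [B,E,D,C,G,F,A], [B,F,A,D,C,E,G], [B,F,A,D,C,G,E], [B,F,A,D,E,C,G]]"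

definition "cert_Q_1minus4 = [
  [B,F,A,E,D,G,C], [B,F,A,E,G,C,D], [B,F,A,G,C,D,E], [B,F,D,C,E,G,A], [B,G,A,C,E,F,D], [B,G,A,D,C,E,F],
  [B,G,A,D,C,F,E], [B,G,A,D,F,E,C], [B,G,A,E,F,C,D], [B,G,A,F,D,C,E], [B,G,A,F,E,C,D], [B,G,C,E,D,F,A],
  [B,G,D,C,E,F,A], [B,G,D,C,F,E,A], [B,G,D,F,C,E,A], [B,G,E,D,C,F,A], [C,A,B,D,E,F,G], [C,A,B,D,E,G,F],
  [C,A,B,E,D,G,F], [C,A,B,E,F,G,D], [C,A,B,F,G,E,D], [C,A,B,G,D,F,E], [C,A,B,G,E,F,D], [C,A,B,G,F,D,E],
  [C,A,D,F,E,G,B], [C,A,D,F,G,E,B], [C,A,D,G,F,E,B], [C,A,F,E,D,G,B], [C,B,A,D,E,F,G], [C,B,A,D,F,E,G],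
  [C,B,A,E,D,G,F], [C,B,A,E,F,D,G], [C,B,A,F,D,G,E], [C,B,A,F,E,D,G], [C,B,D,F,E,G,A], [C,B,D,F,G,E,A],
  [C,B,E,D,G,F,A], [C,B,F,D,E,G,A], [C,D,A,G,E,B,F], [C,E,A,D,F,G,B]]"

definition "cert_Q_1minus5 = [
  [C,E,A,F,D,G,B], [C,E,A,F,G,B,D], [C,E,B,D,F,G,A], [C,E,B,D,G,F,A], [C,E,B,F,D,G,A], [C,E,B,F,G,D,A],
  [C,E,B,G,D,F,A], [C,F,A,D,E,B,G], [C,F,A,D,E,G,B], [C,F,A,D,G,B,E], [C,F,A,D,G,E,B], [C,F,A,E,G,B,D],
  [C,F,A,G,E,D,B], [C,G,A,D,E,F,B], [C,G,A,D,F,E,B], [C,G,A,E,F,D,B], [C,G,A,F,D,B,E], [C,G,B,F,E,D,A],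
  [D,A,B,E,F,C,G], [D,A,B,E,G,C,F], [D,A,B,E,G,F,C], [D,A,B,F,G,C,E], [D,A,B,F,G,E,C], [D,A,B,G,E,C,F],
  [D,A,B,G,F,E,C], [D,A,C,G,F,E,B], [D,B,A,E,F,C,G], [D,B,A,E,G,F,C], [D,B,A,F,E,C,G], [D,B,A,G,E,C,F],
  [D,B,A,G,F,E,C], [D,C,A,E,G,F,B], [D,C,A,F,G,B,E], [D,C,A,G,F,B,E], [D,E,A,F,G,B,C], [D,E,A,F,G,C,B],
  [D,F,A,E,G,C,B], [D,F,B,E,G,C,A], [E,A,B,F,G,D,C], [E,A,B,G,F,C,D]]"

definition "cert_Q_1minus6 = [
  [E,C,B,G,F,D,A], [E,D,A,G,F,C,B], [E,D,B,G,F,C,A]]"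

definition "cert_Q_1plus0 = [
  [A,B,C,D,E,F,G], [A,B,C,D,E,G,F], [A,B,C,D,F,E,G], [A,B,C,D,F,G,E], [A,B,C,E,F,G,D], [A,B,C,F,E,D,G],
  [A,B,C,G,E,D,F], [A,B,D,C,G,E,F], [A,B,D,C,G,F,E], [A,B,D,E,C,F,G], [A,B,D,E,C,G,F], [A,B,D,F,C,G,E],
  [A,B,D,F,E,G,C], [A,B,D,G,E,F,C], [A,B,E,C,D,G,F], [A,B,E,C,G,F,D], [A,B,E,D,C,F,G], [A,B,E,F,D,G,C],
  [A,C,B,D,F,G,E], [A,C,B,D,G,E,F], [A,C,B,D,G,F,E], [A,C,B,E,G,D,F], [A,C,B,E,G,F,D], [A,C,B,F,G,E,D],
  [A,C,B,G,E,F,D], [A,C,D,B,G,E,F], [A,C,D,F,B,E,G], [A,C,D,F,B,G,E], [A,C,D,F,G,E,B], [A,C,D,G,B,E,F],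
  [A,C,D,G,F,E,B], [A,C,E,B,F,G,D], [A,C,E,D,B,F,G], [A,C,E,G,B,F,D], [A,C,F,D,E,G,B], [A,C,F,E,D,G,B],
  [A,D,B,C,G,E,F], [A,D,B,E,C,G,F], [A,D,B,F,C,G,E], [A,D,B,F,G,C,E]]"

definition "cert_Q_1plus1 = [
  [A,D,B,G,C,F,E], [A,D,B,G,E,C,F], [A,D,C,B,E,G,F], [A,D,C,B,F,G,E], [A,D,C,B,G,E,F], [A,D,C,E,B,F,G],
  [A,D,C,E,G,F,B], [A,D,C,F,G,E,B], [A,D,C,G,B,E,F], [A,D,E,B,C,F,G], [A,D,E,B,C,G,F], [A,D,E,B,G,F,C],
  [A,D,E,C,G,F,B], [A,D,F,C,E,G,B], [A,D,F,E,B,G,C], [A,D,F,E,C,G,B], [A,E,B,C,D,F,G], [A,E,B,C,D,G,F],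
  [A,E,B,C,G,D,F], [A,E,B,F,D,C,G], [A,E,B,G,D,C,F], [A,E,B,G,D,F,C], [A,E,C,B,D,G,F], [A,E,C,B,F,D,G],
  [A,E,C,B,G,D,F], [A,E,C,D,B,G,F], [A,E,C,F,B,G,D], [A,E,C,G,F,D,B], [A,E,D,F,C,G,B], [A,E,D,G,C,F,B],
  [A,E,F,B,D,G,C], [A,E,F,C,B,G,D], [A,F,B,C,D,G,E], [A,F,B,D,G,C,E], [A,F,B,E,D,G,C], [A,F,B,G,E,C,D],
  [A,F,C,B,D,E,G], [A,F,C,D,E,G,B], [A,F,C,E,B,D,G], [A,F,C,E,B,G,D]]"

definition "cert_Q_1plus2 = [
  [A,F,C,E,D,G,B], [A,F,C,G,B,E,D], [A,F,D,C,B,E,G], [A,F,D,E,C,G,B], [A,F,D,G,C,E,B], [A,F,E,D,B,G,C],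
  [A,G,B,C,D,E,F], [A,G,B,C,E,D,F], [A,G,B,C,E,F,D], [A,G,B,C,F,D,E], [A,G,B,C,F,E,D], [A,G,B,D,F,E,C],
  [A,G,B,E,D,C,F], [A,G,B,E,F,D,C], [A,G,B,F,D,E,C], [A,G,C,D,F,E,B], [A,G,C,E,B,D,F], [A,G,C,E,D,F,B],
  [A,G,D,B,C,E,F], [A,G,D,C,B,F,E], [A,G,D,E,B,F,C], [A,G,E,C,B,F,D], [A,G,E,C,D,F,B], [B,A,C,D,F,E,G],
  [B,A,C,F,D,E,G], [B,A,C,F,D,G,E], [B,A,C,F,G,E,D], [B,A,C,G,E,F,D], [B,A,D,C,F,G,E], [B,A,D,G,F,E,C],
  [B,A,E,C,D,F,G], [B,A,E,C,D,G,F], [B,A,E,C,F,G,D], [B,A,E,D,C,F,G], [B,A,E,D,C,G,F], [B,A,F,C,D,G,E],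
  [B,A,F,C,E,G,D], [B,A,F,E,C,G,D], [B,A,F,E,D,G,C], [B,C,A,D,E,G,F]]"

definition "cert_Q_1plus3 = [
  [B,C,A,D,F,G,E], [B,C,A,E,G,D,F], [B,C,A,E,G,F,D], [B,C,A,F,E,D,G], [B,C,D,E,G,F,A], [B,C,E,D,F,G,A],
  [B,D,A,E,F,G,C], [B,D,A,E,G,F,C], [B,D,A,F,G,C,E], [B,D,C,E,G,F,A], [B,D,C,F,E,G,A], [B,D,C,G,F,E,A],
  [B,D,E,C,F,G,A], [B,D,E,F,C,G,A], [B,D,E,G,C,F,A], [B,D,F,E,C,G,A], [B,E,A,D,F,C,G], [B,E,A,F,G,C,D],
  [B,E,A,G,C,F,D], [B,E,A,G,F,C,D], [B,E,C,D,F,G,A], [B,E,D,C,F,G,A], [B,E,D,G,C,F,A], [B,E,F,D,C,G,A],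
  [B,F,A,C,D,E,G], [B,F,A,C,E,G,D], [B,F,A,C,G,D,E], [B,F,A,D,G,E,C], [B,F,A,E,C,D,G], [B,F,A,E,C,G,D],
  [B,F,A,E,D,C,G], [B,F,C,E,D,G,A], [B,F,C,G,D,E,A], [B,F,C,G,E,D,A], [B,F,D,C,G,E,A], [B,F,D,E,C,G,A],
  [B,G,A,C,D,F,E], [B,G,A,D,E,C,F], [B,G,A,E,C,D,F], [B,G,A,E,D,F,C]]"

definition "cert_Q_1plus4 = [
  [B,G,A,F,C,E,D], [B,G,C,D,E,F,A], [B,G,C,D,F,E,A], [C,A,B,D,F,E,G], [C,A,B,D,F,G,E], [C,A,B,D,G,E,F],
  [C,A,B,F,D,E,G], [C,A,B,F,E,D,G], [C,A,B,G,E,D,F], [C,A,B,G,F,E,D], [C,A,D,E,F,G,B], [C,A,D,G,E,F,B],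
  [C,B,A,D,E,G,F], [C,B,A,E,F,G,D], [C,B,A,E,G,D,F], [C,B,A,E,G,F,D], [C,B,A,F,G,D,E], [C,B,A,G,D,E,F],
  [C,B,A,G,F,E,D], [C,B,D,G,F,E,A], [C,B,E,D,F,G,A], [C,B,E,F,D,G,A], [C,D,A,F,E,G,B], [C,D,A,F,G,E,B],
  [C,D,B,E,F,G,A], [C,D,B,G,E,F,A], [C,D,B,G,F,E,A], [C,E,A,D,G,F,B], [C,E,A,F,D,B,G], [C,E,A,G,D,B,F],
  [C,E,A,G,F,B,D], [C,E,B,G,F,D,A], [C,F,A,E,D,B,G], [C,F,A,E,D,G,B], [C,F,B,E,G,D,A], [C,F,B,G,E,D,A],
  [C,G,A,D,F,B,E], [C,G,B,E,F,D,A], [D,A,B,G,E,F,C], [D,A,B,G,F,C,E]]"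

definition "cert_Q_1plus5 = [
  [D,B,A,E,G,C,F], [D,B,A,F,G,C,E], [D,B,A,F,G,E,C], [D,B,A,G,E,F,C], [D,B,C,E,F,G,A], [D,C,A,E,F,G,B],
  [D,C,A,E,G,B,F], [D,C,A,G,E,B,F], [D,C,A,G,E,F,B], [D,C,A,G,F,E,B], [D,C,B,E,F,G,A], [D,E,B,F,G,C,A],
  [D,F,A,G,E,C,B], [D,F,B,G,E,C,A], [D,G,A,F,E,B,C], [D,G,A,F,E,C,B], [D,G,B,E,F,C,A], [E,A,B,G,F,D,C],
  [E,A,C,G,F,D,B], [E,B,A,F,G,D,C], [E,B,A,G,F,D,C], [E,B,C,F,G,D,A], [E,C,B,F,G,D,A], [E,D,A,G,F,B,C],
  [E,D,B,F,G,C,A]]"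

definition "cert_Q_2minus0 = [
  [A,B,C,E,D,G,F], [A,B,C,E,F,G,D], [A,B,C,E,G,F,D], [A,B,C,F,E,D,G], [A,B,C,F,G,E,D], [A,B,C,G,E,D,F],
  [A,B,C,G,E,F,D], [A,B,D,E,C,F,G], [A,C,B,F,G,E,D], [A,C,B,G,D,F,E], [A,C,B,G,F,D,E], [A,D,B,C,E,G,F],
  [A,D,B,C,F,G,E], [A,D,B,E,F,G,C], [A,D,B,E,G,C,F], [A,D,B,E,G,F,C], [A,D,B,F,E,C,G], [A,D,B,G,E,C,F],
  [A,D,B,G,F,C,E], [A,E,B,D,F,G,C], [A,F,B,C,G,D,E], [B,A,C,D,F,G,E], [B,A,C,F,D,G,E], [B,A,C,F,E,D,G],
  [B,A,C,F,G,E,D], [B,A,C,G,E,D,F], [B,A,C,G,E,F,D], [B,A,D,F,C,G,E], [B,A,D,G,C,E,F], [B,C,A,D,F,G,E],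
  [B,C,A,E,F,G,D], [B,C,A,E,G,D,F], [B,C,A,E,G,F,D], [B,C,A,F,E,D,G], [B,C,A,G,E,D,F], [B,D,A,C,E,F,G],
  [B,D,A,C,E,G,F], [B,D,A,E,F,G,C], [B,D,A,E,G,C,F], [B,D,A,E,G,F,C]]"

definition "cert_Q_2minus1 = [
  [B,D,A,F,E,C,G], [B,D,A,F,E,G,C], [B,E,A,D,F,C,G], [B,E,A,F,G,D,C], [B,F,A,C,G,E,D], [B,F,A,D,G,C,E],
  [C,A,B,D,F,G,E], [C,A,B,D,G,F,E], [C,A,B,E,D,F,G], [C,A,B,E,F,D,G], [C,A,B,F,D,G,E], [C,A,B,F,G,D,E],
  [C,A,B,G,D,F,E], [C,A,B,G,E,D,F], [C,A,B,G,F,E,D], [C,A,D,F,B,G,E], [C,A,D,G,B,F,E], [C,B,A,D,F,G,E],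
  [C,B,A,E,F,D,G], [C,B,A,E,F,G,D], [C,B,A,E,G,F,D], [C,B,A,F,D,E,G], [C,B,A,G,E,D,F], [C,D,A,B,E,F,G],
  [C,D,A,B,G,E,F], [C,D,A,E,F,B,G], [C,D,A,F,E,G,B], [C,E,A,B,G,F,D], [C,E,A,D,G,B,F], [C,E,A,D,G,F,B],
  [C,F,A,B,G,D,E], [C,F,A,B,G,E,D], [D,A,B,C,G,E,F], [D,A,B,E,F,G,C], [D,A,B,F,C,G,E], [D,A,B,G,E,C,F],
  [D,A,B,G,E,F,C], [D,A,B,G,F,E,C], [D,A,C,E,B,G,F], [D,B,A,C,F,G,E]]"

definition "cert_Q_2minus2 = [
  [D,B,A,C,G,F,E], [D,B,A,E,G,C,F], [D,B,A,F,C,E,G], [D,B,A,G,C,E,F], [D,B,A,G,F,C,E], [D,B,A,G,F,E,C],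
  [D,C,A,B,F,E,G], [D,C,A,B,F,G,E], [D,C,A,B,G,E,F], [D,C,A,E,F,B,G], [D,C,A,E,G,B,F], [D,C,A,F,E,G,B],
  [D,C,A,G,E,B,F], [D,C,A,G,E,F,B], [D,E,A,C,F,G,B], [E,A,B,C,G,F,D], [E,A,B,D,F,G,C], [E,A,B,F,C,D,G],
  [E,A,B,F,C,G,D], [E,A,B,G,D,C,F], [E,A,B,G,D,F,C], [E,B,A,C,D,F,G], [E,B,A,C,F,D,G], [E,B,A,C,G,F,D],
  [E,B,A,D,F,C,G], [E,B,A,D,F,G,C], [E,B,A,G,C,D,F], [E,B,A,G,C,F,D], [E,B,A,G,D,C,F], [E,B,A,G,F,C,D],
  [E,C,A,B,D,F,G], [E,C,A,B,G,F,D], [E,C,A,F,D,G,B], [E,C,A,F,G,B,D], [E,D,A,B,F,G,C], [E,D,A,C,F,B,G],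
  [E,D,A,C,G,B,F], [E,F,A,C,G,D,B], [E,F,A,D,G,C,B], [F,A,B,C,G,D,E]]"

definition "cert_Q_2minus3 = [
  [F,A,B,D,C,G,E], [F,A,B,D,E,G,C], [F,A,B,D,G,C,E], [F,A,B,E,D,C,G], [F,A,B,G,C,D,E], [F,A,B,G,E,D,C],
  [F,A,C,E,B,D,G], [F,A,C,E,B,G,D], [F,B,A,C,D,G,E], [F,B,A,C,E,G,D], [F,B,A,C,G,E,D], [F,B,A,D,C,G,E],
  [F,B,A,E,C,D,G], [F,B,A,E,D,C,G], [F,B,A,G,D,C,E], [F,B,A,G,E,D,C], [F,C,A,B,D,E,G], [F,C,A,B,E,D,G],
  [F,C,A,B,E,G,D], [F,C,A,B,G,D,E], [F,C,A,E,D,G,B], [F,C,A,G,D,B,E], [F,C,A,G,E,B,D], [F,D,A,B,G,C,E],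
  [F,D,A,G,E,C,B], [G,A,B,C,F,E,D], [G,A,B,E,D,C,F], [G,A,B,E,F,C,D], [G,A,B,F,C,E,D], [G,A,C,F,B,E,D],
  [G,B,A,D,F,C,E], [G,B,A,E,C,F,D], [G,B,A,E,F,D,C], [G,C,A,B,E,D,F], [G,C,A,B,E,F,D], [G,C,A,B,F,D,E],
  [G,C,A,E,D,B,F], [G,C,A,E,F,B,D], [G,C,A,F,D,B,E], [G,D,A,B,F,C,E]]"

definition "cert_Q_2minus4 = [
  [G,D,A,C,E,F,B], [G,D,A,C,F,E,B], [G,E,A,C,F,D,B], [G,E,A,D,F,C,B]]"

definition "cert_Q_2plus0 = [
  [A,B,C,D,G,E,F], [A,B,C,E,D,F,G], [A,B,C,E,F,D,G], [A,B,C,F,D,E,G], [A,B,C,F,E,G,D], [A,B,C,F,G,D,E],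
  [A,B,C,G,D,E,F], [A,B,C,G,D,F,E], [A,B,D,F,C,E,G], [A,B,D,G,C,F,E], [A,C,B,D,E,G,F], [A,C,B,D,F,E,G],
  [A,C,B,D,G,F,E], [A,C,B,E,D,F,G], [A,C,B,E,D,G,F], [A,C,B,E,G,D,F], [A,C,B,E,G,F,D], [A,C,B,F,E,G,D],
  [A,C,B,G,E,F,D], [A,C,B,G,F,E,D], [A,D,B,E,F,C,G], [A,D,B,F,G,C,E], [A,D,B,F,G,E,C], [A,D,B,G,F,E,C],
  [A,E,B,C,G,F,D], [A,E,B,D,G,C,F], [A,E,B,G,F,C,D], [A,F,B,D,G,E,C], [B,A,C,D,E,F,G], [B,A,C,D,G,E,F],
  [B,A,C,D,G,F,E], [B,A,C,G,D,F,E], [B,C,A,D,E,F,G], [B,C,A,D,G,F,E], [B,C,A,E,D,F,G], [B,C,A,E,F,D,G],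
  [B,C,A,F,G,D,E], [B,C,A,G,D,F,E], [B,C,A,G,E,F,D], [B,C,A,G,F,D,E]]"

definition "cert_Q_2plus1 = [
  [B,C,A,G,F,E,D], [B,D,A,C,F,G,E], [B,D,A,F,G,E,C], [B,D,A,G,E,C,F], [B,D,A,G,E,F,C], [B,E,A,C,F,G,D],
  [B,E,A,C,G,D,F], [B,E,A,D,G,F,C], [B,E,A,G,F,C,D], [B,F,A,E,G,C,D], [B,F,A,E,G,D,C], [C,A,B,D,F,E,G],
  [C,A,B,E,D,G,F], [C,A,B,E,G,D,F], [C,A,B,E,G,F,D], [C,A,B,F,G,E,D], [C,A,B,G,E,F,D], [C,A,D,F,B,E,G],
  [C,A,D,G,B,E,F], [C,B,A,D,F,E,G], [C,B,A,E,D,F,G], [C,B,A,F,D,G,E], [C,B,A,F,G,D,E], [C,B,A,G,D,F,E],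
  [C,B,A,G,F,E,D], [C,D,A,B,E,G,F], [C,D,A,B,F,G,E], [C,D,A,B,G,F,E], [C,D,A,E,G,B,F], [C,D,A,G,E,B,F],
  [C,D,A,G,E,F,B], [C,E,A,B,G,D,F], [C,E,A,D,F,B,G], [C,E,A,G,F,D,B], [C,F,A,E,G,B,D], [D,A,B,E,G,F,C],
  [D,A,B,F,E,G,C], [D,A,B,G,C,E,F], [D,A,B,G,C,F,E], [D,A,C,F,B,G,E]]"

definition "cert_Q_2plus2 = [
  [D,A,C,G,B,E,F], [D,B,A,C,E,F,G], [D,B,A,C,F,E,G], [D,B,A,C,G,E,F], [D,B,A,E,C,F,G], [D,B,A,E,F,C,G],
  [D,B,A,E,F,G,C], [D,B,A,E,G,F,C], [D,B,A,F,G,C,E], [D,B,A,G,C,F,E], [D,B,A,G,E,C,F], [D,C,A,B,E,G,F],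
  [D,C,A,E,G,F,B], [D,C,A,F,E,B,G], [D,E,A,B,F,C,G], [D,E,A,B,F,G,C], [D,E,A,F,G,B,C], [D,E,A,G,F,B,C],
  [D,F,A,C,G,E,B], [D,F,A,E,G,C,B], [E,A,B,C,G,D,F], [E,A,B,D,C,G,F], [E,A,B,D,F,C,G], [E,A,B,D,G,F,C],
  [E,A,B,F,G,D,C], [E,A,B,G,C,D,F], [E,A,B,G,C,F,D], [E,A,B,G,F,C,D], [E,A,B,G,F,D,C], [E,B,A,D,C,G,F],
  [E,B,A,D,G,F,C], [E,B,A,F,C,D,G], [E,B,A,G,F,D,C], [E,C,A,B,D,G,F], [E,C,A,B,G,D,F], [E,C,A,D,G,B,F],
  [E,C,A,G,D,F,B], [E,D,A,B,G,C,F], [E,D,A,C,F,G,B], [E,D,A,C,G,F,B]]"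

definition "cert_Q_2plus3 = [
  [E,F,A,C,G,B,D], [F,A,B,D,C,E,G], [F,A,B,E,C,D,G], [F,A,B,E,C,G,D], [F,A,B,G,C,E,D], [F,A,B,G,E,C,D],
  [F,B,A,C,G,D,E], [F,B,A,D,G,C,E], [F,B,A,E,D,G,C], [F,B,A,E,G,C,D], [F,B,A,G,C,D,E], [F,B,A,G,D,E,C],
  [F,B,A,G,E,C,D], [F,C,A,D,E,G,B], [F,C,A,D,G,B,E], [F,C,A,D,G,E,B], [F,C,A,E,D,B,G], [F,C,A,E,G,B,D],
  [F,C,A,G,E,D,B], [F,D,A,C,E,G,B], [F,D,A,C,G,E,B], [F,D,A,E,G,B,C], [F,E,A,B,G,C,D], [F,E,A,D,G,B,C],
  [G,A,B,C,D,E,F], [G,A,B,D,E,C,F], [G,A,B,D,E,F,C], [G,A,B,E,F,D,C], [G,A,B,F,D,C,E], [G,A,B,F,D,E,C],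
  [G,A,C,D,B,F,E], [G,A,C,E,B,F,D], [G,A,C,F,B,D,E], [G,B,A,C,D,E,F], [G,B,A,C,E,F,D], [G,B,A,C,F,E,D],
  [G,B,A,D,E,C,F], [G,B,A,E,D,C,F], [G,B,A,E,D,F,C], [G,B,A,F,D,C,E]]"

definition "cert_Q_2plus4 = [
  [G,B,A,F,D,E,C], [G,B,A,F,E,C,D], [G,C,A,D,F,B,E], [G,C,A,F,E,B,D], [G,D,A,B,F,E,C], [G,D,A,F,E,C,B],
  [G,E,A,B,F,D,C]]"

definition "cert_Q_3minus0 = [
  [A,B,C,D,F,G,E], [A,B,C,E,G,F,D], [A,B,C,G,F,D,E], [A,B,D,E,C,F,G], [A,B,D,F,G,C,E], [A,B,D,F,G,E,C],
  [A,B,D,G,F,C,E], [A,B,E,F,D,G,C], [A,B,E,F,G,D,C], [A,B,F,C,G,D,E], [A,B,F,D,E,C,G], [A,B,F,G,C,E,D],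
  [A,B,G,D,E,C,F], [A,B,G,E,C,D,F], [A,B,G,F,E,D,C], [A,C,B,E,G,F,D], [A,C,D,F,E,G,B], [A,C,E,D,B,F,G],
  [A,C,E,D,F,B,G], [A,C,F,G,B,D,E], [A,C,F,G,D,B,E], [A,C,G,B,F,E,D], [A,C,G,E,B,F,D], [A,C,G,E,D,B,F],
  [A,C,G,E,D,F,B], [A,C,G,F,B,D,E], [A,D,B,F,G,C,E], [A,D,B,G,E,C,F], [A,D,C,B,F,E,G], [A,D,C,E,F,B,G],
  [A,D,C,E,G,F,B], [A,D,C,G,B,E,F], [A,D,E,B,G,F,C], [A,D,E,F,G,C,B], [A,D,F,B,C,E,G], [A,D,F,B,E,G,C],
  [A,D,F,E,C,B,G], [A,D,F,E,C,G,B], [A,D,F,G,B,C,E], [A,D,G,E,B,F,C]]"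

definition "cert_Q_3minus1 = [
  [A,E,B,D,F,G,C], [A,E,B,F,D,G,C], [A,E,B,G,D,F,C], [A,E,C,D,F,G,B], [A,E,D,F,C,G,B], [A,E,F,D,G,B,C],
  [A,F,B,D,C,G,E], [A,F,B,D,E,G,C], [A,F,B,E,C,G,D], [A,F,B,G,E,C,D], [A,F,C,B,D,E,G], [A,F,C,D,B,E,G],
  [A,F,C,D,E,G,B], [A,F,E,B,C,D,G], [A,F,E,B,D,C,G], [A,F,E,C,G,D,B], [A,F,E,D,B,C,G], [A,F,E,G,B,C,D],
  [A,F,G,B,E,C,D], [A,F,G,C,B,E,D], [A,F,G,C,E,B,D], [A,F,G,E,D,B,C], [A,G,B,C,D,F,E], [A,G,B,D,C,E,F],
  [A,G,B,E,C,D,F], [A,G,C,E,F,B,D], [A,G,D,C,B,F,E], [A,G,D,E,C,F,B], [A,G,E,D,B,F,C], [A,G,E,D,C,F,B],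
  [A,G,E,D,F,C,B], [A,G,F,E,B,D,C], [B,A,C,D,E,G,F], [B,A,C,E,D,G,F], [B,A,C,F,G,D,E], [B,A,D,E,F,G,C],
  [B,A,D,E,G,C,F], [B,A,D,F,E,C,G], [B,A,D,G,F,E,C], [B,A,E,C,D,G,F]]"

definition "cert_Q_3minus2 = [
  [B,A,E,D,C,G,F], [B,A,F,D,C,E,G], [B,A,G,E,D,C,F], [B,A,G,F,C,D,E], [B,C,D,A,G,E,F], [B,C,D,A,G,F,E],
  [B,C,E,F,A,D,G], [B,C,E,G,D,F,A], [B,C,E,G,F,A,D], [B,C,F,A,G,E,D], [B,C,F,D,E,G,A], [B,C,F,G,A,D,E],
  [B,C,G,A,F,E,D], [B,C,G,D,A,E,F], [B,D,C,E,F,G,A], [B,D,C,G,E,F,A], [B,D,C,G,F,A,E], [B,D,C,G,F,E,A],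
  [B,D,E,A,G,C,F], [B,D,E,A,G,F,C], [B,D,E,C,A,F,G], [B,D,F,A,C,E,G], [B,D,F,A,G,C,E], [B,D,F,A,G,E,C],
  [B,D,F,G,A,E,C], [B,E,D,A,F,C,G], [B,E,D,C,A,F,G], [B,E,D,C,G,A,F], [B,E,D,G,A,F,C], [B,E,D,G,C,F,A],
  [B,E,F,A,G,D,C], [B,E,F,C,G,D,A], [B,E,G,A,C,D,F], [B,E,G,A,C,F,D], [B,F,D,A,C,G,E], [B,F,D,E,C,G,A],
  [B,F,E,C,A,D,G], [B,F,E,D,C,G,A], [B,F,G,E,D,C,A], [B,G,C,A,E,F,D]]"

definition "cert_Q_3minus3 = [
  [B,G,C,D,A,E,F], [B,G,C,D,E,F,A], [B,G,C,D,F,E,A], [B,G,C,F,D,E,A], [B,G,D,A,C,F,E], [B,G,D,A,F,C,E],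
  [B,G,D,C,E,A,F], [B,G,D,C,F,A,E], [B,G,D,C,F,E,A], [B,G,E,C,D,A,F], [B,G,E,C,F,A,D], [B,G,F,A,C,E,D],
  [C,A,D,G,E,F,B], [C,A,E,B,G,D,F], [C,A,E,D,B,G,F], [C,A,E,F,D,B,G], [C,A,E,F,D,G,B], [C,A,F,E,B,G,D],
  [C,A,F,G,D,E,B], [C,A,G,B,F,E,D], [C,A,G,D,F,E,B], [C,B,D,A,G,F,E], [C,B,D,F,E,A,G], [C,B,D,G,F,A,E],
  [C,B,E,A,D,G,F], [C,B,E,A,G,F,D], [C,B,E,D,F,A,G], [C,B,E,D,G,F,A], [C,B,E,F,A,G,D], [C,B,F,E,G,A,D],
  [C,B,F,G,A,D,E], [C,B,F,G,D,E,A], [C,B,G,D,A,E,F], [C,D,E,A,B,F,G], [C,D,E,B,G,A,F], [C,D,E,G,A,B,F],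
  [C,D,F,A,B,E,G], [C,D,G,E,F,A,B], [C,E,D,B,F,A,G], [C,E,D,B,G,A,F]]"

definition "cert_Q_3minus4 = [
  [C,E,D,F,B,G,A], [C,E,F,B,A,D,G], [C,E,F,D,B,A,G], [C,E,G,B,D,F,A], [C,E,G,D,F,B,A], [C,E,G,F,B,A,D],
  [C,F,E,A,D,G,B], [C,F,E,A,G,B,D], [C,F,G,B,D,A,E], [C,F,G,D,A,E,B], [C,F,G,E,A,D,B], [C,G,D,E,A,F,B],
  [C,G,D,E,F,B,A], [C,G,E,A,B,F,D], [C,G,E,A,F,D,B], [C,G,F,B,E,A,D], [C,G,F,D,B,A,E], [C,G,F,E,D,A,B],
  [D,A,E,B,F,C,G], [D,A,E,B,G,C,F], [D,A,E,G,B,F,C], [D,A,F,B,E,C,G], [D,A,F,B,G,E,C], [D,A,F,C,E,B,G],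
  [D,A,F,G,B,C,E], [D,A,F,G,C,B,E], [D,A,F,G,E,B,C], [D,B,E,C,A,F,G], [D,B,E,G,A,C,F], [D,B,F,A,E,C,G],
  [D,B,F,C,E,G,A], [D,B,F,E,G,C,A], [D,B,F,G,E,A,C], [D,B,G,A,F,E,C], [D,B,G,C,E,F,A], [D,B,G,C,F,E,A],
  [D,B,G,E,A,C,F], [D,C,E,A,B,G,F], [D,C,E,F,B,A,G], [D,C,E,F,G,A,B]]"

definition "cert_Q_3minus5 = [
  [D,C,F,B,G,A,E], [D,C,F,G,E,A,B], [D,C,G,A,E,F,B], [D,C,G,B,A,F,E], [D,C,G,F,A,B,E], [D,E,F,A,C,B,G],
  [D,E,F,B,A,G,C], [D,E,F,B,C,A,G], [D,E,F,G,B,A,C], [D,E,G,F,B,C,A], [D,E,G,F,C,B,A], [D,F,E,A,C,B,G],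
  [D,F,E,B,C,G,A], [D,F,E,G,B,C,A], [D,F,G,A,C,B,E], [D,F,G,C,B,A,E], [D,G,E,A,C,B,F], [D,G,E,C,A,B,F],
  [D,G,F,C,B,A,E], [E,A,F,C,D,G,B], [E,A,G,B,C,F,D], [E,A,G,B,F,D,C], [E,A,G,C,F,B,D], [E,B,F,D,A,C,G],
  [E,B,G,C,D,A,F], [E,B,G,F,A,D,C], [E,C,F,A,G,B,D], [E,C,F,G,A,D,B], [E,C,F,G,D,A,B], [E,C,G,B,F,A,D],
  [E,C,G,D,F,A,B], [E,C,G,F,A,D,B], [E,C,G,F,B,D,A], [E,D,F,A,B,C,G], [E,D,F,A,C,B,G], [E,D,F,B,G,A,C],
  [E,D,G,C,F,B,A], [E,D,G,F,A,B,C], [E,D,G,F,C,A,B], [E,F,G,A,D,C,B]]"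

definition "cert_Q_3minus6 = [
  [E,F,G,C,D,B,A], [E,F,G,D,B,A,C], [E,F,G,D,C,B,A], [E,G,F,B,C,A,D], [E,G,F,D,B,C,A], [F,A,G,C,D,B,E],
  [F,A,G,D,B,E,C], [F,B,G,C,D,E,A], [F,B,G,D,C,A,E], [F,B,G,E,D,C,A], [F,C,G,D,A,E,B], [F,D,G,A,E,B,C],
  [F,E,G,A,B,C,D], [F,E,G,C,D,A,B], [F,E,G,D,A,B,C], [F,E,G,D,B,A,C]]"

definition "cert_Q_3plus0 = [
  [A,B,C,D,F,E,G], [A,B,C,F,D,E,G], [A,B,C,F,D,G,E], [A,B,D,F,C,E,G], [A,B,E,D,F,C,G], [A,B,E,F,D,C,G],
  [A,B,G,E,D,F,C], [A,B,G,F,C,D,E], [A,C,B,F,E,G,D], [A,C,B,G,E,F,D], [A,C,D,B,F,E,G], [A,C,D,B,G,E,F],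
  [A,C,D,F,B,G,E], [A,C,D,F,E,B,G], [A,C,E,B,F,G,D], [A,C,E,D,G,F,B], [A,C,E,F,B,D,G], [A,C,F,B,E,G,D],
  [A,C,F,D,B,E,G], [A,C,F,D,G,B,E], [A,C,G,B,D,F,E], [A,C,G,B,E,F,D], [A,C,G,F,B,E,D], [A,D,B,E,G,C,F],
  [A,D,B,G,E,F,C], [A,D,B,G,F,C,E], [A,D,C,F,E,G,B], [A,D,C,F,G,E,B], [A,D,E,B,G,C,F], [A,D,E,C,G,B,F],
  [A,D,F,B,G,C,E], [A,D,F,G,E,B,C], [A,D,G,B,F,E,C], [A,D,G,E,F,B,C], [A,D,G,F,E,B,C], [A,E,B,C,D,F,G],
  [A,E,B,F,C,G,D], [A,E,B,F,D,C,G], [A,E,B,F,G,C,D], [A,E,B,G,F,D,C]]"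

definition "cert_Q_3plus1 = [
  [A,E,D,B,F,C,G], [A,E,D,F,G,C,B], [A,E,F,C,D,G,B], [A,E,F,C,G,D,B], [A,E,G,B,C,D,F], [A,E,G,B,D,C,F],
  [A,E,G,B,F,C,D], [A,E,G,C,F,D,B], [A,E,G,D,F,B,C], [A,E,G,F,C,B,D], [A,F,B,E,D,G,C], [A,F,C,G,D,E,B],
  [A,F,D,B,G,C,E], [A,F,D,B,G,E,C], [A,F,D,E,C,B,G], [A,F,D,G,B,C,E], [A,F,D,G,C,E,B], [A,F,D,G,E,C,B],
  [A,F,E,C,D,B,G], [A,F,E,C,G,B,D], [A,F,G,B,C,E,D], [A,F,G,C,B,D,E], [A,F,G,C,E,D,B], [A,F,G,E,B,D,C],
  [A,G,B,E,F,C,D], [A,G,B,F,E,D,C], [A,G,C,F,B,D,E], [A,G,C,F,E,D,B], [A,G,D,C,F,B,E], [A,G,E,C,B,F,D],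
  [A,G,E,C,F,B,D], [A,G,E,D,B,C,F], [A,G,F,B,E,D,C], [A,G,F,E,C,B,D], [A,G,F,E,D,B,C], [B,A,C,E,D,F,G],
  [B,A,C,G,D,E,F], [B,A,D,C,F,G,E], [B,A,D,E,C,G,F], [B,A,E,C,F,G,D]]"

definition "cert_Q_3plus2 = [
  [B,A,E,D,G,C,F], [B,A,E,G,F,C,D], [B,A,F,G,D,E,C], [B,A,G,E,C,F,D], [B,C,D,F,A,G,E], [B,C,D,G,F,E,A],
  [B,C,E,D,A,F,G], [B,C,E,F,D,G,A], [B,C,E,G,D,A,F], [B,C,F,E,D,G,A], [B,C,G,A,D,E,F], [B,C,G,A,E,D,F],
  [B,D,C,E,A,F,G], [B,D,C,F,E,A,G], [B,D,E,C,A,G,F], [B,D,E,F,G,A,C], [B,D,F,A,C,G,E], [B,D,F,E,A,G,C],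
  [B,D,F,E,G,A,C], [B,D,G,A,F,C,E], [B,D,G,A,F,E,C], [B,D,G,F,A,C,E], [B,D,G,F,A,E,C], [B,E,C,A,D,F,G],
  [B,E,C,D,A,F,G], [B,E,C,G,D,A,F], [B,E,F,A,G,C,D], [B,E,F,C,G,A,D], [B,E,F,D,C,A,G], [B,E,F,G,D,A,C],
  [B,F,C,A,G,D,E], [B,F,C,A,G,E,D], [B,F,C,D,G,A,E], [B,F,C,G,D,A,E], [B,F,C,G,E,A,D], [B,F,D,A,E,C,G],
  [B,F,D,A,G,C,E], [B,F,D,C,G,E,A], [B,F,D,E,G,A,C], [B,F,G,A,D,C,E]]"

definition "cert_Q_3plus3 = [
  [B,F,G,C,E,D,A], [B,G,C,A,F,D,E], [B,G,D,E,A,C,F], [B,G,D,E,F,C,A], [B,G,E,A,C,D,F], [B,G,E,A,D,F,C],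
  [B,G,F,C,E,D,A], [B,G,F,D,A,C,E], [B,G,F,D,A,E,C], [B,G,F,D,C,A,E], [B,G,F,D,C,E,A], [B,G,F,E,A,D,C],
  [C,A,D,E,B,G,F], [C,A,D,F,B,G,E], [C,A,E,D,B,F,G], [C,A,E,D,G,F,B], [C,A,F,D,G,E,B], [C,A,F,E,D,G,B],
  [C,A,G,B,D,E,F], [C,A,G,B,E,F,D], [C,A,G,E,D,F,B], [C,B,D,A,G,E,F], [C,B,E,A,F,D,G], [C,B,E,D,A,G,F],
  [C,B,E,G,F,A,D], [C,B,F,D,A,G,E], [C,B,F,D,E,G,A], [C,B,F,E,A,D,G], [C,B,G,D,F,A,E], [C,D,E,A,G,B,F],
  [C,D,E,B,A,G,F], [C,D,E,B,G,F,A], [C,D,F,A,G,B,E], [C,D,F,B,E,A,G], [C,D,F,E,B,G,A], [C,D,G,A,F,B,E],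
  [C,D,G,B,E,A,F], [C,E,D,F,G,A,B], [C,E,D,G,A,B,F], [C,E,F,A,B,G,D]]"

definition "cert_Q_3plus4 = [
  [C,E,F,B,A,G,D], [C,E,F,D,B,G,A], [C,E,F,G,A,B,D], [C,E,F,G,B,A,D], [C,E,G,A,B,D,F], [C,E,G,B,F,D,A],
  [C,E,G,D,B,A,F], [C,F,D,B,A,E,G], [C,F,D,E,A,B,G], [C,F,D,E,G,A,B], [C,F,D,G,A,B,E], [C,F,E,B,A,G,D],
  [C,F,E,B,D,A,G], [C,F,E,B,G,D,A], [C,F,G,A,D,B,E], [C,F,G,B,A,D,E], [C,F,G,B,D,E,A], [C,F,G,E,B,D,A],
  [C,F,G,E,D,A,B], [C,G,D,B,F,A,E], [C,G,E,A,D,B,F], [C,G,E,D,A,F,B], [C,G,E,D,B,F,A], [C,G,E,D,F,B,A],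
  [C,G,F,A,B,E,D], [C,G,F,A,E,B,D], [C,G,F,A,E,D,B], [C,G,F,E,B,A,D], [D,A,E,C,F,G,B], [D,A,E,F,C,B,G],
  [D,A,E,F,G,B,C], [D,A,F,E,C,B,G], [D,A,G,B,F,C,E], [D,A,G,C,E,B,F], [D,B,E,A,C,F,G], [D,B,E,A,F,C,G],
  [D,B,E,C,F,G,A], [D,B,E,F,G,A,C], [D,B,E,G,A,F,C], [D,B,F,A,E,G,C]]"

definition "cert_Q_3plus5 = [
  [D,B,F,E,A,C,G], [D,B,F,E,C,G,A], [D,B,F,E,G,A,C], [D,B,F,G,C,E,A], [D,B,G,A,E,C,F], [D,B,G,A,E,F,C],
  [D,B,G,C,A,E,F], [D,B,G,E,F,A,C], [D,C,E,B,A,F,G], [D,C,E,B,F,A,G], [D,C,E,B,G,F,A], [D,C,E,F,A,G,B],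
  [D,C,F,E,A,B,G], [D,C,F,G,B,A,E], [D,C,G,B,E,F,A], [D,E,F,C,G,A,B], [D,E,F,G,C,B,A], [D,E,G,A,C,F,B],
  [D,E,G,A,F,C,B], [D,E,G,C,F,A,B], [D,F,E,A,B,C,G], [D,F,E,A,G,B,C], [D,F,E,C,B,G,A], [D,F,E,C,G,B,A],
  [D,F,E,G,C,A,B], [D,F,G,A,E,C,B], [D,F,G,B,A,E,C], [D,F,G,E,A,C,B], [D,F,G,E,C,B,A], [D,G,E,A,F,B,C],
  [D,G,E,C,B,A,F], [D,G,E,F,C,B,A], [D,G,F,A,E,C,B], [D,G,F,C,A,E,B], [E,A,F,C,G,B,D], [E,A,F,D,G,B,C],
  [E,A,F,D,G,C,B], [E,A,F,G,D,B,C], [E,A,G,B,C,D,F], [E,A,G,B,D,C,F]]"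

definition "cert_Q_3plus6 = [
  [E,A,G,B,D,F,C], [E,B,F,A,D,C,G], [E,B,F,C,G,A,D], [E,B,F,D,C,A,G], [E,B,F,D,G,A,C], [E,B,F,G,C,D,A],
  [E,C,F,A,D,B,G], [E,C,F,D,A,B,G], [E,C,G,A,D,F,B], [E,C,G,B,F,D,A], [E,C,G,F,D,B,A], [E,D,F,B,C,A,G],
  [E,D,F,C,G,B,A], [E,D,F,G,B,C,A], [E,D,F,G,C,B,A], [E,D,G,A,C,B,F], [E,D,G,B,F,A,C], [E,D,G,C,B,A,F],
  [E,D,G,C,F,A,B], [E,D,G,F,A,C,B], [E,D,G,F,B,C,A], [E,D,G,F,C,B,A], [E,F,G,C,D,A,B], [E,F,G,D,C,A,B],
  [E,G,F,C,B,A,D], [E,G,F,C,B,D,A], [F,A,G,C,B,E,D], [F,B,G,A,E,C,D], [F,B,G,C,A,D,E], [F,B,G,C,E,A,D],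
  [F,B,G,D,E,A,C], [F,C,G,A,D,B,E], [F,C,G,B,D,E,A], [F,C,G,D,B,E,A], [F,C,G,E,B,A,D], [F,D,G,B,C,A,E],
  [F,D,G,C,B,A,E], [F,D,G,E,B,A,C], [F,D,G,E,C,B,A], [F,E,G,C,A,B,D]]"

definition "cert_Q_3plus7 = [
  [F,E,G,C,A,D,B], [F,E,G,D,A,C,B]]"

text \<open>As for \<open>cert_P\<close>, the two \<open>gauge\<close> terms sit at the ends of the
  edge and match \<open>Q_fix\<close> modulo 3. The second end is now
  \<open>aedcbfg\<close>.\<close>

definition cert_Q :: certificate where
  "cert_Q = [
    (keys_gauge Minus, [[A,B,C,D,E,F,G], [A,E,D,C,B,F,G]]),
    (keys1 Minus, cert_Q_1minus0),
    (keys1 Minus, cert_Q_1minus1),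
    (keys1 Minus, cert_Q_1minus2),
    (keys1 Minus, cert_Q_1minus3),
    (keys1 Minus, cert_Q_1minus4),
    (keys1 Minus, cert_Q_1minus5),
    (keys1 Minus, cert_Q_1minus6),
    (keys1 Plus, cert_Q_1plus0),
    (keys1 Plus, cert_Q_1plus1),
    (keys1 Plus, cert_Q_1plus2),
    (keys1 Plus, cert_Q_1plus3),
    (keys1 Plus, cert_Q_1plus4),
    (keys1 Plus, cert_Q_1plus5),
    (keys2 Minus, cert_Q_2minus0),
    (keys2 Minus, cert_Q_2minus1),
    (keys2 Minus, cert_Q_2minus2),
    (keys2 Minus, cert_Q_2minus3),
    (keys2 Minus, cert_Q_2minus4),
    (keys2 Plus, cert_Q_2plus0),
    (keys2 Plus, cert_Q_2plus1),
    (keys2 Plus, cert_Q_2plus2),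
    (keys2 Plus, cert_Q_2plus3),
    (keys2 Plus, cert_Q_2plus4),
    (keys3 Minus, cert_Q_3minus0),
    (keys3 Minus, cert_Q_3minus1),
    (keys3 Minus, cert_Q_3minus2),
    (keys3 Minus, cert_Q_3minus3),
    (keys3 Minus, cert_Q_3minus4),
    (keys3 Minus, cert_Q_3minus5),
    (keys3 Minus, cert_Q_3minus6),
    (keys3 Plus, cert_Q_3plus0),
    (keys3 Plus, cert_Q_3plus1),
    (keys3 Plus, cert_Q_3plus2),
    (keys3 Plus, cert_Q_3plus3),
    (keys3 Plus, cert_Q_3plus4),
    (keys3 Plus, cert_Q_3plus5),
    (keys3 Plus, cert_Q_3plus6),
    (keys3 Plus, cert_Q_3plus7)]"

text \<open>With the edge itself put in front, all coefficients of terms \<open>P\<close> vanish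
  modulo 3. No values of \<open>P\<close> or \<open>Q\<close> enter the computation, so one run
  serves every solution of the relations.\<close>

lemma cancels_P_P: "cancels sel_P ((keys_P Plus, [[A,B,C,D,E,F,G]]) # cert_P)"
  by code_simp

lemma cancels_P_Q: "cancels sel_Q ((keys_P Plus, [[A,B,C,D,E,F,G]]) # cert_P)"
  by code_simp

lemma cancels_Q_Q: "cancels sel_Q ((keys_Q Plus, [[A,B,C,D,E,F,G]]) # cert_Q)"
  by code_simp

end

section \<open>Descent\<close>

fun key_val_P :: "(var7 \<Rightarrow> var7 \<Rightarrow> var7 \<Rightarrow> var7 \<Rightarrow> var7 \<Rightarrow> var7 \<Rightarrow> var7 \<Rightarrow> int) \<Rightarrow> key \<Rightarrow> int" where
  "key_val_P T (KP s a b c d e f g) = digit_val s * T a b c d e f g"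
| "key_val_P T (KQ s a b c d e f g) = 0"

fun key_val_Q :: "(var7 \<Rightarrow> var7 \<Rightarrow> var7 \<Rightarrow> var7 \<Rightarrow> var7 \<Rightarrow> var7 \<Rightarrow> var7 \<Rightarrow> int) \<Rightarrow> key \<Rightarrow> int" where
  "key_val_Q T (KP s a b c d e f g) = 0"
| "key_val_Q T (KQ s a b c d e f g) = digit_val s * T a b c d e f g"

text \<open>Each term \<open>P\<close> has one first letter and is therefore selected for exactly
  one \<open>x\<close>, so the separate tables together account for all terms.\<close>

lemma sum_sel_P:
  "(\<Sum>x\<in>UNIV. sum_list (map (entry_val (T x)) (sel_P x ks))) = sum_list (map (key_val_P T) ks)"
proof (induction ks)
  case (Cons k ks)
  show ?case
  proof (cases k)
    case (KP s a b c d e f g)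
    have "sum_list (map (entry_val (T x)) (sel_P x (k # ks))) =
        (if x = a then digit_val s * T a b c d e f g else 0)
        + sum_list (map (entry_val (T x)) (sel_P x ks))" for x
      using KP by auto
    then show ?thesis
      using Cons KP by (simp add: sum.distrib)
  qed (use Cons in simp)
qed simp

lemma sum_sel_Q:
  "(\<Sum>x\<in>UNIV. sum_list (map (entry_val (T x)) (sel_Q x ks))) = sum_list (map (key_val_Q T) ks)"
proof (induction ks)
  case (Cons k ks)
  show ?case
  proof (cases k)
    case (KQ s a b c d e f g)
    have "sum_list (map (entry_val (T x)) (sel_Q x (k # ks))) =
        (if x = a then digit_val s * T a b c d e f g else 0)
        + sum_list (map (entry_val (T x)) (sel_Q x ks))" for x
      using KQ by auto
    then show ?thesis
      using Cons KQ by (simp add: sum.distrib)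
  qed (use Cons in simp)
qed simp

lemma total_eq_0: "\<forall>(pat, ws)\<in>set C. \<forall>w. v (pat w) = 0 \<Longrightarrow> total v C = 0"
  by (induction C) auto

lemma dvd_sum_list: "(\<And>x. x \<in> set xs \<Longrightarrow> (m::int) dvd x) \<Longrightarrow> m dvd sum_list xs"
  by (induction xs) auto

lemma dvd_total: "(\<And>ks. m dvd v ks) \<Longrightarrow> m dvd total v C"
  unfolding total_def by (auto intro!: dvd_sum_list)

locale var7_relations = gauged_relations P Q
  for P Q :: "var7 \<Rightarrow> var7 \<Rightarrow> var7 \<Rightarrow> var7 \<Rightarrow> var7 \<Rightarrow> var7 \<Rightarrow> var7 \<Rightarrow> int"
begin

definition keys_val :: "key list \<Rightarrow> int" where
  "keys_val ks = sum_list (map (key_val_P P) ks) + sum_list (map (key_val_Q Q) ks)"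

text \<open>The reordering of letters in \<open>key_P\<close> and \<open>key_Q\<close> does not
  change values, by \<open>P_sym\<close> and \<open>Q_sym\<close>.\<close>

lemma keys_val_simps [simp]:
  "keys_val [] = 0"
  "keys_val (key_P s a b c d e f g # ks) = digit_val s * P a b c d e f g + keys_val ks"
  "keys_val (key_Q s a b c d e f g # ks) = digit_val s * Q a b c d e f g + keys_val ks"
  by (simp_all add: keys_val_def key_P_def key_Q_def P_sym Q_sym)

text \<open>For seven letters this is \<open>rel1\<close> multiplied by the sign. A list of any
  other length yields no keys and has value 0, so the statement holds for every \<open>w\<close>,
  and certificates can be evaluated without inspecting their words.\<close>

lemma keys_val_keys1: "keys_val (keys1 s w) = 0"
proof (induction s w rule: keys1.induct)
  case (1 s a b c d e f g)
  show ?case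
    using arg_cong[OF rel1[of a b c d e f g], of "\<lambda>x. digit_val s * x"]
    by (simp add: digit_val_neg algebra_simps)
qed simp_all

lemma keys_val_keys2: "keys_val (keys2 s w) = 0"
proof (induction s w rule: keys2.induct)
  case (1 s a b c d e f g)
  show ?case
    using arg_cong[OF rel2[of a b c d e f g], of "\<lambda>x. digit_val s * x"]
    by (simp add: digit_val_neg algebra_simps)
qed simp_all

lemma keys_val_keys3: "keys_val (keys3 s w) = 0"
proof (induction s w rule: keys3.induct)
  case (1 s a b c d e f g)
  show ?case
    using arg_cong[OF rel3[of a b c d e f g], of "\<lambda>x. digit_val s * x"]
    by (simp add: digit_val_neg algebra_simps)
qed simp_all

lemma keys_val_gauge: "keys_val (keys_gauge s w) = 0"
proof (induction s w rule: keys_gauge.induct)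
  case (1 s a b c d e f g)
  show ?case
    using arg_cong[OF gauge_eq_0[of a b c d e f g], of "\<lambda>x. digit_val s * x"]
    by (simp add: digit_val_neg gauge_def walk_def algebra_simps)
qed simp_all

lemmas keys_val_zero = keys_val_keys1 keys_val_keys2 keys_val_keys3 keys_val_gauge

lemma total_cert: "total keys_val cert_P = 0" "total keys_val cert_Q = 0"
  by (rule total_eq_0, auto simp: cert_P_def cert_Q_def keys_val_zero)+

lemma total_split:
  "total keys_val C = total (\<lambda>ks. sum_list (map (key_val_P P) ks)) C
     + total (\<lambda>ks. sum_list (map (key_val_Q Q) ks)) C"
  unfolding keys_val_def by (rule total_add)

lemma cong_total_P:
  assumes "cancels sel_P C" and "\<And>a b c d e f g. q dvd P a b c d e f g"
  shows "[total (\<lambda>ks. sum_list (map (key_val_P P) ks)) C = 0] (mod 3 * q)"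
  using total_cancels[OF assms(1), of q P] assms(2) by (simp add: sum_sel_P)

lemma cong_total_Q:
  assumes "cancels sel_Q C" and "\<And>a b c d e f g. q dvd Q a b c d e f g"
  shows "[total (\<lambda>ks. sum_list (map (key_val_Q Q) ks)) C = 0] (mod 3 * q)"
  using total_cancels[OF assms(1), of q Q] assms(2) by (simp add: sum_sel_Q)

text \<open>The total of the extended certificate is computed twice. Its other entries are instances
  of relations and contribute 0, so it equals the value of the edge; by cancellation of coefficients
  it is 0 modulo \<open>3 * q\<close>.\<close>

lemma dvd_P:
  assumes "\<And>a b c d e f g. q dvd P a b c d e f g" and "\<And>a b c d e f g. q dvd Q a b c d e f g"
  shows "3 * q dvd P Xa Xb Xc Xd Xe Xf Xg"
proof -
  let ?C = "(keys_P Plus, [[Xa, Xb, Xc, Xd, Xe, Xf, Xg]]) # cert_P"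
  have "[total keys_val ?C = 0 + 0] (mod 3 * q)"
    unfolding total_split
    by (intro cong_add cong_total_P cong_total_Q cancels_P_P cancels_P_Q assms)
  then show ?thesis
    by (simp add: total_cert cong_0_iff)
qed

text \<open>The terms \<open>P\<close> need not cancel here: their values are already divisible by
  \<open>3 * q\<close>. Only the coefficients of terms \<open>Q\<close> are checked.\<close>

lemma dvd_Q:
  assumes "\<And>a b c d e f g. 3 * q dvd P a b c d e f g" and "\<And>a b c d e f g. q dvd Q a b c d e f g"
  shows "3 * q dvd Q Xa Xb Xc Xd Xe Xf Xg"
proof -
  let ?C = "(keys_Q Plus, [[Xa, Xb, Xc, Xd, Xe, Xf, Xg]]) # cert_Q"
  have "3 * q dvd key_val_P P k" for k
    using assms(1) by (cases k) auto
  then have "[total (\<lambda>ks. sum_list (map (key_val_P P) ks)) ?C = 0] (mod 3 * q)"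
    unfolding cong_0_iff by (intro dvd_total dvd_sum_list) auto
  then have "[total keys_val ?C = 0 + 0] (mod 3 * q)"
    unfolding total_split
    by (intro cong_add cong_total_Q cancels_Q_Q assms)
  then show ?thesis
    by (simp add: total_cert cong_0_iff)
qed

end

section \<open>From the descent to the existence of a potential\<close>

lemma int_eq_0_if_powers_dvd:
  assumes "\<And>n. (3::int) ^ n dvd x"
  shows "x = 0"
proof (rule ccontr)
  assume "x \<noteq> 0"
  \<comment> \<open>The exponent \<open>\<bar>x\<bar>\<close> is already too large, since a nonzero
    multiple of \<open>3 ^ n\<close> is at least \<open>3 ^ n\<close> in absolute value.\<close>
  then have "3 ^ nat \<bar>x\<bar> \<le> \<bar>x\<bar>"
    using dvd_imp_le_int[OF _ assms[of "nat \<bar>x\<bar>"]] by simp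
  moreover have "int k < 3 ^ k" for k
  proof (induction k)
    case (Suc k)
    then show ?case
      unfolding of_nat_Suc power_Suc using zero_less_power[of "3::int" k] by linarith
  qed simp
  then have "int (nat \<bar>x\<bar>) < 3 ^ nat \<bar>x\<bar>" .
  ultimately show False
    by simp
qed

text \<open>The certificates treat one edge of each kind; pulling the relations back along the
  substitution \<open>s a b c d e f g\<close> carries the result to arbitrary arguments, repeated
  ones included. In each step \<open>P\<close> gains its factor 3 before \<open>Q\<close>, because
  the reduction of \<open>Q\<close> ends in terms \<open>P\<close>.\<close>

lemma gauged_int_relations_eq_0:
  fixes P Q :: "'v \<Rightarrow> 'v \<Rightarrow> 'v \<Rightarrow> 'v \<Rightarrow> 'v \<Rightarrow> 'v \<Rightarrow> 'v \<Rightarrow> int"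
  assumes "gauged_relations P Q"
  shows "P a b c d e f g = 0" and "Q a b c d e f g = 0"
proof -
  interpret gauged_relations P Q
    by (fact assms)
  define s where "s a b c d e f g x =
      (case x of Xa \<Rightarrow> a | Xb \<Rightarrow> b | Xc \<Rightarrow> c | Xd \<Rightarrow> d | Xe \<Rightarrow> e | Xf \<Rightarrow> f | Xg \<Rightarrow> g)"
    for a b c d e f g :: 'v and x
  have sub: "var7_relations
      (\<lambda>x1 x2 x3 x4 x5 x6 x7. P (t x1) (t x2) (t x3) (t x4) (t x5) (t x6) (t x7))
      (\<lambda>x1 x2 x3 x4 x5 x6 x7. Q (t x1) (t x2) (t x3) (t x4) (t x5) (t x6) (t x7))" for t
    unfolding var7_relations_def by (rule gauged_relations_subst)
  have "(\<forall>a b c d e f g. 3 ^ n dvd P a b c d e f g) \<and> (\<forall>a b c d e f g. 3 ^ n dvd Q a b c d e f g)" for n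
  proof (induction n)
    case (Suc n)
    then have P_n: "3 ^ n dvd P a b c d e f g" and Q_n: "3 ^ n dvd Q a b c d e f g" for a b c d e f g
      by blast+
    have "3 * 3 ^ n dvd P (t Xa) (t Xb) (t Xc) (t Xd) (t Xe) (t Xf) (t Xg)" for t
      by (rule var7_relations.dvd_P[OF sub[of t]]) (rule P_n Q_n)+
    from this[of "s a b c d e f g" for a b c d e f g]
    have P: "3 ^ Suc n dvd P a b c d e f g" for a b c d e f g
      by (simp add: s_def)
    then have P_Suc: "3 * 3 ^ n dvd P a b c d e f g" for a b c d e f g
      by simp
    have "3 * 3 ^ n dvd Q (t Xa) (t Xb) (t Xc) (t Xd) (t Xe) (t Xf) (t Xg)" for t
      by (rule var7_relations.dvd_Q[OF sub[of t]]) (rule P_Suc Q_n)+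
    from this[of "s a b c d e f g" for a b c d e f g]
    have "3 ^ Suc n dvd Q a b c d e f g" for a b c d e f g
      by (simp add: s_def)
    with P show ?case
      by blast
  qed simp
  then show "P a b c d e f g = 0" and "Q a b c d e f g = 0"
    by (auto intro: int_eq_0_if_powers_dvd)
qed

lemma common_denominator:
  fixes S :: "rat set"
  assumes "finite S"
  obtains N :: int where "N > 0" and "\<And>x. x \<in> S \<Longrightarrow> of_int N * x \<in> \<int>"
proof -
  have "\<exists>N::int. N > 0 \<and> (\<forall>x\<in>S. of_int N * x \<in> \<int>)"
    using assms
  proof (induction S)
    case (insert x S)
    then obtain N :: int where N: "N > 0" "\<forall>y\<in>S. of_int N * y \<in> \<int>"
      by blast
    obtain p q where x: "quotient_of x = (p, q)"
      by fastforce
    have "q > 0" and "of_int q * x = of_int p"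
      using quotient_of_denom_pos[OF x] quotient_of_div[OF x] by auto
    have "of_int (N * q) * y \<in> \<int>" if "y \<in> insert x S" for y
    proof (cases "y = x")
      case True
      have "of_int (N * q) * x = of_int N * (of_int q * x)"
        by simp
      also have "\<dots> \<in> \<int>"
        unfolding \<open>of_int q * x = of_int p\<close> by simp
      finally show ?thesis
        using True by simp
    next
      case False
      then have "of_int q * (of_int N * y) \<in> \<int>"
        using N that Ints_mult[OF Ints_of_int[of q], of "of_int N * y"] by auto
      then show ?thesis
        by (simp add: algebra_simps)
    qed
    then show ?case
      using N \<open>q > 0\<close> by (intro exI[of _ "N * q"]) simp
  qed (auto intro: exI[of _ 1])
  then show ?thesis
    using that by blast
qed

text \<open>All relations are linear and homogeneous, so they survive multiplication by a common
  denominator. One exists because finitely many letters give finitely many values.\<close>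

lemma gauged_rat_relations_eq_0:
  fixes P Q :: "'v::finite \<Rightarrow> 'v \<Rightarrow> 'v \<Rightarrow> 'v \<Rightarrow> 'v \<Rightarrow> 'v \<Rightarrow> 'v \<Rightarrow> rat"
  assumes "gauged_relations P Q"
  shows "P a b c d e f g = 0" and "Q a b c d e f g = 0"
proof -
  interpret gauged_relations P Q
    by (fact assms)
  let ?S = "\<lambda>T. range (\<lambda>(a, b, c, d, e, f, g). T a b c d e f g :: rat)"
  obtain N :: int where N: "N > 0" "\<And>x. x \<in> ?S P \<union> ?S Q \<Longrightarrow> of_int N * x \<in> \<int>"
    by (rule common_denominator[of "?S P \<union> ?S Q"]) auto
  \<comment> \<open>The floor merely changes the type: by the choice of \<open>N\<close> its
    argument is an integer.\<close>
  define P' where "P' a b c d e f g = \<lfloor>of_int N * P a b c d e f g\<rfloor>" for a b c d e f g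
  define Q' where "Q' a b c d e f g = \<lfloor>of_int N * Q a b c d e f g\<rfloor>" for a b c d e f g
  have of_int_floor: "of_int \<lfloor>of_int N * T a b c d e f g\<rfloor> = of_int N * T a b c d e f g"
    if "?S T \<subseteq> ?S P \<union> ?S Q" for T a b c d e f g
  proof -
    have "T a b c d e f g \<in> ?S T"
      by (rule range_eqI[of _ _ "(a, b, c, d, e, f, g)"]) simp
    with that have "of_int N * T a b c d e f g \<in> \<int>"
      by (intro N(2)) (rule subsetD)
    then show ?thesis
      by (elim Ints_cases) simp
  qed
  have P': "of_int (P' a b c d e f g) = of_int N * P a b c d e f g" for a b c d e f g
    unfolding P'_def by (rule of_int_floor) (rule Un_upper1)
  have Q': "of_int (Q' a b c d e f g) = of_int N * Q a b c d e f g" for a b c d e f g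
    unfolding Q'_def by (rule of_int_floor) (rule Un_upper2)
  have "gauged_relations P' Q'"
  proof unfold_locales
    fix a b c d e f g
    \<comment> \<open>An integer relation is checked in the rationals, where it is \<open>N\<close>
      times the given one.\<close>
    have int0: "x = 0" if "(of_int x :: rat) = of_int N * y" "y = 0" for x :: int and y
      using that by simp
    show "P' d c b a e f g = P' a b c d e f g" "Q' a e d c b f g = Q' a b c d e f g"
      by (simp_all add: P'_def Q'_def P_sym Q_sym)
    show "P' a b c d e f g + P' a b f e d c g + P' d c f e a b g
      - Q' g b a d c f e - Q' g b a e f c d - Q' g c d e f b a = 0"
      by (rule int0[OF _ rel1[of a b c d e f g]]) (simp add: P' Q' algebra_simps)
    show "P' a b c d e f g - P' a b g f e c d + P' a b d c e g f - P' a b f g e d c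
      + P' a e c d b g f - P' a e g f b d c + P' a e d c b f g - P' a e f g b c d
      - Q' a b c d e f g + Q' a b g f e c d - Q' a b d c e g f + Q' a b f g e d c = 0"
      by (rule int0[OF _ rel2[of a b c d e f g]]) (simp add: P' Q' algebra_simps)
    show "P' a b c d e f g - P' a f g c b e d + P' c b a d e g f + P' f b c e g a d
      - P' f g a e c b d - P' f g a d b c e - P' f g e d a b c + P' g b a e f c d
      - P' g f c e a b d - P' g f c d b a e - P' g f e d c b a + P' e a b d c f g
      + P' e c b d a g f + Q' a b c g f e d + Q' c b a f g e d - Q' f b c e g a d
      - Q' g b a e f c d + Q' e a g f c b d = 0"
      by (rule int0[OF _ rel3[of a b c d e f g]]) (simp add: P' Q' algebra_simps)
    show "gauge P' Q' a b c d e f g = 0"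
      by (rule int0[OF _ gauge_eq_0[of a b c d e f g]])
        (simp add: gauge_def walk_def P' Q' algebra_simps)
  qed
  then have "P' a b c d e f g = 0" and "Q' a b c d e f g = 0"
    by (rule gauged_int_relations_eq_0)+
  with P'[of a b c d e f g] Q'[of a b c d e f g] N(1)
  show "P a b c d e f g = 0" and "Q a b c d e f g = 0"
    by auto
qed

text \<open>\<open>P_fix\<close> and \<open>Q_fix\<close> satisfy the relations and have vanishing
  \<open>gauge\<close>, so the descent makes them 0. Hence every solution has the form g(u) + g(v),
  with g a quarter of the \<open>gauge\<close>.\<close>

lemma tetrad_relations_potential:
  fixes P Q :: "'v::finite \<Rightarrow> 'v \<Rightarrow> 'v \<Rightarrow> 'v \<Rightarrow> 'v \<Rightarrow> 'v \<Rightarrow> 'v \<Rightarrow> rat"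
  assumes "tetrad_relations P Q"
  shows "4 * P a b c d e f g = gauge P Q a b c d e f g + gauge P Q d c b a e f g"
    and "4 * Q a b c d e f g = gauge P Q a b c d e f g + gauge P Q a e d c b f g"
proof -
  interpret tetrad_relations P Q
    by (fact assms)
  show "4 * P a b c d e f g = gauge P Q a b c d e f g + gauge P Q d c b a e f g"
    and "4 * Q a b c d e f g = gauge P Q a b c d e f g + gauge P Q a e d c b f g"
    using gauged_rat_relations_eq_0[OF gauged_relations_fix, of a b c d e f g]
    by (simp_all add: P_fix_def Q_fix_def)
qed

section \<open>Evaluation of polynomials\<close>

locale rat_vector_space = vector_space scale
  for scale :: "rat \<Rightarrow> 'b::ab_group_add \<Rightarrow> 'b"
begin

lemma eval_poly_superset:
  assumes "finite M" "Poly_Mapping.keys p \<subseteq> M"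
  shows "eval_poly scale quad \<rho> p =
    (\<Sum>m\<in>M. scale (Poly_Mapping.lookup p m) (eval_monomial quad \<rho> m))"
  unfolding eval_poly_def using assms
  by (intro sum.mono_neutral_left) (auto simp: in_keys_iff)

lemma eval_poly_add:
  "eval_poly scale quad \<rho> (p + q) = eval_poly scale quad \<rho> p + eval_poly scale quad \<rho> q"
proof -
  let ?M = "Poly_Mapping.keys p \<union> Poly_Mapping.keys q"
  have "finite ?M" "Poly_Mapping.keys (p + q) \<subseteq> ?M"
    by (simp_all add: Poly_Mapping.keys_add)
  then show ?thesis
    by (simp add: eval_poly_superset[of ?M] lookup_add scale_left_distrib sum.distrib)
qed

lemma eval_poly_diff:
  "eval_poly scale quad \<rho> (p - q) = eval_poly scale quad \<rho> p - eval_poly scale quad \<rho> q"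
  using eval_poly_add[of quad \<rho> "p - q" q] by (simp add: algebra_simps)

lemma eval_poly_monomial: "eval_poly scale quad \<rho> \<langle>m\<rangle> = eval_monomial quad \<rho> m"
  by (simp add: eval_poly_def)

lemmas eval_poly_simps = eval_poly_add eval_poly_diff eval_poly_monomial

text \<open>A single nonzero vector is linearly independent, so the value 1 on it extends to a
  functional. This reduces the vanishing of a vector to the vanishing of rational numbers.\<close>

lemma exists_functional_neq_0:
  assumes "x \<noteq> 0"
  obtains \<phi> :: "'b \<Rightarrow> rat" where "Vector_Spaces.linear scale (*) \<phi>" "\<phi> x \<noteq> 0"
proof -
  interpret pair: vector_space_pair scale "(*) :: rat \<Rightarrow> rat \<Rightarrow> rat"
    by unfold_locales (simp_all add: algebra_simps)
  have "independent {x}"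
    using assms by simp
  from pair.linear_independent_extend[OF this, of "\<lambda>_. 1"] show ?thesis
    using that by auto
qed

end

lemma lookup_scale_free: "Poly_Mapping.lookup (scale_free c p) w = c * Poly_Mapping.lookup p w"
  by (simp add: scale_free_def Poly_Mapping.map.rep_eq when_def)

interpretation free_algebra: rat_vector_space scale_free
  by unfold_locales
    (auto intro!: poly_mapping_eqI simp: lookup_scale_free lookup_add algebra_simps)

lemma tetrad_identity_symmetry: "tetrad_identity (tetrad_symmetry a b c d)"
  by (simp add: tetrad_identity_def tetrad_symmetry_def free_algebra.eval_poly_simps tetrad_def)

lemma tetrad_identity_id1: "tetrad_identity (tetrad_id1 a b c d e f g)"
  by (simp add: tetrad_identity_def tetrad_id1_def free_algebra.eval_poly_simps tetrad_def algebra_simps)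

lemma tetrad_identity_id2: "tetrad_identity (tetrad_id2 a b c d e f g)"
  by (simp add: tetrad_identity_def tetrad_id2_def free_algebra.eval_poly_simps tetrad_def algebra_simps)

lemma tetrad_identity_id3: "tetrad_identity (tetrad_id3 a b c d e f g)"
  by (simp add: tetrad_identity_def tetrad_id3_def free_algebra.eval_poly_simps tetrad_def algebra_simps)

section \<open>Linear functionals on the free algebra, given by their values on words\<close>

definition extend :: "('x word \<Rightarrow> rat) \<Rightarrow> 'x free_algebra \<Rightarrow> rat" where
  "extend \<gamma> p = (\<Sum>w\<in>Poly_Mapping.keys p. Poly_Mapping.lookup p w * \<gamma> w)"

lemma extend_superset:
  assumes "finite W" "Poly_Mapping.keys p \<subseteq> W"
  shows "extend \<gamma> p = (\<Sum>w\<in>W. Poly_Mapping.lookup p w * \<gamma> w)"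
  unfolding extend_def using assms
  by (intro sum.mono_neutral_left) (auto simp: in_keys_iff)

lemma extend_0: "extend \<gamma> 0 = 0"
  by (simp add: extend_def)

lemma extend_add: "extend \<gamma> (p + q) = extend \<gamma> p + extend \<gamma> q"
proof -
  let ?W = "Poly_Mapping.keys p \<union> Poly_Mapping.keys q"
  have "finite ?W" "Poly_Mapping.keys (p + q) \<subseteq> ?W"
    by (simp_all add: Poly_Mapping.keys_add)
  then show ?thesis
    by (simp add: extend_superset[of ?W] lookup_add ring_distribs sum.distrib)
qed

lemma extend_scale: "extend \<gamma> (scale_free c p) = c * extend \<gamma> p"
proof -
  have "Poly_Mapping.keys (scale_free c p) \<subseteq> Poly_Mapping.keys p"
    by (auto simp: in_keys_iff lookup_scale_free)
  then show ?thesis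
    by (simp add: extend_superset[of "Poly_Mapping.keys p"] lookup_scale_free sum_distrib_left mult.assoc)
qed

lemma extend_sum: "extend \<gamma> (\<Sum>i\<in>I. p i) = (\<Sum>i\<in>I. extend \<gamma> (p i))"
  by (induction I rule: infinite_finite_induct) (simp_all add: extend_0 extend_add)

lemma extend_single: "extend \<gamma> (Poly_Mapping.single w 1) = \<gamma> w"
  by (simp add: extend_def)

lemma extend_eval_poly:
  "extend \<gamma> (eval_poly scale_free quad \<rho> p) =
     (\<Sum>m\<in>Poly_Mapping.keys p. Poly_Mapping.lookup p m * extend \<gamma> (eval_monomial quad \<rho> m))"
  by (simp add: eval_poly_def extend_sum extend_scale)

lemma single_word_mult:
  "Poly_Mapping.single (Word u) 1 * Poly_Mapping.single (Word v) 1 =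
     (Poly_Mapping.single (Word (u @ v)) 1 :: 'x free_algebra)"
  by (simp add: mult_single plus_word_def)

section \<open>Shapes of monomials with seven leaves\<close>

lemma length_leaves: "\<exists>k. length (leaves m) = 3 * k + 1"
proof (induction m)
  case (Quad p q r s)
  then obtain i j k l where "length (leaves p) = 3 * i + 1" "length (leaves q) = 3 * j + 1"
    "length (leaves r) = 3 * k + 1" "length (leaves s) = 3 * l + 1"
    by blast
  then show ?case
    by (intro exI[of _ "i + j + k + l + 1"]) simp
qed simp

lemma leaves_length_1:
  assumes "length (leaves m) = 1"
  obtains x where "m = Var x"
proof (cases m)
  case (Quad p q r s)
  with assms length_leaves[of p] length_leaves[of q] show ?thesis
    by auto
qed (use that in blast)

lemma leaves_length_4:
  assumes "length (leaves m) = 4"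
  obtains a b c d where "m = \<lbrace>Var a, Var b, Var c, Var d\<rbrace>"
proof (cases m)
  case (Quad p q r s)
  obtain i j k l where "length (leaves p) = 3 * i + 1" "length (leaves q) = 3 * j + 1"
    "length (leaves r) = 3 * k + 1" "length (leaves s) = 3 * l + 1"
    using length_leaves by meson
  with assms Quad have "length (leaves p) = 1" "length (leaves q) = 1"
    "length (leaves r) = 1" "length (leaves s) = 1"
    by auto
  then show ?thesis
    using that Quad by (metis leaves_length_1)
qed (use assms in simp)

text \<open>The four arguments have 1 modulo 3 leaves each, so a total of seven leaves forces one
  argument to have four and the other three to be variables. The cases differ in the position of the
  inner operation.\<close>

lemma leaves_length_7:
  assumes "length (leaves m) = 7"
  obtains (first) a b c d e f g where "m = \<lbrace>\<lbrace>Var a, Var b, Var c, Var d\<rbrace>, Var e, Var f, Var g\<rbrace>"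
  | (second) a b c d e f g where "m = \<lbrace>Var a, \<lbrace>Var b, Var c, Var d, Var e\<rbrace>, Var f, Var g\<rbrace>"
  | (third) a b c d e f g where "m = \<lbrace>Var a, Var b, \<lbrace>Var c, Var d, Var e, Var f\<rbrace>, Var g\<rbrace>"
  | (fourth) a b c d e f g where "m = \<lbrace>Var a, Var b, Var c, \<lbrace>Var d, Var e, Var f, Var g\<rbrace>\<rbrace>"
proof (cases m)
  case (Quad p q r s)
  let ?l = "\<lambda>n. length (leaves n)"
  obtain i j k l where l: "?l p = 3 * i + 1" "?l q = 3 * j + 1" "?l r = 3 * k + 1" "?l s = 3 * l + 1"
    using length_leaves by meson
  with assms Quad have "i + j + k + l = 1"
    by simp
  then consider "i = 1" "j = 0" "k = 0" "l = 0" | "i = 0" "j = 1" "k = 0" "l = 0"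
    | "i = 0" "j = 0" "k = 1" "l = 0" | "i = 0" "j = 0" "k = 0" "l = 1"
    by linarith
  then consider "?l p = 4" "?l q = 1" "?l r = 1" "?l s = 1" | "?l p = 1" "?l q = 4" "?l r = 1" "?l s = 1"
    | "?l p = 1" "?l q = 1" "?l r = 4" "?l s = 1" | "?l p = 1" "?l q = 1" "?l r = 1" "?l s = 4"
    by cases (auto simp: l)
  then show ?thesis
  proof cases
    case 1
    then show ?thesis
      using Quad first by (metis leaves_length_1 leaves_length_4)
  next
    case 2
    then show ?thesis
      using Quad second by (metis leaves_length_1 leaves_length_4)
  next
    case 3
    then show ?thesis
      using Quad third by (metis leaves_length_1 leaves_length_4)
  next
    case 4
    then show ?thesis
      using Quad fourth by (metis leaves_length_1 leaves_length_4)
  qed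
qed (use assms in simp)

section \<open>Algebras satisfying the identities\<close>

sublocale quaternary_algebra \<subseteq> rat_vector_space
  by unfold_locales

locale tetrad_algebra = quaternary_algebra scale quad
  for scale :: "rat \<Rightarrow> 'a::ab_group_add \<Rightarrow> 'a" and quad +
  assumes identities: "p \<in> tetrad_id_set \<Longrightarrow> satisfies scale quad p"
begin

lemma eval_identity: "p \<in> tetrad_id_set \<Longrightarrow> eval_poly scale quad \<rho> p = 0"
  using identities by (simp add: satisfies_def)

definition assign :: "'a \<Rightarrow> 'a \<Rightarrow> 'a \<Rightarrow> 'a \<Rightarrow> 'a \<Rightarrow> 'a \<Rightarrow> 'a \<Rightarrow> var7 \<Rightarrow> 'a" where
  "assign a b c d e f g x =
     (case x of Xa \<Rightarrow> a | Xb \<Rightarrow> b | Xc \<Rightarrow> c | Xd \<Rightarrow> d | Xe \<Rightarrow> e | Xf \<Rightarrow> f | Xg \<Rightarrow> g)"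

lemma quad_sym: "quad d c b a = quad a b c d"
  \<comment> \<open>The symmetry involves only \<open>Xa\<close> to \<open>Xd\<close>; the remaining
    three letters receive \<open>a\<close> as a filler.\<close>
  using eval_identity[of "tetrad_symmetry (Var Xa) (Var Xb) (Var Xc) (Var Xd)" "assign a b c d a a a"]
  by (simp add: tetrad_id_set_def tetrad_symmetry_def eval_poly_simps assign_def)

lemma tetrad_relations_functional:
  assumes "Vector_Spaces.linear scale (*) \<phi>"
  shows "tetrad_relations
    (\<lambda>a b c d e f g. \<phi> (quad (quad (\<rho> a) (\<rho> b) (\<rho> c) (\<rho> d)) (\<rho> e) (\<rho> f) (\<rho> g)))
    (\<lambda>a b c d e f g. \<phi> (quad (\<rho> a) (quad (\<rho> b) (\<rho> c) (\<rho> d) (\<rho> e)) (\<rho> f) (\<rho> g)))"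
proof -
  interpret \<phi>: Vector_Spaces.linear scale "(*)" \<phi>
    by (fact assms)
  \<comment> \<open>Linearity read backwards collects the values of \<open>\<phi>\<close> into
    \<open>\<phi>\<close> of a single element, which is 0 by an identity of the algebra.\<close>
  note lin = \<phi>.add[symmetric] \<phi>.diff[symmetric]
  show ?thesis
  proof (unfold_locales, goal_cases)
    case (1 d c b a e f g)
    show ?case by (simp add: quad_sym[of "\<rho> d"])
  next
    case (2 a e d c b f g)
    show ?case by (simp add: quad_sym[of "\<rho> e" "\<rho> d" "\<rho> c" "\<rho> b"])
  next
    case (3 a b c d e f g)
    show ?case
      unfolding lin
      using eval_identity[of "tetrad_id1 (Var Xa) (Var Xb) (Var Xc) (Var Xd) (Var Xe) (Var Xf) (Var Xg)"
          "assign (\<rho> a) (\<rho> b) (\<rho> c) (\<rho> d) (\<rho> e) (\<rho> f) (\<rho> g)"]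
      by (simp add: tetrad_id_set_def tetrad_id1_def eval_poly_simps assign_def)
  next
    case (4 a b c d e f g)
    show ?case
      unfolding lin
      using eval_identity[of "tetrad_id2 (Var Xa) (Var Xb) (Var Xc) (Var Xd) (Var Xe) (Var Xf) (Var Xg)"
          "assign (\<rho> a) (\<rho> b) (\<rho> c) (\<rho> d) (\<rho> e) (\<rho> f) (\<rho> g)"]
      by (simp add: tetrad_id_set_def tetrad_id2_def eval_poly_simps assign_def)
  next
    case (5 a b c d e f g)
    show ?case
      unfolding lin
      using eval_identity[of "tetrad_id3 (Var Xa) (Var Xb) (Var Xc) (Var Xd) (Var Xe) (Var Xf) (Var Xg)"
          "assign (\<rho> a) (\<rho> b) (\<rho> c) (\<rho> d) (\<rho> e) (\<rho> f) (\<rho> g)"]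
      by (simp add: tetrad_id_set_def tetrad_id3_def eval_poly_simps assign_def)
  qed
qed

text \<open>The expansion of a monomial with two operations has four words: the two ends of its edge
  and their reversals. The potential at a vertex is \<open>G / 4\<close>, and a word and its
  reversal share it equally, hence the 8.\<close>

fun weight ::
  "(var7 \<Rightarrow> var7 \<Rightarrow> var7 \<Rightarrow> var7 \<Rightarrow> var7 \<Rightarrow> var7 \<Rightarrow> var7 \<Rightarrow> rat) \<Rightarrow> var7 word \<Rightarrow> rat" where
  "weight G (Word [a, b, c, d, e, f, g]) = G a b c d e f g / 8"
| "weight G _ = 0"

text \<open>On monomials of degree 7 the functional factors through the expansion in the free
  algebra. What matters is that one \<open>\<gamma>\<close> serves all monomials, so that linear
  relations between expansions carry over to the algebra.\<close>

lemma functional_eval_monomial: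
  fixes \<rho> :: "var7 \<Rightarrow> 'a"
  assumes "Vector_Spaces.linear scale (*) \<phi>"
  obtains \<gamma> where "\<And>m. length (leaves m) = 7 \<Longrightarrow>
    \<phi> (eval_monomial quad \<rho> m) = extend \<gamma> (eval_monomial tetrad generator m)"
proof -
  define P where "P a b c d e f g =
    \<phi> (quad (quad (\<rho> a) (\<rho> b) (\<rho> c) (\<rho> d)) (\<rho> e) (\<rho> f) (\<rho> g))" for a b c d e f g
  define Q where "Q a b c d e f g =
    \<phi> (quad (\<rho> a) (quad (\<rho> b) (\<rho> c) (\<rho> d) (\<rho> e)) (\<rho> f) (\<rho> g))" for a b c d e f g
  have "tetrad_relations P Q"
    unfolding P_def Q_def by (rule tetrad_relations_functional[OF assms])
  note potential = tetrad_relations_potential[OF this]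
  define G where "G = gauge P Q"
  have G_rev: "G g f e d c b a = G a b c d e f g" for a b c d e f g
    unfolding G_def by (rule gauge_rev)
  have P: "P a b c d e f g = (G a b c d e f g + G d c b a e f g) / 4" for a b c d e f g
    using potential(1)[of a b c d e f g] by (simp add: G_def)
  have Q: "Q a b c d e f g = (G a b c d e f g + G a e d c b f g) / 4" for a b c d e f g
    using potential(2)[of a b c d e f g] by (simp add: G_def)
  note tetrad_simps = tetrad_def generator_def distrib_left distrib_right single_word_mult
    extend_add extend_single add_divide_distrib
  have "\<phi> (eval_monomial quad \<rho> m) = extend (weight G) (eval_monomial tetrad generator m)"
    if "length (leaves m) = 7" for m
    using that
  proof (cases m rule: leaves_length_7)
    case (first a b c d e f g)
    then have "\<phi> (eval_monomial quad \<rho> m) = P a b c d e f g"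
      by (simp add: P_def)
    also have "\<dots> = extend (weight G) (eval_monomial tetrad generator m)"
      unfolding P using first by (simp add: tetrad_simps G_rev)
    finally show ?thesis .
  next
    case (second a b c d e f g)
    then have "\<phi> (eval_monomial quad \<rho> m) = Q a b c d e f g"
      by (simp add: Q_def)
    also have "\<dots> = extend (weight G) (eval_monomial tetrad generator m)"
      unfolding Q using second by (simp add: tetrad_simps G_rev)
    finally show ?thesis .
  next
    case (third a b c d e f g)
    \<comment> \<open>The outer symmetry turns the third place into the second and reverses the
      other three arguments; the expansion is unchanged, so \<open>Q\<close> covers this shape. The
      fourth place is likewise turned into the first and covered by \<open>P\<close>.\<close>
    then have "\<phi> (eval_monomial quad \<rho> m) = Q g c d e f b a"
      by (simp add: Q_def quad_sym[of "\<rho> a" "\<rho> b" _ "\<rho> g"])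
    also have "\<dots> = extend (weight G) (eval_monomial tetrad generator m)"
      unfolding Q using third by (simp add: tetrad_simps G_rev)
    finally show ?thesis .
  next
    case (fourth a b c d e f g)
    then have "\<phi> (eval_monomial quad \<rho> m) = P d e f g c b a"
      by (simp add: P_def quad_sym[of "\<rho> a" "\<rho> b" "\<rho> c"])
    also have "\<dots> = extend (weight G) (eval_monomial tetrad generator m)"
      unfolding P using fourth by (simp add: tetrad_simps G_rev)
    finally show ?thesis .
  qed
  then show ?thesis
    using that by blast
qed

lemma satisfies_tetrad_identity:
  assumes "multilinear7 I" "tetrad_identity I"
  shows "satisfies scale quad I"
  unfolding satisfies_def
proof (intro allI, rule ccontr)
  fix \<rho>
  assume "eval_poly scale quad \<rho> I \<noteq> 0"
  then obtain \<phi> where \<phi>: "Vector_Spaces.linear scale (*) \<phi>" "\<phi> (eval_poly scale quad \<rho> I) \<noteq> 0"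
    by (rule exists_functional_neq_0)
  interpret \<phi>: Vector_Spaces.linear scale "(*)" \<phi>
    by (fact \<phi>(1))
  obtain \<gamma> where \<gamma>: "\<And>m. length (leaves m) = 7 \<Longrightarrow>
      \<phi> (eval_monomial quad \<rho> m) = extend \<gamma> (eval_monomial tetrad generator m)"
    using functional_eval_monomial[OF \<phi>(1)] by metis
  have "length (leaves m) = 7" if "m \<in> Poly_Mapping.keys I" for m
  proof -
    have "distinct (leaves m)" "set (leaves m) = UNIV"
      using assms(1) that by (auto simp: multilinear7_def)
    then have "length (leaves m) = card (UNIV :: var7 set)"
      by (metis distinct_card)
    then show ?thesis
      by (simp add: UNIV_var7)
  qed
  \<comment> \<open>Since \<open>\<gamma>\<close> does not depend on the monomial, it can be pulled
    out of the sum over the terms of \<open>I\<close>.\<close>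
  then have "\<phi> (eval_poly scale quad \<rho> I) = extend \<gamma> (eval_poly scale_free tetrad generator I)"
    unfolding extend_eval_poly by (simp add: eval_poly_def \<phi>.sum \<phi>.scale \<gamma>)
  also have "\<dots> = 0"
    using assms(2) by (simp add: tetrad_identity_def extend_0)
  finally show False
    using \<phi>(2) by simp
qed

end

theorem theorem3p2:
  shows "(\<forall>p\<in>tetrad_id_set. tetrad_identity p) \<and>
    (\<forall>I. multilinear7 I \<and> tetrad_identity I \<longrightarrow>
       consequence TYPE('a::ab_group_add) tetrad_id_set I)"
proof (intro conjI ballI allI impI)
  fix p :: "var7 quad_poly"
  assume "p \<in> tetrad_id_set"
  then show "tetrad_identity p"
    by (auto simp: tetrad_id_set_def tetrad_identity_symmetry tetrad_identity_id1
        tetrad_identity_id2 tetrad_identity_id3)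
next
  fix I
  assume I: "multilinear7 I \<and> tetrad_identity I"
  show "consequence TYPE('a) tetrad_id_set I"
    unfolding consequence_def
  proof (intro allI impI)
    fix scale :: "rat \<Rightarrow> 'a \<Rightarrow> 'a" and quad
    assume "quaternary_algebra scale quad" "\<forall>s\<in>tetrad_id_set. satisfies scale quad s"
    then interpret tetrad_algebra scale quad
      by (simp add: tetrad_algebra_def tetrad_algebra_axioms_def)
    show "satisfies scale quad I"
      using I by (intro satisfies_tetrad_identity) auto
  qed
qed

end
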